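(* Let $(W,Q,\psi)$ be an $L$-twisted $\mathrm{GL}(n,\mathbb R)$-Higgs pair over a compact Riemann surface $X$. (1) $(W,Q,\psi)$ is semistable if and only if $\deg(W')\le0$ for any isotropic and $\psi$-invariant subbundle $W'\subset W$. (2) $(W,Q,\psi)$ is stable if and only if it is semistable and $\deg(W')<0$ for any isotropic and $\psi$-invariant strict subbundle $0\ne W'\subset W$. (3) $(W,Q,\psi)$ is polystable if and only if it is semistable and, for any isotropic (resp. coisotropic) and $\psi$-invariant strict subbundle $0\neq W'\subset W$ such that $\deg(W')=0$, there is another coisotropic (resp. isotropic) and $\psi$-invariant subbundle $0\ne W''\subset W$ such that $W\simeq W'\oplus W''$.
   Context: $L$ is a holomorphic line bundle on $X$. An $L$-twisted $\mathrm{GL}(n,\mathbb R)$-Higgs pair is a triple $(W,Q,\psi)$: a rank $n$ holomorphic vector bundle $W$ with a (holomorphic, fibrewise) non-degenerate quadratic form $Q$, and $\psi\in H^0(L\otimes S^2W)$; equivalently, via $Q:W\simeq W^*$, a section of $L\otimes S^2_QW$, where $S^2_QW$ is the bundle of endomorphisms of $W$ symmetric with respect to $Q$. $W'\subset W$ is $\psi$-invariant if the corresponding $L$-valued endomorphism $\psi\circ Q:W\to W\otimes L$ maps $W'$ into $W'\otimes L$. $\perp_Q$ denotes the orthogonal with respect to $Q$; $W'$ is isotropic if $W'\subset W'^{\perp_Q}$ and coisotropic if $W'\supset W'^{\perp_Q}$. $W'\otimes_SW''$ is the image of $W'\otimes W''$ in $S^2W$ under symmetrization. Subbundles are holomorphic.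 For a filtration $\mathcal W=(0=W_0\subsetneq W_1\subsetneq\dots\subsetneq W_k=W)$ by subbundles with $W_j=W_{k-j}^{\perp_Q}$ let $\Lambda(\mathcal W)=\{\lambda\in\mathbb R^k:\lambda_i\le\lambda_{i+1},\ \lambda_i+\lambda_{k-i+1}=0\text{ for all }i\}$; for $\lambda\in\Lambda(\mathcal W)$ let $N(\mathcal W,\lambda)=\sum_{\lambda_i+\lambda_j\le0}L\otimes W_i\otimes_SW_j$ and $d(\mathcal W,\lambda)=\sum_{j=1}^{k-1}(\lambda_j-\lambda_{j+1})\deg W_j$. $(W,Q,\psi)$ is: - semistable if $d(\mathcal W,\lambda)\ge0$ for all such $\mathcal W$ and all $\lambda\in\Lambda(\mathcal W)$ with $\psi\in H^0(N(\mathcal W,\lambda))$; - stable if it is semistable and $d(\mathcal W,\lambda)>0$ for all such $\mathcal W$ and all nonzero $\lambda\in\Lambda(\mathcal W)$ with $\psi\in H^0(N(\mathcal W,\lambda))$; - polystable if it is semistable and for all such $\mathcal W$ and $\lambda\in\Lambda(\mathcal W)$ with $\lambda_i<\lambda_{i+1}$ for each $i$, $\psi\in H^0(N(\mathcal W,\lambda))$ and $d(\mathcal W,\lambda)=0$, there is an isomorphism $W\simeq W_1\oplus W_2/W_1\oplus\dots\oplus W_k/W_{k-1}$ (under which $W_j$ corresponds to the sum of the first $j$ summands) such that the $Q$-pairing of an element of $W_i/W_{i-1}$ with one of $W_j/W_{j-1}$ is zero unless $i+j=k+1$, and via which $\psi\in H^0\big(\bigoplus_{\lambda_i+\lambda_j=0}L\otimes(W_i/W_{i-1})\otimes_S(W_j/W_{j-1})\big)$.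 *)

theory Defs
  imports "HOL-Analysis.Analysis"
begin

section \<open>Riemann surfaces\<close>

text \<open>
  A surface is a Hausdorff topological type together with a set of charts (domain, coordinate).
  Only the values of a coordinate on its domain matter.
\<close>

type_synonym 'x atlas = "('x set \<times> ('x \<Rightarrow> complex)) set"

definition hol_fun :: "'x atlas \<Rightarrow> 'x set \<Rightarrow> ('x \<Rightarrow> complex) \<Rightarrow> bool" where
  "hol_fun A U f \<longleftrightarrow> (\<forall>(V, \<phi>)\<in>A. (\<lambda>z. f (inv_into V \<phi> z)) holomorphic_on \<phi> ` (U \<inter> V))"

definition compact_riemann_surface :: "('x::t2_space) atlas \<Rightarrow> bool" where
  "compact_riemann_surface A \<longleftrightarrow>
     compact (UNIV :: 'x set) \<and> connected (UNIV :: 'x set) \<and>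
     (\<forall>x. \<exists>(U, \<phi>)\<in>A. x \<in> U) \<and>
     (\<forall>(U, \<phi>)\<in>A. open U \<and> open (\<phi> ` U) \<and> homeomorphism U (\<phi> ` U) \<phi> (inv_into U \<phi>)) \<and>
     (\<forall>(U, \<phi>)\<in>A. hol_fun A U \<phi>)"

section \<open>Holomorphic vector bundles\<close>

text \<open>
  A rank \<open>n\<close> bundle is given by its local trivializations. As a bare set each fibre is identified,
  pointwise and by an arbitrary choice of basis, with \<open>\<complex>\<^sup>n\<close>; this identification carries neither
  topology nor holomorphic structure, so it does not make the bundle trivial. All of the structure
  is in the pairs \<open>(U, t)\<close>: \<open>t x\<close> is the linear isomorphism from the fibre over \<open>x\<close> to \<open>\<complex>\<^sup>n\<close> given
  by a holomorphic trivialization over \<open>U\<close>, no regularity of \<open>t\<close> itself is required, and only the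
  transition functions \<open>t' x ** matrix_inv (t x)\<close> have to be holomorphic. By choosing a basis of
  every fibre, every holomorphic vector bundle is isomorphic to one of this form. A line bundle is
  a bundle with the one-element index type.
\<close>

type_synonym ('x, 'n) vbundle = "('x set \<times> ('x \<Rightarrow> ((complex, 'n) vec, 'n) vec)) set"

definition hol_vbundle :: "('x::topological_space) atlas \<Rightarrow> ('x, 'n::finite) vbundle \<Rightarrow> bool" where
  "hol_vbundle A W \<longleftrightarrow>
     (\<forall>(U, t)\<in>W. open U \<and> (\<forall>x\<in>U. invertible (t x))) \<and>
     (\<forall>x. \<exists>(U, t)\<in>W. x \<in> U) \<and>
     (\<forall>(U, t)\<in>W. \<forall>(U', t')\<in>W. \<forall>i j.
        hol_fun A (U \<inter> U') (\<lambda>x. (t' x ** matrix_inv (t x)) $ i $ j))"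

definition hol_section ::
  "'x atlas \<Rightarrow> ('x, 'n::finite) vbundle \<Rightarrow> 'x set \<Rightarrow> ('x \<Rightarrow> complex ^ 'n) \<Rightarrow> bool" where
  "hol_section A W U s \<longleftrightarrow> (\<forall>(V, t)\<in>W. \<forall>i. hol_fun A (U \<inter> V) (\<lambda>x. (t x *v s x) $ i))"

text \<open>
  Over a field, the prefix \<open>vec\<close> selects linear algebra over that field, here \<open>\<complex>\<close>.
\<close>

definition local_frame ::
  "('x::topological_space) atlas \<Rightarrow> ('x, 'n::finite) vbundle \<Rightarrow> ('x \<Rightarrow> (complex ^ 'n) set) \<Rightarrow>
   nat \<Rightarrow> 'x set \<Rightarrow> (nat \<Rightarrow> 'x \<Rightarrow> complex ^ 'n) \<Rightarrow> bool" where
  "local_frame A W S r U s \<longleftrightarrow>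
     open U \<and> (\<forall>i<r. hol_section A W U (s i)) \<and>
     (\<forall>x\<in>U. inj_on (\<lambda>i. s i x) {..<r} \<and> vec.independent ((\<lambda>i. s i x) ` {..<r}) \<and>
             vec.span ((\<lambda>i. s i x) ` {..<r}) = S x)"

definition hol_subbundle ::
  "('x::topological_space) atlas \<Rightarrow> ('x, 'n::finite) vbundle \<Rightarrow> ('x \<Rightarrow> (complex ^ 'n) set) \<Rightarrow> bool" where
  "hol_subbundle A W S \<longleftrightarrow> (\<exists>r. \<forall>x. \<exists>U s. x \<in> U \<and> local_frame A W S r U s)"

abbreviation zero_sub :: "'x \<Rightarrow> (complex ^ 'n) set" where
  "zero_sub \<equiv> \<lambda>x. {0}"

abbreviation whole_sub :: "'x \<Rightarrow> (complex ^ 'n) set" where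
  "whole_sub \<equiv> \<lambda>x. UNIV"

section \<open>Degree\<close>

definition pdx :: "(complex \<Rightarrow> 'b::real_normed_vector) \<Rightarrow> complex \<Rightarrow> 'b" where
  "pdx f z = frechet_derivative f (at z) 1"

definition pdy :: "(complex \<Rightarrow> 'b::real_normed_vector) \<Rightarrow> complex \<Rightarrow> 'b" where
  "pdy f z = frechet_derivative f (at z) \<i>"

definition laplacian :: "(complex \<Rightarrow> real) \<Rightarrow> complex \<Rightarrow> real" where
  "laplacian f z = pdx (pdx f) z + pdy (pdy f) z"

fun Ck_on :: "nat \<Rightarrow> complex set \<Rightarrow> (complex \<Rightarrow> 'b::real_normed_vector) \<Rightarrow> bool" where
  "Ck_on 0 S f \<longleftrightarrow> continuous_on S f"
| "Ck_on (Suc k) S f \<longleftrightarrow>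
     (\<forall>z\<in>S. f differentiable (at z)) \<and> Ck_on k S (pdx f) \<and> Ck_on k S (pdy f)"

definition smooth_fun :: "'x atlas \<Rightarrow> 'x set \<Rightarrow> ('x \<Rightarrow> 'b::real_normed_vector) \<Rightarrow> bool" where
  "smooth_fun A U f \<longleftrightarrow>
     (\<forall>(V, \<phi>)\<in>A. \<forall>k. Ck_on k (\<phi> ` (U \<inter> V)) (\<lambda>z. f (inv_into V \<phi> z)))"

text \<open>Smooth Hermitian metrics on a subbundle \<open>S\<close> (linear in the first argument).\<close>

definition hermitian_metric ::
  "('x::topological_space) atlas \<Rightarrow> ('x, 'n::finite) vbundle \<Rightarrow> ('x \<Rightarrow> (complex ^ 'n) set) \<Rightarrow>
   ('x \<Rightarrow> complex ^ 'n \<Rightarrow> complex ^ 'n \<Rightarrow> complex) \<Rightarrow> bool" where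
  "hermitian_metric A W S h \<longleftrightarrow>
     (\<forall>x. \<forall>u\<in>S x. \<forall>v\<in>S x.
        (\<forall>w\<in>S x. \<forall>a b. h x (a *s u + b *s v) w = a * h x u w + b * h x v w) \<and>
        h x v u = cnj (h x u v) \<and> (u \<noteq> 0 \<longrightarrow> 0 < Re (h x u u))) \<and>
     (\<forall>r U s. local_frame A W S r U s \<longrightarrow>
        (\<forall>i<r. \<forall>j<r. smooth_fun A U (\<lambda>x. h x (s i x) (s j x))))"

text \<open>Determinant of the leading \<open>r \<times> r\<close> block, by the Leibniz formula.\<close>

definition det_n :: "nat \<Rightarrow> (nat \<Rightarrow> nat \<Rightarrow> complex) \<Rightarrow> complex" where
  "det_n r M = (\<Sum>p | p permutes {..<r}. of_int (sign p) * (\<Prod>i<r. M i (p i)))"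

text \<open>
  A real 2-form is given by its densities with respect to \<open>dx \<and> dy\<close> in the charts.
  In a holomorphic frame with Gram matrix \<open>H\<close>, the curvature \<open>F\<close> of the Chern connection satisfies
  \<open>tr F = - \<partial>\<close>dbar\<open> (log det H)\<close>, so \<open>(\<i>/2\<pi>) tr F\<close> has density
  \<open>- \<Delta> (log det H) / (4\<pi>)\<close>. This is the form representing the first Chern class.
\<close>

type_synonym 'x two_form = "'x set \<times> ('x \<Rightarrow> complex) \<Rightarrow> complex \<Rightarrow> real"

definition chern_form ::
  "('x::topological_space) atlas \<Rightarrow> ('x, 'n::finite) vbundle \<Rightarrow> ('x \<Rightarrow> (complex ^ 'n) set) \<Rightarrow>
   ('x \<Rightarrow> complex ^ 'n \<Rightarrow> complex ^ 'n \<Rightarrow> complex) \<Rightarrow> 'x two_form \<Rightarrow> bool" where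
  "chern_form A W S h \<omega> \<longleftrightarrow>
     (\<forall>(V, \<phi>)\<in>A. \<forall>r U s. local_frame A W S r U s \<longrightarrow>
        (\<forall>z\<in>\<phi> ` (U \<inter> V).
           \<omega> (V, \<phi>) z =
             - laplacian (\<lambda>z. let x = inv_into V \<phi> z in
                             ln (Re (det_n r (\<lambda>i j. h x (s i x) (s j x))))) z / (4 * pi)))"

text \<open>\<open>I\<close> is the integral of \<open>\<omega>\<close>, computed with a smooth partition of unity subordinate to charts.\<close>

definition has_form_integral :: "('x::topological_space) atlas \<Rightarrow> 'x two_form \<Rightarrow> real \<Rightarrow> bool" where
  "has_form_integral A \<omega> I \<longleftrightarrow>
     (\<exists>J \<rho>. finite J \<and> J \<subseteq> A \<and>
        (\<forall>c\<in>J. smooth_fun A UNIV (\<rho> c) \<and> (\<forall>x. 0 \<le> \<rho> c x) \<and> closure {x. \<rho> c x \<noteq> 0} \<subseteq> fst c) \<and>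
        (\<forall>x. (\<Sum>c\<in>J. \<rho> c x) = (1::real)) \<and>
        I = (\<Sum>c\<in>J. integral (snd c ` fst c) (\<lambda>z. \<rho> c (inv_into (fst c) (snd c) z) * \<omega> c z)))"

text \<open>
  The degree is the integral of the Chern form of a Hermitian metric. It does not depend on the
  metric or on the partition of unity.
\<close>

definition deg ::
  "('x::topological_space) atlas \<Rightarrow> ('x, 'n::finite) vbundle \<Rightarrow> ('x \<Rightarrow> (complex ^ 'n) set) \<Rightarrow> real" where
  "deg A W S = (THE d. \<exists>h \<omega>. hermitian_metric A W S h \<and> chern_form A W S h \<omega> \<and>
                             has_form_integral A \<omega> d)"

section \<open>Quadratic forms and Higgs pairs\<close>

definition pairing :: "complex ^ 'n ^ 'n \<Rightarrow> complex ^ 'n \<Rightarrow> complex ^ 'n \<Rightarrow> complex" where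
  "pairing q u v = (\<Sum>i\<in>UNIV. \<Sum>j\<in>UNIV. u $ i * q $ i $ j * v $ j)"

text \<open>
  A quadratic form on \<open>W\<close> is given by its symmetric bilinear form. Holomorphy is that of its
  matrix in the trivializations.
\<close>

definition hol_nondeg_quadratic_form ::
  "'x atlas \<Rightarrow> ('x, 'n::finite) vbundle \<Rightarrow> ('x \<Rightarrow> complex ^ 'n ^ 'n) \<Rightarrow> bool" where
  "hol_nondeg_quadratic_form A W Q \<longleftrightarrow>
     (\<forall>x. transpose (Q x) = Q x \<and> (\<forall>u. (\<forall>v. pairing (Q x) u v = 0) \<longrightarrow> u = 0)) \<and>
     (\<forall>(U, t)\<in>W. \<forall>i j.
        hol_fun A U (\<lambda>x. (transpose (matrix_inv (t x)) ** Q x ** matrix_inv (t x)) $ i $ j))"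

definition perp ::
  "('x \<Rightarrow> complex ^ 'n ^ 'n) \<Rightarrow> ('x \<Rightarrow> (complex ^ 'n) set) \<Rightarrow> 'x \<Rightarrow> (complex ^ 'n) set" where
  "perp Q S x = {v. \<forall>u\<in>S x. pairing (Q x) u v = 0}"

definition isotropic ::
  "('x \<Rightarrow> complex ^ 'n ^ 'n) \<Rightarrow> ('x \<Rightarrow> (complex ^ 'n) set) \<Rightarrow> bool" where
  "isotropic Q S \<longleftrightarrow> (\<forall>x. S x \<subseteq> perp Q S x)"

definition coisotropic ::
  "('x \<Rightarrow> complex ^ 'n ^ 'n) \<Rightarrow> ('x \<Rightarrow> (complex ^ 'n) set) \<Rightarrow> bool" where
  "coisotropic Q S \<longleftrightarrow> (\<forall>x. perp Q S x \<subseteq> S x)"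

text \<open>
  The fibre of \<open>L \<otimes> S\<^sup>2 W\<close>, where \<open>L\<close> has fibre \<open>\<complex>\<^sup>1\<close> and \<open>W\<close> has fibre \<open>\<complex>\<^sup>n\<close>, is the space of
  symmetric \<open>n \<times> n\<close> matrices, with \<open>l \<otimes> (u \<otimes>\<^sub>S v)\<close> corresponding to the following matrix.
\<close>

definition sym_tensor :: "complex ^ 1 \<Rightarrow> complex ^ 'n \<Rightarrow> complex ^ 'n \<Rightarrow> complex ^ 'n ^ 'n" where
  "sym_tensor l u v = (\<chi> i j. l $ 1 * ((u $ i * v $ j + v $ i * u $ j) / 2))"

definition hol_section_LS2 ::
  "'x atlas \<Rightarrow> ('x, 1) vbundle \<Rightarrow> ('x, 'n::finite) vbundle \<Rightarrow> ('x \<Rightarrow> complex ^ 'n ^ 'n) \<Rightarrow> bool" where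
  "hol_section_LS2 A L W \<psi> \<longleftrightarrow>
     (\<forall>x. transpose (\<psi> x) = \<psi> x) \<and>
     (\<forall>(U, l)\<in>L. \<forall>(V, t)\<in>W. \<forall>i j.
        hol_fun A (U \<inter> V) (\<lambda>x. l x $ 1 $ 1 * (t x ** \<psi> x ** transpose (t x)) $ i $ j))"

definition higgs_pair ::
  "('x::topological_space) atlas \<Rightarrow> ('x, 1) vbundle \<Rightarrow> ('x, 'n::finite) vbundle \<Rightarrow>
   ('x \<Rightarrow> complex ^ 'n ^ 'n) \<Rightarrow> ('x \<Rightarrow> complex ^ 'n ^ 'n) \<Rightarrow> bool" where
  "higgs_pair A L W Q \<psi> \<longleftrightarrow>
     hol_vbundle A W \<and> hol_nondeg_quadratic_form A W Q \<and> hol_section_LS2 A L W \<psi>"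

text \<open>
  The map \<open>\<psi> \<circ> Q : W \<rightarrow> W \<otimes> L\<close> is the matrix \<open>\<psi> x ** Q x\<close>, the fibre of \<open>W \<otimes> L\<close> being \<open>\<complex>\<^sup>n\<close>
  with \<open>w \<otimes> l\<close> corresponding to \<open>l $ 1 *s w\<close>; then \<open>S \<otimes> L\<close> has the same fibres as \<open>S\<close>.
\<close>

definition psi_invariant ::
  "('x \<Rightarrow> complex ^ 'n ^ 'n) \<Rightarrow> ('x \<Rightarrow> complex ^ 'n ^ 'n) \<Rightarrow> ('x \<Rightarrow> (complex ^ 'n) set) \<Rightarrow> bool" where
  "psi_invariant Q \<psi> S \<longleftrightarrow> (\<forall>x. \<forall>w\<in>S x. (\<psi> x ** Q x) *v w \<in> S x)"

section \<open>Filtrations and stability\<close>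

text \<open>The order on families of sets is pointwise, so \<open><\<close> is proper inclusion of subbundles.\<close>

definition q_filtration ::
  "('x::topological_space) atlas \<Rightarrow> ('x, 'n::finite) vbundle \<Rightarrow> ('x \<Rightarrow> complex ^ 'n ^ 'n) \<Rightarrow>
   nat \<Rightarrow> (nat \<Rightarrow> 'x \<Rightarrow> (complex ^ 'n) set) \<Rightarrow> bool" where
  "q_filtration A W Q k F \<longleftrightarrow>
     F 0 = zero_sub \<and> F k = whole_sub \<and>
     (\<forall>j\<le>k. hol_subbundle A W (F j)) \<and> (\<forall>j<k. F j < F (Suc j)) \<and>
     (\<forall>j\<le>k. F j = perp Q (F (k - j)))"

text \<open>Only the values \<open>lam 1, \<dots>, lam k\<close> of a weight are relevant.\<close>

definition Weights :: "nat \<Rightarrow> (nat \<Rightarrow> real) set" where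
  "Weights k = {lam. (\<forall>i. 1 \<le> i \<and> i < k \<longrightarrow> lam i \<le> lam (i + 1)) \<and>
                   (\<forall>i\<in>{1..k}. lam i + lam (k - i + 1) = 0)}"

text \<open>
  \<open>L \<otimes> S \<otimes>\<^sub>S T\<close> at \<open>x\<close> is the span of the following set, which is closed under multiplication by
  complex scalars, so that real and complex span agree.
\<close>

definition sym_tensors :: "(complex ^ 'n) set \<Rightarrow> (complex ^ 'n) set \<Rightarrow> (complex ^ 'n ^ 'n) set" where
  "sym_tensors S T = {sym_tensor l u v | l u v. u \<in> S \<and> v \<in> T}"

definition N_bundle ::
  "nat \<Rightarrow> (nat \<Rightarrow> 'x \<Rightarrow> (complex ^ 'n) set) \<Rightarrow> (nat \<Rightarrow> real) \<Rightarrow> 'x \<Rightarrow> (complex ^ 'n ^ 'n) set" where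
  "N_bundle k F lam x =
     span (\<Union>{sym_tensors (F i x) (F j x) | i j. i \<in> {1..k} \<and> j \<in> {1..k} \<and> lam i + lam j \<le> 0})"

definition H0 ::
  "'x atlas \<Rightarrow> ('x, 1) vbundle \<Rightarrow> ('x, 'n::finite) vbundle \<Rightarrow> ('x \<Rightarrow> (complex ^ 'n ^ 'n) set) \<Rightarrow>
   ('x \<Rightarrow> complex ^ 'n ^ 'n) set" where
  "H0 A L W N = {\<psi>. hol_section_LS2 A L W \<psi> \<and> (\<forall>x. \<psi> x \<in> N x)}"

definition weighted_deg ::
  "('x::topological_space) atlas \<Rightarrow> ('x, 'n::finite) vbundle \<Rightarrow> nat \<Rightarrow>
   (nat \<Rightarrow> 'x \<Rightarrow> (complex ^ 'n) set) \<Rightarrow> (nat \<Rightarrow> real) \<Rightarrow> real" where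
  "weighted_deg A W k F lam = (\<Sum>j = 1..k - 1. (lam j - lam (j + 1)) * deg A W (F j))"

definition semistable ::
  "('x::topological_space) atlas \<Rightarrow> ('x, 1) vbundle \<Rightarrow> ('x, 'n::finite) vbundle \<Rightarrow>
   ('x \<Rightarrow> complex ^ 'n ^ 'n) \<Rightarrow> ('x \<Rightarrow> complex ^ 'n ^ 'n) \<Rightarrow> bool" where
  "semistable A L W Q \<psi> \<longleftrightarrow>
     (\<forall>k F lam. q_filtration A W Q k F \<and> lam \<in> Weights k \<and> \<psi> \<in> H0 A L W (N_bundle k F lam)
        \<longrightarrow> weighted_deg A W k F lam \<ge> 0)"

definition stable ::
  "('x::topological_space) atlas \<Rightarrow> ('x, 1) vbundle \<Rightarrow> ('x, 'n::finite) vbundle \<Rightarrow>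
   ('x \<Rightarrow> complex ^ 'n ^ 'n) \<Rightarrow> ('x \<Rightarrow> complex ^ 'n ^ 'n) \<Rightarrow> bool" where
  "stable A L W Q \<psi> \<longleftrightarrow>
     semistable A L W Q \<psi> \<and>
     (\<forall>k F lam. q_filtration A W Q k F \<and> lam \<in> Weights k \<and> (\<exists>i\<in>{1..k}. lam i \<noteq> 0) \<and>
        \<psi> \<in> H0 A L W (N_bundle k F lam) \<longrightarrow> weighted_deg A W k F lam > 0)"

section \<open>Splittings and polystability\<close>

text \<open>
  The fibre of a quotient bundle \<open>S/T\<close> consists of cosets. A section of it is holomorphic if
  it lifts locally to a holomorphic section of \<open>S\<close>.
\<close>

definition coset :: "(complex ^ 'n) set \<Rightarrow> complex ^ 'n \<Rightarrow> (complex ^ 'n) set" where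
  "coset T u = (+) u ` T"

definition quot_add :: "(complex ^ 'n) set \<Rightarrow> (complex ^ 'n) set \<Rightarrow> (complex ^ 'n) set" where
  "quot_add C D = {c + d | c d. c \<in> C \<and> d \<in> D}"

definition quot_scale ::
  "(complex ^ 'n) set \<Rightarrow> complex \<Rightarrow> (complex ^ 'n) set \<Rightarrow> (complex ^ 'n) set" where
  "quot_scale T a C = {a *s c + w | c w. c \<in> C \<and> w \<in> T}"

definition hol_quot_section ::
  "('x::topological_space) atlas \<Rightarrow> ('x, 'n::finite) vbundle \<Rightarrow> ('x \<Rightarrow> (complex ^ 'n) set) \<Rightarrow>
   ('x \<Rightarrow> (complex ^ 'n) set) \<Rightarrow> 'x set \<Rightarrow> ('x \<Rightarrow> (complex ^ 'n) set) \<Rightarrow> bool" where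
  "hol_quot_section A W S T U \<sigma> \<longleftrightarrow>
     (\<forall>x\<in>U. \<exists>V s. open V \<and> x \<in> V \<and> V \<subseteq> U \<and> hol_section A W V s \<and>
        (\<forall>y\<in>V. s y \<in> S y \<and> \<sigma> y = coset (T y) (s y)))"

text \<open>
  Fibre of \<open>F 1 / F 0 \<oplus> \<dots> \<oplus> F k / F (k - 1)\<close>, the component of index \<open>i\<close> being in \<open>F i / F (i - 1)\<close>.
\<close>

definition graded_fibre ::
  "nat \<Rightarrow> (nat \<Rightarrow> 'x \<Rightarrow> (complex ^ 'n) set) \<Rightarrow> 'x \<Rightarrow> (nat \<Rightarrow> (complex ^ 'n) set) set" where
  "graded_fibre k F x = (\<Pi>\<^sub>E i\<in>{1..k}. coset (F (i - 1) x) ` F i x)"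

text \<open>
  \<open>\<Phi>\<close> is an isomorphism of holomorphic bundles from \<open>W\<close> to the associated graded bundle under which
  \<open>F j\<close> corresponds to the sum of the first \<open>j\<close> summands; the zero of \<open>F i / F (i - 1)\<close> is
  the coset \<open>F (i - 1)\<close>. The second condition is holomorphy of \<open>\<Phi>\<close> and of its inverse.
\<close>

definition graded_iso ::
  "('x::topological_space) atlas \<Rightarrow> ('x, 'n::finite) vbundle \<Rightarrow> nat \<Rightarrow>
   (nat \<Rightarrow> 'x \<Rightarrow> (complex ^ 'n) set) \<Rightarrow>
   ('x \<Rightarrow> complex ^ 'n \<Rightarrow> nat \<Rightarrow> (complex ^ 'n) set) \<Rightarrow> bool" where
  "graded_iso A W k F \<Phi> \<longleftrightarrow>
     (\<forall>x. bij_betw (\<Phi> x) UNIV (graded_fibre k F x) \<and>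
        (\<forall>i\<in>{1..k}. \<forall>u v a. \<Phi> x (u + v) i = quot_add (\<Phi> x u i) (\<Phi> x v i) \<and>
                            \<Phi> x (a *s u) i = quot_scale (F (i - 1) x) a (\<Phi> x u i))) \<and>
     (\<forall>U s. open U \<longrightarrow>
        (hol_section A W U s \<longleftrightarrow>
         (\<forall>i\<in>{1..k}. hol_quot_section A W (F i) (F (i - 1)) U (\<lambda>x. \<Phi> x (s x) i)))) \<and>
     (\<forall>x. \<forall>j\<le>k. \<Phi> x ` F j x = {c \<in> graded_fibre k F x. \<forall>i\<in>{j<..k}. c i = F (i - 1) x})"

text \<open>The subspace of the fibre of \<open>W\<close> corresponding under \<open>\<Phi>\<close> to the summand of index \<open>i\<close>.\<close>

definition summand ::
  "nat \<Rightarrow> (nat \<Rightarrow> 'x \<Rightarrow> (complex ^ 'n) set) \<Rightarrow>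
   ('x \<Rightarrow> complex ^ 'n \<Rightarrow> nat \<Rightarrow> (complex ^ 'n) set) \<Rightarrow> nat \<Rightarrow> 'x \<Rightarrow> (complex ^ 'n) set" where
  "summand k F \<Phi> i x = {w. \<forall>j\<in>{1..k} - {i}. \<Phi> x w j = F (j - 1) x}"

definition graded_N ::
  "nat \<Rightarrow> (nat \<Rightarrow> 'x \<Rightarrow> (complex ^ 'n) set) \<Rightarrow>
   ('x \<Rightarrow> complex ^ 'n \<Rightarrow> nat \<Rightarrow> (complex ^ 'n) set) \<Rightarrow> (nat \<Rightarrow> real) \<Rightarrow> 'x \<Rightarrow>
   (complex ^ 'n ^ 'n) set" where
  "graded_N k F \<Phi> lam x =
     span (\<Union>{sym_tensors (summand k F \<Phi> i x) (summand k F \<Phi> j x) | i j.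
              i \<in> {1..k} \<and> j \<in> {1..k} \<and> lam i + lam j = 0})"

definition polystable ::
  "('x::topological_space) atlas \<Rightarrow> ('x, 1) vbundle \<Rightarrow> ('x, 'n::finite) vbundle \<Rightarrow>
   ('x \<Rightarrow> complex ^ 'n ^ 'n) \<Rightarrow> ('x \<Rightarrow> complex ^ 'n ^ 'n) \<Rightarrow> bool" where
  "polystable A L W Q \<psi> \<longleftrightarrow>
     semistable A L W Q \<psi> \<and>
     (\<forall>k F lam. q_filtration A W Q k F \<and> lam \<in> Weights k \<and>
        (\<forall>i. 1 \<le> i \<and> i < k \<longrightarrow> lam i < lam (i + 1)) \<and>
        \<psi> \<in> H0 A L W (N_bundle k F lam) \<and> weighted_deg A W k F lam = 0 \<longrightarrow>
        (\<exists>\<Phi>. graded_iso A W k F \<Phi> \<and>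
             (\<forall>x. \<forall>i\<in>{1..k}. \<forall>j\<in>{1..k}. i + j \<noteq> k + 1 \<longrightarrow>
                (\<forall>u\<in>summand k F \<Phi> i x. \<forall>v\<in>summand k F \<Phi> j x. pairing (Q x) u v = 0)) \<and>
             \<psi> \<in> H0 A L W (graded_N k F \<Phi> lam)))"

text \<open>\<open>W\<close> is the direct sum of its subbundles \<open>S\<close> and \<open>T\<close>.\<close>

definition splits :: "('x \<Rightarrow> (complex ^ 'n) set) \<Rightarrow> ('x \<Rightarrow> (complex ^ 'n) set) \<Rightarrow> bool" where
  "splits S T \<longleftrightarrow> (\<forall>x. S x \<inter> T x = {0} \<and> {u + v | u v. u \<in> S x \<and> v \<in> T x} = UNIV)"

end

theory Submission
  imports "Jordan_Normal_Form.Determinant" "HOL-Complex_Analysis.Complex_Analysis" Defs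
begin

text \<open>
  An isotropic invariant \<open>S\<close> gives the filtration \<open>0 \<subset> S \<subseteq> S\<^sup>\<bottom> \<subset> W\<close>, whose weighted degree is
  \<open>- 2 deg S\<close> because \<open>deg S\<^sup>\<bottom> = deg S\<close>: metrics on \<open>S\<close> and \<open>S\<^sup>\<bottom>\<close> induce metrics on their
  determinants whose ratio has a globally defined logarithm, and its Laplacian integrates to zero.
  Conversely, if \<open>\<lambda>\<close> jumps at \<open>j\<close>, then \<open>\<psi> \<in> N\<close> makes \<open>F j\<close> invariant, and since \<open>F j\<close> or its
  orthogonal is isotropic, every term of the weighted degree has the required sign. For
  polystability, the splitting of \<open>0 \<subset> S \<subseteq> S\<^sup>\<bottom> \<subset> W\<close> provides a complement of \<open>S\<close>, and complements
  of the isotropic steps of a filtration yield nested projections commuting with \<open>\<psi> \<circ> Q\<close> and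
  compatible with \<open>Q\<close>, hence the splitting.
\<close>

text \<open>\<open>deg\<close> is a definite description over metrics, Chern forms and partitions of
  unity. The orthogonal is compared with \<open>S\<close> so that both descriptions range over
  literally the same forms: the global logarithm L is absorbed into a conformal factor exp(L/m) on
  the orthogonal, of rank m. The two log determinants then differ by 2 log |P| - log |F| with P and
  F holomorphic without zeros, which is harmonic. The m-th root sets rank zero apart.

  A simple tensor of u and v, read through Q as an endomorphism, sends w to a combination of u and v
  with coefficients Q(v,w) and Q(u,w); the weights decide which of these can be non-zero. Symmetry
  of \<psi> makes \<psi> Q self-adjoint, so orthogonals and adjoint projections inherit invariance.

  In polystability the obstacle is compatibility: the complements of different steps are related
  neither to each other nor to Q. Only the isotropic half is chosen and duality dictates the rest.
  Choice and duality meet in a Lagrangian middle step, which exists exactly for an even number of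
  steps; there coisotropy of the complement makes them agree.\<close>

no_notation fps_nth (infixl "$" 75)

section \<open>Leading determinants\<close>

text \<open>Both sides are the same Leibniz sum. The product rule, the block rule and the kernel
  criterion for matrices of variable size are transferred along this identity.\<close>

lemma det_n_mat: "det_n r M = Determinant.det (Matrix.mat r r (\<lambda>(i, j). M i j))"
proof -
  have "(\<Prod>i<r. M i (p i)) = (\<Prod>i<r. Matrix.mat r r (\<lambda>(i, j). M i j) $$ (i, p i))"
    if "p permutes {..<r}" for p
    using permutes_in_image[OF that] by (intro prod.cong) auto
  then show ?thesis
    unfolding det_n_def Determinant.det_def
    by (auto simp: atLeast0LessThan intro!: sum.cong)
qed

lemma det_n_cong:
  assumes "\<And>i j. i < r \<Longrightarrow> j < r \<Longrightarrow> M i j = N i j"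
  shows "det_n r M = det_n r N"
proof -
  have "Matrix.mat r r (\<lambda>(i, j). M i j) = Matrix.mat r r (\<lambda>(i, j). N i j)"
    by (rule eq_matI) (auto simp: assms)
  then show ?thesis by (simp add: det_n_mat)
qed

lemma det_n_mult: "det_n r (\<lambda>i j. \<Sum>k<r. A i k * B k j) = det_n r A * det_n r B"
proof -
  have "Matrix.mat r r (\<lambda>(i, j). \<Sum>k<r. A i k * B k j) =
        Matrix.mat r r (\<lambda>(i, j). A i j) * Matrix.mat r r (\<lambda>(i, j). B i j)"
    by (rule eq_matI) (auto simp: scalar_prod_def atLeast0LessThan)
  then show ?thesis unfolding det_n_mat by (simp add: Determinant.det_mult[of _ r])
qed

lemma det_n_transpose: "det_n r (\<lambda>i j. A j i) = det_n r A"
proof -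
  have "Matrix.mat r r (\<lambda>(i, j). A j i) = transpose_mat (Matrix.mat r r (\<lambda>(i, j). A i j))"
    by (rule eq_matI) auto
  then show ?thesis unfolding det_n_mat by (simp add: Determinant.det_transpose[of _ r])
qed

lemma det_n_cnj: "det_n r (\<lambda>i j. cnj (A i j)) = cnj (det_n r A)"
  by (simp add: det_n_def)

lemma det_n_scale: "det_n r (\<lambda>i j. c * A i j) = c ^ r * det_n r A"
  by (simp add: det_n_def prod.distrib sum_distrib_left mult.left_commute)

lemma det_n_one: "det_n r (\<lambda>i j. if i = j then 1 else 0) = 1"
proof -
  have "Matrix.mat r r (\<lambda>(i, j). if i = j then 1 else 0) = (1\<^sub>m r :: complex mat)"
    by (rule eq_matI) auto
  then show ?thesis by (simp add: det_n_mat)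
qed

text \<open>For transition matrices between two bases of the fibre that both begin with a basis of
  the same subspace.\<close>

lemma det_n_block:
  assumes "\<And>i j. r \<le> i \<Longrightarrow> i < r + m \<Longrightarrow> j < r \<Longrightarrow> M i j = 0"
  shows "det_n (r + m) M = det_n r M * det_n m (\<lambda>i j. M (r + i) (r + j))"
proof -
  have "Matrix.mat (r + m) (r + m) (\<lambda>(i, j). M i j) =
     four_block_mat (Matrix.mat r r (\<lambda>(i, j). M i j)) (Matrix.mat r m (\<lambda>(i, j). M i (r + j)))
       (0\<^sub>m m r) (Matrix.mat m m (\<lambda>(i, j). M (r + i) (r + j)))"
    by (rule eq_matI) (auto simp: four_block_mat_def assms)
  then show ?thesis
    unfolding det_n_mat
    by (simp add: det_four_block_mat_lower_left_zero[of _ r _ m])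
qed

lemma det_n_eq_0:
  assumes "det_n r G = 0"
  shows "\<exists>y. (\<exists>i<r. y i \<noteq> 0) \<and> (\<forall>i<r. (\<Sum>j<r. G i j * y j) = 0)"
proof -
  let ?G = "Matrix.mat r r (\<lambda>(i, j). G i j)"
  obtain v where v: "v \<in> carrier_vec r" "v \<noteq> 0\<^sub>v r" "?G *\<^sub>v v = 0\<^sub>v r"
    using assms Determinant.det_0_iff_vec_prod_zero[of ?G r] by (auto simp: det_n_mat)
  have "\<exists>i<r. vec_index v i \<noteq> 0"
  proof (rule ccontr)
    assume "\<not> ?thesis"
    then have "v = 0\<^sub>v r" using v(1) by (intro eq_vecI) auto
    with v(2) show False by simp
  qed
  moreover have "(\<Sum>j<r. G i j * vec_index v j) = 0" if "i < r" for i
  proof -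
    have "vec_index (?G *\<^sub>v v) i = (\<Sum>j<r. G i j * vec_index v j)"
      using that v(1) by (auto simp: scalar_prod_def atLeast0LessThan intro!: sum.cong)
    then show ?thesis using v(3) that by simp
  qed
  ultimately show ?thesis by blast
qed

text \<open>Keeping \<open>A\<close> and \<open>B\<close> independent covers bilinear forms
  (\<open>B\<close> equal to \<open>A\<close>), Hermitian forms (\<open>B\<close> the conjugate of
  \<open>A\<close>) and pairings between two different subspaces.\<close>

lemma det_n_congruence:
  "det_n r (\<lambda>i j. \<Sum>k<r. \<Sum>l<r. A k i * G k l * B l j) = det_n r A * det_n r G * det_n r B"
proof -
  have "det_n r (\<lambda>i j. \<Sum>k<r. \<Sum>l<r. A k i * G k l * B l j) =
        det_n r (\<lambda>i j. \<Sum>l<r. (\<Sum>k<r. A k i * G k l) * B l j)"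
    unfolding sum_distrib_right by (intro det_n_cong sum.swap)
  also have "\<dots> = det_n r (\<lambda>i l. \<Sum>k<r. A k i * G k l) * det_n r B"
    by (rule det_n_mult)
  also have "det_n r (\<lambda>i l. \<Sum>k<r. A k i * G k l) = det_n r (\<lambda>i k. A k i) * det_n r G"
    by (rule det_n_mult)
  finally show ?thesis by (simp only: det_n_transpose[of r A])
qed

text \<open>The determinant of the segment from the identity to \<open>G\<close> is real and has no zero.\<close>

lemma det_n_pos:
  assumes herm: "\<And>i j. i < r \<Longrightarrow> j < r \<Longrightarrow> G j i = cnj (G i j)"
    and pos: "\<And>y. \<exists>i<r. y i \<noteq> 0 \<Longrightarrow> 0 < Re (\<Sum>i<r. \<Sum>j<r. cnj (y i) * G i j * y j)"
  shows "0 < Re (det_n r G)" and "det_n r G = of_real (Re (det_n r G))"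
proof -
  define H where "H t i j = of_real (1 - t) * (if i = j then 1 else 0) + of_real t * G i j"
    for t :: real and i j :: nat
  have real: "Im (det_n r (H t)) = 0" for t
  proof -
    have "cnj (det_n r (H t)) = det_n r (\<lambda>i j. H t j i)"
      unfolding det_n_cnj[symmetric]
    proof (rule det_n_cong)
      fix i j assume "i < r" "j < r"
      then show "cnj (H t i j) = H t j i" using herm[of i j, symmetric] by (auto simp: H_def)
    qed
    then have "cnj (det_n r (H t)) = det_n r (H t)"
      by (simp only: det_n_transpose[of r "H t"])
    then show ?thesis by (simp add: complex_eq_iff)
  qed
  \<comment> \<open>A kernel vector y of \<open>H t\<close> would make (1 - t) |y|^2 plus t times
    the value of the form \<open>G\<close> at y vanish; both terms are non-negative and one of them
    is positive.\<close>
  have nz: "det_n r (H t) \<noteq> 0" if t: "0 \<le> t" "t \<le> 1" for t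
  proof
    assume "det_n r (H t) = 0"
    then obtain y where y: "\<exists>i<r. y i \<noteq> 0" and 0: "\<forall>i<r. (\<Sum>j<r. H t i j * y j) = 0"
      using det_n_eq_0 by blast
    have "0 = (\<Sum>i<r. cnj (y i) * (\<Sum>j<r. H t i j * y j))" using 0 by simp
    also have "\<dots> = (\<Sum>i<r. \<Sum>j<r. cnj (y i) * H t i j * y j)"
      by (simp add: sum_distrib_left mult.assoc)
    also have "\<dots> = (\<Sum>i<r. \<Sum>j<r. of_real (1 - t) * (if i = j then cnj (y i) * y j else 0) +
        of_real t * (cnj (y i) * G i j * y j))"
      by (intro sum.cong refl) (auto simp: H_def algebra_simps)
    also have "\<dots> = of_real (1 - t) * (\<Sum>i<r. cnj (y i) * y i) +
        of_real t * (\<Sum>i<r. \<Sum>j<r. cnj (y i) * G i j * y j)"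
      by (simp add: sum.distrib sum_distrib_left[symmetric])
    also have "(\<Sum>i<r. cnj (y i) * y i) = of_real (\<Sum>i<r. (cmod (y i))\<^sup>2)"
      unfolding of_real_sum
      by (intro sum.cong refl) (subst complex_norm_square, rule mult.commute)
    finally have "Re (of_real (1 - t) * of_real (\<Sum>i<r. (cmod (y i))\<^sup>2) +
        of_real t * (\<Sum>i<r. \<Sum>j<r. cnj (y i) * G i j * y j)) = 0"
      by simp
    then have "(1 - t) * (\<Sum>i<r. (cmod (y i))\<^sup>2) +
        t * Re (\<Sum>i<r. \<Sum>j<r. cnj (y i) * G i j * y j) = 0"
      by (simp only: plus_complex.sel Re_complex_of_real times_complex.sel Im_complex_of_real mult_zero_left diff_zero)
    moreover have "0 < (\<Sum>i<r. (cmod (y i))\<^sup>2)"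
      using y by (auto intro!: sum_pos2)
    ultimately show False using t
        mult_pos_pos[OF _ pos[OF y], of t]
        mult_nonneg_nonneg[of "1 - t" "\<Sum>i<r. (cmod (y i))\<^sup>2"]
      by (cases "t = 0") (simp, linarith)
  qed
  have cont: "continuous_on {0..1} (\<lambda>t. Re (det_n r (H t)))"
    unfolding det_n_def H_def by (intro continuous_intros)
  have H0: "Re (det_n r (H 0)) = 1"
    using det_n_one[of r] by (simp add: H_def[abs_def])
  have H1: "H 1 = G" by (simp add: H_def fun_eq_iff)
  show "0 < Re (det_n r G)"
  proof (rule ccontr)
    assume "\<not> ?thesis"
    then obtain t where t: "0 \<le> t" "t \<le> 1" "Re (det_n r (H t)) = 0"
      using H0 H1 cont IVT2'[of "\<lambda>t. Re (det_n r (H t))" 1 0 0] by auto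
    then have "det_n r (H t) = 0" using real[of t] by (simp add: complex_eq_iff)
    then show False using nz[OF t(1,2)] by contradiction
  qed
  show "det_n r G = of_real (Re (det_n r G))"
    using real[of 1] H1 by (simp add: complex_eq_iff)
qed

no_notation Matrix.vec_index (infixl "$" 100)
no_notation Matrix.scalar_prod (infix "\<bullet>" 70)
no_notation transpose_mat ("(_\<^sup>T)" [1000])
hide_const (open) Determinant.det Matrix.vec Matrix.mat Matrix.row Matrix.col
hide_type (open) Matrix.vec Matrix.mat

section \<open>Calculus in the plane\<close>

lemma has_derivative_pd:
  assumes "(f has_derivative D) (at z)"
  shows "pdx f z = D 1" "pdy f z = D \<i>"
  using frechet_derivative_at[OF assms] by (simp_all add: pdx_def pdy_def)

lemma linear_complex_expand:
  assumes "linear D"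
  shows "D h = Re h *\<^sub>R D 1 + Im h *\<^sub>R D \<i>"
proof -
  have "h = Re h *\<^sub>R 1 + Im h *\<^sub>R \<i>" by (simp add: complex_eq_iff)
  then have "D h = D (Re h *\<^sub>R 1 + Im h *\<^sub>R \<i>)" by simp
  then show ?thesis by (simp only: linear_add[OF assms] linear_scale[OF assms])
qed

lemma differentiable_has_derivative_pd:
  assumes "f differentiable (at z)"
  shows "(f has_derivative (\<lambda>h. Re h *\<^sub>R pdx f z + Im h *\<^sub>R pdy f z)) (at z)"
proof -
  obtain D where D: "(f has_derivative D) (at z)"
    using assms by (auto simp: differentiable_def)
  have "D = (\<lambda>h. Re h *\<^sub>R pdx f z + Im h *\<^sub>R pdy f z)"
    unfolding has_derivative_pd[OF D]
    using linear_complex_expand[OF has_derivative_linear[OF D]] by blast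
  then show ?thesis using D by simp
qed

lemma pd_cong:
  assumes "open S" "z \<in> S" "\<And>w. w \<in> S \<Longrightarrow> f w = g w"
  shows "pdx f z = pdx g z" "pdy f z = pdy g z"
proof -
  have "(f has_derivative D) (at z) \<longleftrightarrow> (g has_derivative D) (at z)" for D
    using has_derivative_transform_within_open[of f D z UNIV S g]
      has_derivative_transform_within_open[of g D z UNIV S f] assms by auto
  then have "frechet_derivative f (at z) = frechet_derivative g (at z)"
    unfolding frechet_derivative_def by simp
  then show "pdx f z = pdx g z" "pdy f z = pdy g z"
    by (simp_all add: pdx_def pdy_def)
qed

lemma Ck_on_cong:
  assumes "open S" "\<And>z. z \<in> S \<Longrightarrow> f z = g z" "Ck_on k S f"
  shows "Ck_on k S g"
  using assms(2,3)
proof (induction k arbitrary: f g)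
  case 0
  then show ?case using continuous_on_cong[of S S f g] by simp
next
  case (Suc k)
  have "g differentiable (at z)" if "z \<in> S" for z
    using Suc.prems that assms(1) has_derivative_transform_within_open[of f _ z UNIV S g]
    unfolding Ck_on.simps differentiable_def by metis
  moreover have "Ck_on k S (pdx g)"
    using Suc.prems by (intro Suc.IH[of "pdx f" "pdx g"] pd_cong(1)[OF assms(1)]) simp_all
  moreover have "Ck_on k S (pdy g)"
    using Suc.prems by (intro Suc.IH[of "pdy f" "pdy g"] pd_cong(2)[OF assms(1)]) simp_all
  ultimately show ?case by simp
qed

text \<open>Trades the chosen derivative behind \<open>pdx\<close> and \<open>pdy\<close> for an
  explicit one, evaluated at the two basis directions. The closure properties of
  \<open>Ck_on\<close> are inductions through this rule.\<close>

lemma Ck_on_SucI: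
  assumes "open S"
    and "\<And>z. z \<in> S \<Longrightarrow> (f has_derivative D z) (at z)"
    and "Ck_on k S (\<lambda>z. D z 1)" "Ck_on k S (\<lambda>z. D z \<i>)"
  shows "Ck_on (Suc k) S f"
proof -
  have "Ck_on k S (pdx f)" "Ck_on k S (pdy f)"
    using Ck_on_cong[OF assms(1) _ assms(3), of "pdx f"] Ck_on_cong[OF assms(1) _ assms(4), of "pdy f"]
      has_derivative_pd[OF assms(2)] by simp_all
  then show ?thesis using assms(2) by (auto simp: differentiable_def)
qed

lemma Ck_on_has_derivative:
  assumes "Ck_on (Suc k) S f" "z \<in> S"
  shows "(f has_derivative (\<lambda>h. Re h *\<^sub>R pdx f z + Im h *\<^sub>R pdy f z)) (at z)"
  using assms by (auto intro: differentiable_has_derivative_pd)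

lemma Ck_on_Suc_imp: "Ck_on (Suc k) S f \<Longrightarrow> Ck_on k S f"
proof (induction k arbitrary: f)
  case 0
  then have "f differentiable_on S"
    by (auto simp: differentiable_on_def intro: differentiable_at_withinI)
  then show ?case by (simp add: differentiable_imp_continuous_on)
next
  case (Suc k)
  have "Ck_on (Suc k) S (pdx f)" "Ck_on (Suc k) S (pdy f)" using Suc.prems by simp_all
  then have "Ck_on k S (pdx f)" "Ck_on k S (pdy f)" by (simp_all only: Suc.IH)
  with Suc.prems show ?case by simp
qed

lemma Ck_on_subset: "Ck_on k S f \<Longrightarrow> T \<subseteq> S \<Longrightarrow> Ck_on k T f"
proof (induction k arbitrary: f)
  case 0
  then show ?case by (simp add: continuous_on_subset)
qed auto

lemma Ck_on_local:
  assumes "open S" "\<And>z. z \<in> S \<Longrightarrow> \<exists>T. open T \<and> z \<in> T \<and> Ck_on k (S \<inter> T) f"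
  shows "Ck_on k S f"
  using assms(2)
proof (induction k arbitrary: f)
  case 0
  have "isCont f z" if "z \<in> S" for z
  proof -
    obtain T where "open T" "z \<in> T" "continuous_on (S \<inter> T) f" using 0 \<open>z \<in> S\<close> by auto
    then show ?thesis using that assms(1) by (simp add: continuous_on_eq_continuous_at open_Int)
  qed
  then show ?case by (auto intro: continuous_at_imp_continuous_on)
next
  case (Suc k)
  have "f differentiable (at z)" if "z \<in> S" for z
    using Suc.prems[OF that] that by auto
  moreover have "Ck_on k S (pdx f)" "Ck_on k S (pdy f)"
    using Suc.prems Suc.IH[of "pdx f"] Suc.IH[of "pdy f"] unfolding Ck_on.simps by blast+
  ultimately show ?case by simp
qed

lemma Ck_on_const: "open S \<Longrightarrow> Ck_on k S (\<lambda>_. c)"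
proof (induction k arbitrary: c)
  case (Suc k)
  then show ?case by (intro Ck_on_SucI[where D = "\<lambda>_ _. 0"]) auto
qed simp

lemma Ck_on_linear:
  assumes "bounded_linear L" "open S" "Ck_on k S f"
  shows "Ck_on k S (\<lambda>z. L (f z))"
  using assms(3)
proof (induction k arbitrary: f)
  case 0
  then show ?case by (simp add: bounded_linear.continuous_on[OF assms(1)])
next
  case (Suc k)
  show ?case
    by (rule Ck_on_SucI[OF assms(2) bounded_linear.has_derivative[OF assms(1)
              Ck_on_has_derivative[OF Suc.prems]]])
      (use Suc in auto)
qed

lemma Ck_on_add:
  assumes "open S" "Ck_on k S f" "Ck_on k S g"
  shows "Ck_on k S (\<lambda>z. f z + g z)"
  using assms(2,3)
proof (induction k arbitrary: f g)
  case 0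
  then show ?case by (auto intro: continuous_intros)
next
  case (Suc k)
  show ?case
    by (rule Ck_on_SucI[OF assms(1) has_derivative_add[OF
              Ck_on_has_derivative[OF Suc.prems(1)] Ck_on_has_derivative[OF Suc.prems(2)]]])
      (use Suc in auto)
qed

lemma Ck_on_mult:
  fixes f g :: "complex \<Rightarrow> 'a::real_normed_algebra"
  assumes "open S" "Ck_on k S f" "Ck_on k S g"
  shows "Ck_on k S (\<lambda>z. f z * g z)"
  using assms(2,3)
proof (induction k arbitrary: f g)
  case 0
  then show ?case by (auto intro: continuous_intros)
next
  case (Suc k)
  note k = Ck_on_Suc_imp[OF Suc.prems(1)] Ck_on_Suc_imp[OF Suc.prems(2)]
  show ?case
    by (rule Ck_on_SucI[OF assms(1) has_derivative_mult[OF
              Ck_on_has_derivative[OF Suc.prems(1)] Ck_on_has_derivative[OF Suc.prems(2)]]])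
      (use Suc k in \<open>auto intro!: Ck_on_add assms(1) Suc.IH\<close>)
qed

lemma Ck_on_holomorphic:
  assumes "open S" "f holomorphic_on S"
  shows "Ck_on k S f"
  using assms(2)
proof (induction k arbitrary: f)
  case 0
  then show ?case by (simp add: holomorphic_on_imp_continuous_on)
next
  case (Suc k)
  have "(f has_derivative (\<lambda>h. deriv f z * h)) (at z)" if "z \<in> S" for z
    using holomorphic_derivI[OF Suc.prems assms(1) that] by (simp add: has_field_derivative_def)
  then show ?case
    using Suc assms(1)
    by (intro Ck_on_SucI[where D = "\<lambda>z h. deriv f z * h"] Suc.IH)
      (auto intro!: holomorphic_intros)
qed

text \<open>A family \<open>\<G>\<close> closed under differentiation stands in for smoothness in
  one real variable: the chain rule passes from g to another member of the family, so the induction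
  on \<open>k\<close> runs with g arbitrary in it.\<close>

lemma Ck_on_compose:
  fixes f :: "complex \<Rightarrow> real"
  assumes "open S" "Ck_on k S f" "\<And>z. z \<in> S \<Longrightarrow> f z \<in> T" "g \<in> \<G>"
    and "\<And>g. g \<in> \<G> \<Longrightarrow> \<exists>g'\<in>\<G>. \<forall>y\<in>T. (g has_real_derivative g' y) (at y)"
  shows "Ck_on k S (\<lambda>z. g (f z))"
  using assms(2,4)
proof (induction k arbitrary: g)
  case (0 g)
  obtain g' where "\<forall>y\<in>T. (g has_real_derivative g' y) (at y)" using assms(5) 0 by blast
  then have "continuous_on T g" by (auto intro: DERIV_continuous_on has_field_derivative_at_within)
  then show ?case using 0 assms(3)
    by (auto intro: continuous_on_compose2)
next
  case (Suc k g)
  obtain g' where g': "g' \<in> \<G>" "\<forall>y\<in>T. (g has_real_derivative g' y) (at y)"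
    using assms(5) Suc.prems by blast
  have d: "((\<lambda>z. g (f z)) has_derivative
      (\<lambda>h. g' (f z) * (Re h *\<^sub>R pdx f z + Im h *\<^sub>R pdy f z))) (at z)" if "z \<in> S" for z
    using has_derivative_compose[OF Ck_on_has_derivative[OF Suc.prems(1) that],
        of g "(*) (g' (f z))"] g'(2) assms(3)[OF that]
    by (auto simp: has_field_derivative_def)
  have "Ck_on k S (\<lambda>z. g' (f z))"
    using Suc.IH[OF Ck_on_Suc_imp[OF Suc.prems(1)] g'(1)] .
  then show ?case
    using Suc.prems by (intro Ck_on_SucI[OF assms(1) d]) (auto intro!: Ck_on_mult assms(1))
qed

lemma Ck_on_exp:
  fixes f :: "complex \<Rightarrow> real"
  assumes "open S" "Ck_on k S f"
  shows "Ck_on k S (\<lambda>z. exp (f z))"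
  by (rule Ck_on_compose[where T = UNIV and \<G> = "{exp}", OF assms])
    (auto intro: DERIV_exp)

lemma Ck_on_inverse_ln:
  fixes f :: "complex \<Rightarrow> real"
  assumes "open S" "Ck_on k S f" "\<And>z. z \<in> S \<Longrightarrow> 0 < f z"
  shows "Ck_on k S (\<lambda>z. ln (f z))" "Ck_on k S (\<lambda>z. inverse (f z))"
proof -
  \<comment> \<open>The derivative of ln is 1/y, and multiples of powers of 1/y are closed under
    differentiation; the same family therefore serves ln and the inverse.\<close>
  define \<G> where "\<G> = insert ln (range (\<lambda>(c, n) y. c * inverse y ^ n :: real))"
  have "\<exists>g'\<in>\<G>. \<forall>y\<in>{0<..}. (g has_real_derivative g' y) (at y)" if "g \<in> \<G>" for g
    using that unfolding \<G>_def
  proof safe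
    show "\<exists>g'\<in>insert ln (range (\<lambda>(c, n) y. c * inverse y ^ n)).
        \<forall>y\<in>{0<..}. (ln has_real_derivative g' y) (at y)"
      by (rule bexI[of _ "\<lambda>y. 1 * inverse y ^ 1"])
        (auto intro!: derivative_eq_intros image_eqI[of _ _ "(1, 1)"] simp: inverse_eq_divide)
  next
    fix c :: real and n
    show "\<exists>g'\<in>insert ln (range (\<lambda>(c, n) y. c * inverse y ^ n)).
        \<forall>y\<in>{0<..}. ((\<lambda>y. c * inverse y ^ n) has_real_derivative g' y) (at y)"
    proof (rule bexI[of _ "\<lambda>y. (- c * real n) * inverse y ^ (n + 1)"])
      have "inverse y * inverse y ^ (n - Suc 0) = inverse y ^ n" if "n > 0" for y :: real
        using that by (cases n) simp_all
      then show "\<forall>y\<in>{0<..}. ((\<lambda>y. c * inverse y ^ n) has_real_derivative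
           (- c * real n) * inverse y ^ (n + 1)) (at y)"
        by (cases "n > 0") (auto intro!: derivative_eq_intros simp: power2_eq_square mult_ac)
    qed (auto intro!: image_eqI[of _ _ "(- c * real n, n + 1)"])
  qed
  note * = Ck_on_compose[where T = "{0<..}" and \<G> = \<G>, OF assms(1,2) _ _ this]
  show "Ck_on k S (\<lambda>z. ln (f z))"
    by (rule *) (auto simp: assms(3) \<G>_def)
  have "(\<lambda>y. 1 * inverse y ^ 1) \<in> \<G>"
    unfolding \<G>_def by (rule insertI2, rule image_eqI[of _ _ "(1, 1)"]) auto
  from *[OF _ this] show "Ck_on k S (\<lambda>z. inverse (f z))"
    by (simp add: assms(3))
qed

subsection \<open>The Laplacian\<close>

lemma laplacian_cong:
  assumes "open S" "z \<in> S" "\<And>w. w \<in> S \<Longrightarrow> f w = g w"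
  shows "laplacian f z = laplacian g z"
  unfolding laplacian_def
  using pd_cong(1)[OF assms(1,2), of "pdx f" "pdx g"] pd_cong(2)[OF assms(1,2), of "pdy f" "pdy g"]
    pd_cong[OF assms(1) _ assms(3)] by simp

lemma laplacian_linear_combination:
  assumes "open S" "z \<in> S" "Ck_on 2 S f" "Ck_on 2 S g"
  shows "laplacian (\<lambda>w. a * f w + b * g w) z = a * laplacian f z + b * laplacian g z"
proof -
  have C: "Ck_on (Suc 1) S f" "Ck_on (Suc 1) S g"
    using assms(3,4) by (simp_all add: numeral_2_eq_2)
  then have C1: "Ck_on (Suc 0) S (pdx f)" "Ck_on (Suc 0) S (pdy f)"
    "Ck_on (Suc 0) S (pdx g)" "Ck_on (Suc 0) S (pdy g)" by simp_all
  have *: "((\<lambda>w. a * u w + b * v w) has_derivative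
      (\<lambda>h. a * (Re h *\<^sub>R pdx u w + Im h *\<^sub>R pdy u w) + b * (Re h *\<^sub>R pdx v w + Im h *\<^sub>R pdy v w))) (at w)"
    if "Ck_on (Suc k) S u" "Ck_on (Suc k) S v" "w \<in> S" for u v :: "complex \<Rightarrow> real" and k w
    by (intro has_derivative_add has_derivative_mult_right Ck_on_has_derivative[OF that(1,3)]
        Ck_on_has_derivative[OF that(2,3)])
  note ** = has_derivative_pd[OF *]
  have "pdx (pdx (\<lambda>w. a * f w + b * g w)) z = pdx (\<lambda>w. a * pdx f w + b * pdx g w) z"
    by (rule pd_cong(1)[OF assms(1,2)]) (simp add: **[OF C])
  moreover have "pdy (pdy (\<lambda>w. a * f w + b * g w)) z = pdy (\<lambda>w. a * pdy f w + b * pdy g w) z"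
    by (rule pd_cong(2)[OF assms(1,2)]) (simp add: **[OF C])
  ultimately show ?thesis
    by (simp add: laplacian_def **[OF C1(1,3) assms(2)] **[OF C1(2,4) assms(2)] algebra_simps)
qed

text \<open>Removes the square root, so that only a logarithm of a polynomial in the real and
  imaginary parts has to be differentiated.\<close>

lemma ln_cmod_conv: "F \<noteq> 0 \<Longrightarrow> ln (cmod F) = ln ((Re F)\<^sup>2 + (Im F)\<^sup>2) / 2"
  by (simp add: cmod_def ln_sqrt)

text \<open>The differential of log |F| is h \<mapsto> Re (G h) with G = F'/F holomorphic.
  Differentiating once more, the second derivatives in the two directions are Re G' and - Re G', and
  they cancel.\<close>

lemma
  assumes "open S" "F holomorphic_on S" "\<And>z. z \<in> S \<Longrightarrow> F z \<noteq> 0"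
  shows Ck_on_ln_cmod: "Ck_on k S (\<lambda>z. ln (cmod (F z)))"
    and laplacian_ln_cmod: "z \<in> S \<Longrightarrow> laplacian (\<lambda>z. ln (cmod (F z))) z = 0"
proof -
  have pos: "0 < (Re (F z))\<^sup>2 + (Im (F z))\<^sup>2" if "z \<in> S" for z
    using assms(3)[OF that] by (simp add: complex_neq_0)
  have "Ck_on k S (\<lambda>z. ln ((Re (F z))\<^sup>2 + (Im (F z))\<^sup>2) * (1 / 2))"
    using pos Ck_on_linear[OF bounded_linear_Re assms(1) Ck_on_holomorphic[OF assms(1,2)]]
      Ck_on_linear[OF bounded_linear_Im assms(1) Ck_on_holomorphic[OF assms(1,2)]]
    unfolding power2_eq_square
    by (intro Ck_on_mult Ck_on_inverse_ln(1) Ck_on_add Ck_on_const assms(1)) auto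
  then show "Ck_on k S (\<lambda>z. ln (cmod (F z)))"
    by (rule Ck_on_cong[OF assms(1), rotated]) (simp add: ln_cmod_conv assms(3))
  define G where "G z = deriv F z / F z" for z
  have G: "G holomorphic_on S"
    unfolding G_def using assms by (intro holomorphic_intros) auto
  have dF: "(F has_derivative (\<lambda>h. deriv F z * h)) (at z)" if "z \<in> S" for z
    using holomorphic_derivI[OF assms(2,1) that] by (simp add: has_field_derivative_def)
  have d: "((\<lambda>z. ln (cmod (F z))) has_derivative (\<lambda>h. Re (G z * h))) (at z)" if z: "z \<in> S" for z
  proof -
    have G_eq: "Re (G z * h) = (Re (deriv F z * h) * Re (F z) + Im (deriv F z * h) * Im (F z)) /
        ((Re (F z))\<^sup>2 + (Im (F z))\<^sup>2)" for h
      unfolding G_def times_divide_eq_left Re_divide by simp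
    have "((\<lambda>z. ln ((Re (F z))\<^sup>2 + (Im (F z))\<^sup>2) / 2) has_derivative
        (\<lambda>h. (2 * Re (deriv F z * h) * Re (F z) + 2 * Im (deriv F z * h) * Im (F z)) *
          inverse ((Re (F z))\<^sup>2 + (Im (F z))\<^sup>2) / 2)) (at z)"
      by (rule derivative_eq_intros dF[OF z] refl pos[OF z])+ (simp_all add: fun_eq_iff)
    then have "((\<lambda>z. ln ((Re (F z))\<^sup>2 + (Im (F z))\<^sup>2) / 2) has_derivative (\<lambda>h. Re (G z * h))) (at z)"
    proof (rule has_derivative_eq_rhs)
      have "(2 * a * r + 2 * b * i) * inverse t / 2 = (a * r + b * i) / t" for a r b i t :: real
        by (cases "t = 0") (simp_all add: field_simps)
      then show "(\<lambda>h. (2 * Re (deriv F z * h) * Re (F z) + 2 * Im (deriv F z * h) * Im (F z)) *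
          inverse ((Re (F z))\<^sup>2 + (Im (F z))\<^sup>2) / 2) = (\<lambda>h. Re (G z * h))"
        unfolding G_eq by blast
    qed
    then show ?thesis
      by (rule has_derivative_transform_within_open[OF _ assms(1) z])
        (simp add: ln_cmod_conv assms(3))
  qed
  assume z: "z \<in> S"
  have dG: "(G has_derivative (\<lambda>h. deriv G z * h)) (at z)"
    using holomorphic_derivI[OF G assms(1) z] by (simp add: has_field_derivative_def)
  have "pdx (pdx (\<lambda>z. ln (cmod (F z)))) z = pdx (\<lambda>z. Re (G z)) z"
    by (rule pd_cong(1)[OF assms(1) z]) (simp add: has_derivative_pd[OF d])
  moreover have "pdy (pdy (\<lambda>z. ln (cmod (F z)))) z = pdy (\<lambda>z. Re (G z * \<i>)) z"
    by (rule pd_cong(2)[OF assms(1) z]) (simp add: has_derivative_pd[OF d])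
  moreover have "((\<lambda>z. Re (G z * \<i>)) has_derivative (\<lambda>h. Re (deriv G z * h * \<i>))) (at z)"
    by (rule derivative_eq_intros dG refl)+ auto
  ultimately show "laplacian (\<lambda>z. ln (cmod (F z))) z = 0"
    using has_derivative_pd(1)[OF has_derivative_Re[OF dG]]
    by (simp add: laplacian_def has_derivative_pd(2))
qed

subsection \<open>A flat function\<close>

text \<open>The classical exp(-1/t), continued by zero, together with everything its derivatives
  produce: a polynomial factor in 1/t makes the family closed under differentiation.\<close>

definition flat :: "real poly \<Rightarrow> real \<Rightarrow> real" where
  "flat p t = (if 0 < t then poly p (inverse t) * exp (- inverse t) else 0)"

text \<open>The additional power of y lets the induction over the coefficients close: splitting off
  the constant coefficient raises the exponent of the remaining polynomial by one.\<close>

lemma poly_times_exp_tendsto_0: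
  "((\<lambda>y::real. y ^ j * poly p y * exp (- y)) \<longlongrightarrow> 0) at_top"
proof (induction p arbitrary: j)
  case (pCons a p)
  have "((\<lambda>y. a * (y ^ j / exp y) + y ^ Suc j * poly p y * exp (- y)) \<longlongrightarrow> a * 0 + 0) at_top"
    by (intro tendsto_intros tendsto_power_div_exp_0 pCons)
  then show ?case by (simp add: exp_minus field_simps)
qed simp

text \<open>For positive t the chain rule gives (p - p')(1/t) exp(-1/t) / t^2, whence the polynomial
  factor of degree two. At 0 both one-sided difference quotients tend to zero, since the exponential
  beats every power.\<close>

lemma flat_has_derivative:
  "(flat p has_real_derivative flat ([:0, 0, 1:] * (p - pderiv p)) t) (at t)"
proof -
  consider "t > 0" | "t < 0" | "t = 0" by linarith
  then show ?thesis
  proof cases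
    case 1
    have "((\<lambda>t. poly p (inverse t) * exp (- inverse t)) has_real_derivative
        flat ([:0, 0, 1:] * (p - pderiv p)) t) (at t)"
      using 1 by (auto intro!: derivative_eq_intros simp: flat_def power2_eq_square algebra_simps)
    then show ?thesis
      by (rule has_field_derivative_transform_within_open[of _ _ _ "{0<..}"])
        (use 1 in \<open>auto simp: flat_def\<close>)
  next
    case 2
    have "((\<lambda>t. 0) has_real_derivative flat ([:0, 0, 1:] * (p - pderiv p)) t) (at t)"
      using 2 by (simp add: flat_def)
    then show ?thesis
      by (rule has_field_derivative_transform_within_open[of _ _ _ "{..<0}"])
        (use 2 in \<open>auto simp: flat_def\<close>)
  next
    case 3
    have R: "((\<lambda>h. flat p h / h) \<longlongrightarrow> 0) (at_right 0)"
    proof (rule Lim_transform_eventually)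
      show "((\<lambda>h::real. inverse h ^ 1 * poly p (inverse h) * exp (- inverse h)) \<longlongrightarrow> 0) (at_right 0)"
        using filterlim_compose[OF poly_times_exp_tendsto_0[of 1 p] filterlim_inverse_at_top_right] .
      show "eventually (\<lambda>h. inverse h ^ 1 * poly p (inverse h) * exp (- inverse h) = flat p h / h) (at_right 0)"
        unfolding eventually_at_right_field by (rule exI[of _ 1]) (auto simp: flat_def field_simps)
    qed
    have L: "((\<lambda>h. flat p h / h) \<longlongrightarrow> 0) (at_left 0)"
    proof (rule Lim_transform_eventually)
      show "((\<lambda>h::real. 0::real) \<longlongrightarrow> 0) (at_left 0)" by simp
      show "eventually (\<lambda>h. 0 = flat p h / h) (at_left 0)"
        unfolding eventually_at_left_field by (rule exI[of _ "-1"]) (auto simp: flat_def)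
    qed
    have "((\<lambda>h. flat p h / h) \<longlongrightarrow> 0) (at 0)"
      using L R by (simp add: filterlim_split_at)
    then show ?thesis by (simp add: 3 DERIV_def flat_def[of _ 0])
  qed
qed

lemma Ck_on_flat:
  assumes "open S" "Ck_on k S f"
  shows "Ck_on k S (\<lambda>z. flat p (f z))"
  by (rule Ck_on_compose[where T = UNIV and \<G> = "range flat", OF assms])
    (use flat_has_derivative in blast)+

section \<open>Functions on a surface\<close>

locale riemann_surface =
  fixes A :: "('x::t2_space) atlas"
  assumes surface: "compact_riemann_surface A"
begin

lemma chart:
  assumes "(V, \<phi>) \<in> A"
  shows "open V" "open (\<phi> ` V)" "homeomorphism V (\<phi> ` V) \<phi> (inv_into V \<phi>)" "hol_fun A V \<phi>"
  using surface assms unfolding compact_riemann_surface_def by blast+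

lemma chart_exists:
  obtains V \<phi> where "(V, \<phi>) \<in> A" "x \<in> V"
  using surface unfolding compact_riemann_surface_def by blast

lemma inv_chart: "(V, \<phi>) \<in> A \<Longrightarrow> x \<in> V \<Longrightarrow> inv_into V \<phi> (\<phi> x) = x"
  using chart(3) by (meson homeomorphism_apply1)

lemma chart_inv_in:
  assumes "(V, \<phi>) \<in> A" "z \<in> \<phi> ` (U \<inter> V)"
  shows "inv_into V \<phi> z \<in> U" "inv_into V \<phi> z \<in> V" "\<phi> (inv_into V \<phi> z) = z"
  using assms inv_chart by auto

lemma open_chart_image:
  assumes "(V, \<phi>) \<in> A" "open U"
  shows "open (\<phi> ` (U \<inter> V))"
proof -
  have "openin (top_of_set V) (U \<inter> V)"
    using assms(2) by (auto simp: openin_open)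
  then have "openin (top_of_set (\<phi> ` V)) (\<phi> ` (U \<inter> V))"
    using homeomorphism_imp_open_map[OF chart(3)[OF assms(1)]] by blast
  then show ?thesis
    using chart(2)[OF assms(1)] openin_open_trans by blast
qed

lemma chart_cover:
  assumes "\<And>x. x \<in> U \<Longrightarrow> x \<in> T x"
  shows "\<phi> ` (U \<inter> V) = (\<Union>x\<in>U. \<phi> ` ((U \<inter> T x) \<inter> V))"
  using assms by blast

lemma hol_funD:
  "hol_fun A U f \<Longrightarrow> (V, \<phi>) \<in> A \<Longrightarrow> (\<lambda>z. f (inv_into V \<phi> z)) holomorphic_on \<phi> ` (U \<inter> V)"
  unfolding hol_fun_def by blast

lemma hol_fun_subset: "hol_fun A U f \<Longrightarrow> T \<subseteq> U \<Longrightarrow> hol_fun A T f"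
  unfolding hol_fun_def by (fast intro: holomorphic_on_subset)

lemma hol_fun_local:
  assumes "open U" "\<And>x. x \<in> U \<Longrightarrow> \<exists>T. open T \<and> x \<in> T \<and> hol_fun A (U \<inter> T) f"
  shows "hol_fun A U f"
proof -
  obtain T where T: "\<And>x. x \<in> U \<Longrightarrow> open (T x) \<and> x \<in> T x \<and> hol_fun A (U \<inter> T x) f"
    using assms(2) by metis
  show ?thesis
    unfolding hol_fun_def
  proof safe
    fix V \<phi> assume c: "(V, \<phi>) \<in> A"
    have "\<phi> ` (U \<inter> V) = (\<Union>x\<in>U. \<phi> ` ((U \<inter> T x) \<inter> V))"
      using T by (intro chart_cover) blast
    moreover have "(\<lambda>z. f (inv_into V \<phi> z)) holomorphic_on (\<Union>x\<in>U. \<phi> ` ((U \<inter> T x) \<inter> V))"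
    proof (rule holomorphic_on_UN_open)
      fix x assume "x \<in> U"
      with T have "open (T x)" "hol_fun A (U \<inter> T x) f" by blast+
      then show "(\<lambda>z. f (inv_into V \<phi> z)) holomorphic_on \<phi> ` ((U \<inter> T x) \<inter> V)"
        "open (\<phi> ` ((U \<inter> T x) \<inter> V))"
        using assms(1) by (auto intro: hol_funD[OF _ c] open_chart_image[OF c])
    qed
    ultimately show "(\<lambda>z. f (inv_into V \<phi> z)) holomorphic_on \<phi> ` (U \<inter> V)" by simp
  qed
qed

lemma hol_fun_cong:
  assumes "\<And>x. x \<in> U \<Longrightarrow> f x = g x" "hol_fun A U f"
  shows "hol_fun A U g"
  unfolding hol_fun_def
proof safe
  fix V \<phi> assume c: "(V, \<phi>) \<in> A"
  show "(\<lambda>z. g (inv_into V \<phi> z)) holomorphic_on \<phi> ` (U \<inter> V)"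
    by (rule holomorphic_transform[OF hol_funD[OF assms(2) c]])
      (simp add: assms(1) chart_inv_in[OF c])
qed

lemma hol_fun_const: "hol_fun A U (\<lambda>_. c)"
  and hol_fun_add: "hol_fun A U f \<Longrightarrow> hol_fun A U g \<Longrightarrow> hol_fun A U (\<lambda>x. f x + g x)"
  and hol_fun_diff: "hol_fun A U f \<Longrightarrow> hol_fun A U g \<Longrightarrow> hol_fun A U (\<lambda>x. f x - g x)"
  and hol_fun_mult: "hol_fun A U f \<Longrightarrow> hol_fun A U g \<Longrightarrow> hol_fun A U (\<lambda>x. f x * g x)"
  unfolding hol_fun_def by (fast intro: holomorphic_intros)+

lemma hol_fun_sum: "(\<And>i. i \<in> I \<Longrightarrow> hol_fun A U (f i)) \<Longrightarrow> hol_fun A U (\<lambda>x. \<Sum>i\<in>I. f i x)"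
  by (induction I rule: infinite_finite_induct) (auto intro: hol_fun_const hol_fun_add)

lemma hol_fun_prod: "(\<And>i. i \<in> I \<Longrightarrow> hol_fun A U (f i)) \<Longrightarrow> hol_fun A U (\<lambda>x. \<Prod>i\<in>I. f i x)"
  by (induction I rule: infinite_finite_induct) (auto intro: hol_fun_const hol_fun_mult)

lemma hol_fun_divide:
  assumes "hol_fun A U f" "hol_fun A U g" "\<And>x. x \<in> U \<Longrightarrow> g x \<noteq> 0"
  shows "hol_fun A U (\<lambda>x. f x / g x)"
  unfolding hol_fun_def
proof safe
  fix V \<phi> assume c: "(V, \<phi>) \<in> A"
  show "(\<lambda>z. f (inv_into V \<phi> z) / g (inv_into V \<phi> z)) holomorphic_on \<phi> ` (U \<inter> V)"
    by (rule holomorphic_on_divide[OF hol_funD[OF assms(1) c] hol_funD[OF assms(2) c]])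
      (simp add: assms(3) chart_inv_in[OF c])
qed

lemma continuous_from_charts:
  assumes "open U"
    and "\<And>V \<phi>. (V, \<phi>) \<in> A \<Longrightarrow> continuous_on (\<phi> ` (U \<inter> V)) (\<lambda>z. f (inv_into V \<phi> z))"
  shows "continuous_on U f"
proof -
  have "isCont f x" if x: "x \<in> U" for x
  proof -
    obtain V \<phi> where c: "(V, \<phi>) \<in> A" "x \<in> V" using chart_exists by blast
    have "continuous_on (U \<inter> V) \<phi>"
      using chart(3)[OF c(1)] by (auto simp: homeomorphism_def intro: continuous_on_subset)
    with assms(2)[OF c(1)] have "continuous_on (U \<inter> V) (\<lambda>y. f (inv_into V \<phi> (\<phi> y)))"
      by (rule continuous_on_compose2) auto
    then have "continuous_on (U \<inter> V) f"
      by (rule continuous_on_eq) (simp add: inv_chart[OF c(1)])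
    then show ?thesis
      using x c chart(1)[OF c(1)] assms(1) by (simp add: continuous_on_eq_continuous_at open_Int)
  qed
  then show ?thesis by (auto intro: continuous_at_imp_continuous_on)
qed

lemma hol_fun_continuous: "open U \<Longrightarrow> hol_fun A U f \<Longrightarrow> continuous_on U f"
  by (rule continuous_from_charts) (auto intro: holomorphic_on_imp_continuous_on hol_funD)

lemma smooth_funD:
  "smooth_fun A U f \<Longrightarrow> (V, \<phi>) \<in> A \<Longrightarrow> Ck_on k (\<phi> ` (U \<inter> V)) (\<lambda>z. f (inv_into V \<phi> z))"
  unfolding smooth_fun_def by blast

lemma smooth_fun_continuous: "open U \<Longrightarrow> smooth_fun A U f \<Longrightarrow> continuous_on U f"
  using smooth_funD[where k = 0] by (intro continuous_from_charts) auto

lemma smooth_fun_subset: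
  assumes "smooth_fun A U f" "T \<subseteq> U"
  shows "smooth_fun A T f"
  unfolding smooth_fun_def
proof safe
  fix V \<phi> k assume c: "(V, \<phi>) \<in> A"
  show "Ck_on k (\<phi> ` (T \<inter> V)) (\<lambda>z. f (inv_into V \<phi> z))"
    by (rule Ck_on_subset[OF smooth_funD[OF assms(1) c]]) (use assms(2) in blast)
qed

lemma smooth_fun_local:
  assumes "open U" "\<And>x. x \<in> U \<Longrightarrow> \<exists>T. open T \<and> x \<in> T \<and> smooth_fun A (U \<inter> T) f"
  shows "smooth_fun A U f"
  unfolding smooth_fun_def
proof safe
  fix V \<phi> k assume c: "(V, \<phi>) \<in> A"
  show "Ck_on k (\<phi> ` (U \<inter> V)) (\<lambda>z. f (inv_into V \<phi> z))"
  proof (rule Ck_on_local[OF open_chart_image[OF c assms(1)]])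
    fix z assume "z \<in> \<phi> ` (U \<inter> V)"
    then obtain x where x: "x \<in> U" "x \<in> V" "z = \<phi> x" by blast
    obtain T where T: "open T" "x \<in> T" "smooth_fun A (U \<inter> T) f" using assms(2) x(1) by blast
    have "Ck_on k (\<phi> ` ((U \<inter> T) \<inter> V)) (\<lambda>z. f (inv_into V \<phi> z))"
      by (rule smooth_funD[OF T(3) c])
    moreover have "\<phi> ` (U \<inter> V) \<inter> \<phi> ` ((U \<inter> T) \<inter> V) = \<phi> ` ((U \<inter> T) \<inter> V)" by blast
    ultimately show "\<exists>S. open S \<and> z \<in> S \<and> Ck_on k (\<phi> ` (U \<inter> V) \<inter> S) (\<lambda>z. f (inv_into V \<phi> z))"
      using T x open_chart_image[OF c open_Int[OF assms(1) T(1)]]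
      by (intro exI[of _ "\<phi> ` ((U \<inter> T) \<inter> V)"]) auto
  qed
qed

lemma smooth_fun_cong:
  assumes "open U" "\<And>x. x \<in> U \<Longrightarrow> f x = g x" "smooth_fun A U f"
  shows "smooth_fun A U g"
  unfolding smooth_fun_def
proof safe
  fix V \<phi> k assume c: "(V, \<phi>) \<in> A"
  show "Ck_on k (\<phi> ` (U \<inter> V)) (\<lambda>z. g (inv_into V \<phi> z))"
    by (rule Ck_on_cong[OF open_chart_image[OF c assms(1)] _ smooth_funD[OF assms(3) c]])
      (simp add: assms(2) chart_inv_in[OF c])
qed

lemma smooth_fun_const: "open U \<Longrightarrow> smooth_fun A U (\<lambda>_. c)"
  unfolding smooth_fun_def by (auto intro!: Ck_on_const open_chart_image)

lemma smooth_fun_hol: "open U \<Longrightarrow> hol_fun A U f \<Longrightarrow> smooth_fun A U f"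
  unfolding smooth_fun_def by (auto intro!: Ck_on_holomorphic open_chart_image hol_funD)

lemma smooth_fun_linear:
  "bounded_linear l \<Longrightarrow> open U \<Longrightarrow> smooth_fun A U f \<Longrightarrow> smooth_fun A U (\<lambda>x. l (f x))"
  unfolding smooth_fun_def by (auto intro!: Ck_on_linear[of l] open_chart_image)

lemma smooth_fun_add:
  "open U \<Longrightarrow> smooth_fun A U f \<Longrightarrow> smooth_fun A U g \<Longrightarrow> smooth_fun A U (\<lambda>x. f x + g x)"
  unfolding smooth_fun_def by (auto intro!: Ck_on_add open_chart_image)

lemma smooth_fun_sum:
  "open U \<Longrightarrow> (\<And>i. i \<in> I \<Longrightarrow> smooth_fun A U (f i)) \<Longrightarrow> smooth_fun A U (\<lambda>x. \<Sum>i\<in>I. f i x)"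
  by (induction I rule: infinite_finite_induct)
    (auto intro: smooth_fun_const smooth_fun_add)

lemma smooth_fun_mult:
  fixes f g :: "'x \<Rightarrow> 'b::real_normed_algebra"
  shows "open U \<Longrightarrow> smooth_fun A U f \<Longrightarrow> smooth_fun A U g \<Longrightarrow> smooth_fun A U (\<lambda>x. f x * g x)"
  unfolding smooth_fun_def by (auto intro!: Ck_on_mult open_chart_image)

lemma smooth_fun_prod:
  fixes f :: "'i \<Rightarrow> 'x \<Rightarrow> 'b::real_normed_field"
  shows "open U \<Longrightarrow> (\<And>i. i \<in> I \<Longrightarrow> smooth_fun A U (f i)) \<Longrightarrow> smooth_fun A U (\<lambda>x. \<Prod>i\<in>I. f i x)"
  by (induction I rule: infinite_finite_induct)
    (auto intro: smooth_fun_const smooth_fun_mult)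

lemma smooth_fun_exp:
  fixes f :: "'x \<Rightarrow> real"
  shows "open U \<Longrightarrow> smooth_fun A U f \<Longrightarrow> smooth_fun A U (\<lambda>x. exp (f x))"
  unfolding smooth_fun_def by (auto intro!: Ck_on_exp open_chart_image)

lemma
  fixes f :: "'x \<Rightarrow> real"
  assumes "open U" "smooth_fun A U f" "\<And>x. x \<in> U \<Longrightarrow> 0 < f x"
  shows smooth_fun_ln: "smooth_fun A U (\<lambda>x. ln (f x))"
    and smooth_fun_inverse: "smooth_fun A U (\<lambda>x. inverse (f x))"
proof -
  have "0 < f (inv_into V \<phi> z)" if "(V, \<phi>) \<in> A" "z \<in> \<phi> ` (U \<inter> V)" for V \<phi> z
    using assms(3) chart_inv_in[OF that] by blast
  note * = Ck_on_inverse_ln[OF open_chart_image[OF _ assms(1)] smooth_funD[OF assms(2)] this]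
  show "smooth_fun A U (\<lambda>x. ln (f x))" "smooth_fun A U (\<lambda>x. inverse (f x))"
    unfolding smooth_fun_def using * by blast+
qed

subsection \<open>Partitions of unity\<close>

text \<open>The bump is written down in the coordinate and continued by zero. The continuation is
  smooth because the preimage of a closed disc is compact, hence closed in the Hausdorff
  surface.\<close>

lemma bump_exists:
  assumes c: "(V, \<phi>) \<in> A" and "x \<in> V" "open T" "x \<in> T"
  obtains b :: "'x \<Rightarrow> real"
  where "smooth_fun A UNIV b" "\<And>y. 0 \<le> b y" "0 < b x" "closure {y. b y \<noteq> 0} \<subseteq> T \<inter> V"
proof -
  obtain e where e: "0 < e" "cball (\<phi> x) e \<subseteq> \<phi> ` (T \<inter> V)"
    using open_chart_image[OF c assms(3)] assms open_contains_cball[of "\<phi> ` (T \<inter> V)"] by blast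
  define K where "K = inv_into V \<phi> ` cball (\<phi> x) e"
  have "continuous_on (\<phi> ` V) (inv_into V \<phi>)"
    using chart(3)[OF c] by (simp add: homeomorphism_def)
  then have "compact K"
    unfolding K_def using e(2) by (intro compact_continuous_image) (auto intro: continuous_on_subset)
  then have "closed K" by (rule compact_imp_closed)
  have KT: "K \<subseteq> T \<inter> V"
    using e(2) chart_inv_in[OF c, of _ T] unfolding K_def by blast
  \<comment> \<open>\<open>flat 1\<close> is positive exactly for positive arguments, so b is
    positive precisely over the open disc of radius e, and using the squared modulus keeps the
    argument smooth at the centre.\<close>
  define b where "b y = (if y \<in> V then flat 1 (e\<^sup>2 - (cmod (\<phi> y - \<phi> x))\<^sup>2) else 0)" for y
  have bK: "y \<in> K" if "b y \<noteq> 0" for y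
  proof -
    have "y \<in> V" "(cmod (\<phi> y - \<phi> x))\<^sup>2 < e\<^sup>2"
      using that by (auto simp: b_def flat_def split: if_splits)
    then have "\<phi> y \<in> cball (\<phi> x) e"
      using e(1) power_less_imp_less_base[of "cmod (\<phi> y - \<phi> x)" 2 e]
      by (simp add: dist_norm norm_minus_commute)
    then show ?thesis
      unfolding K_def using inv_chart[OF c \<open>y \<in> V\<close>] by force
  qed
  have V: "smooth_fun A V b"
    unfolding smooth_fun_def
  proof safe
    fix V' \<phi>' k assume c': "(V', \<phi>') \<in> A"
    let ?S = "\<phi>' ` (V \<inter> V')" and ?F = "\<lambda>z. \<phi> (inv_into V' \<phi>' z) - \<phi> x"
    have S: "open ?S" by (rule open_chart_image[OF c' chart(1)[OF c]])
    have "?F holomorphic_on ?S"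
      by (intro holomorphic_intros hol_funD[OF chart(4)[OF c] c'])
    note F = Ck_on_holomorphic[OF S this]
    have "Ck_on k ?S (\<lambda>z. flat 1 (e\<^sup>2 + - ((Re (?F z))\<^sup>2 + (Im (?F z))\<^sup>2)))"
      unfolding power2_eq_square[of "Re _"] power2_eq_square[of "Im _"]
      by (intro Ck_on_flat Ck_on_add Ck_on_const Ck_on_linear[OF bounded_linear_minus[OF bounded_linear_ident]]
          Ck_on_mult Ck_on_linear[OF bounded_linear_Re _ F] Ck_on_linear[OF bounded_linear_Im _ F] S)
    then show "Ck_on k ?S (\<lambda>z. b (inv_into V' \<phi>' z))"
      by (rule Ck_on_cong[OF S, rotated]) (simp add: b_def chart_inv_in[OF c'] cmod_power2 algebra_simps)
  qed
  have "smooth_fun A (- K) (\<lambda>_. 0 :: real)"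
    by (rule smooth_fun_const) (use \<open>closed K\<close> in auto)
  then have "smooth_fun A (- K) b"
    by (rule smooth_fun_cong[rotated 2]) (use \<open>closed K\<close> bK in auto)
  \<comment> \<open>V and the complement of K are open and cover the surface; b is smooth on the
    first and vanishes on the second.\<close>
  have "\<exists>S. open S \<and> y \<in> S \<and> smooth_fun A (UNIV \<inter> S) b" for y
  proof (cases "y \<in> V")
    case True
    with V chart(1)[OF c] show ?thesis by auto
  next
    case False
    then have "y \<in> - K" using KT by blast
    with \<open>smooth_fun A (- K) b\<close> \<open>closed K\<close> show ?thesis by (intro exI[of _ "- K"]) auto
  qed
  then have "smooth_fun A UNIV b" by (intro smooth_fun_local) auto
  moreover have "0 \<le> b y" for y by (simp add: b_def flat_def)
  moreover have "0 < b x" using assms(2) e(1) by (simp add: b_def flat_def)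
  moreover have "closure {y. b y \<noteq> 0} \<subseteq> T \<inter> V"
    using closure_minimal[of "{y. b y \<noteq> 0}" K] \<open>closed K\<close> bK KT by blast
  ultimately show thesis by (rule that)
qed

text \<open>Compactness extracts finitely many bumps with positive sum. The sum is not normalized
  here: the construction of a Hermitian metric uses it as it is, and a partition of unity divides by
  it.\<close>

lemma bump_cover:
  assumes "\<And>x. open (T x) \<and> x \<in> T x"
  obtains P :: "'x set" and c :: "'x \<Rightarrow> 'x set \<times> ('x \<Rightarrow> complex)" and b :: "'x \<Rightarrow> 'x \<Rightarrow> real"
  where "finite P" "\<And>p. c p \<in> A" "\<And>p. smooth_fun A UNIV (b p)" "\<And>p y. 0 \<le> b p y"
    "\<And>p. closure {y. b p y \<noteq> 0} \<subseteq> T p \<inter> fst (c p)" "\<And>y. 0 < (\<Sum>p\<in>P. b p y)"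
proof -
  have "\<exists>c (b :: 'x \<Rightarrow> real). c \<in> A \<and> smooth_fun A UNIV b \<and> (\<forall>y. 0 \<le> b y) \<and> 0 < b p \<and>
      closure {y. b y \<noteq> 0} \<subseteq> T p \<inter> fst c" for p
  proof -
    obtain V \<phi> where c: "(V, \<phi>) \<in> A" "p \<in> V" using chart_exists by blast
    obtain b :: "'x \<Rightarrow> real" where "smooth_fun A UNIV b" "\<And>y. 0 \<le> b y" "0 < b p"
      "closure {y. b y \<noteq> 0} \<subseteq> T p \<inter> V"
      using bump_exists[OF c, of "T p"] assms[of p] by blast
    then show ?thesis using c(1) by (intro exI[of _ "(V, \<phi>)"] exI[of _ b]) simp
  qed
  then obtain c and b :: "'x \<Rightarrow> 'x \<Rightarrow> real" where
    cb: "c p \<in> A \<and> smooth_fun A UNIV (b p) \<and> (\<forall>y. 0 \<le> b p y) \<and> 0 < b p p \<and>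
      closure {y. b p y \<noteq> 0} \<subseteq> T p \<inter> fst (c p)" for p
    by metis
  have "open {y. 0 < b p y}" for p
    using smooth_fun_continuous[of UNIV "b p"] cb[of p] open_Collect_less[of "\<lambda>_. 0" "b p"]
    by simp
  moreover have "compact (UNIV :: 'x set)"
    using surface by (simp add: compact_riemann_surface_def)
  moreover have "UNIV \<subseteq> (\<Union>p\<in>UNIV. {y. 0 < b p y})" using cb by auto
  ultimately obtain P where P: "finite P" "UNIV \<subseteq> (\<Union>p\<in>P. {y. 0 < b p y})"
    by (metis compactE_image)
  have "0 < (\<Sum>p\<in>P. b p y)" for y
  proof -
    obtain p where "p \<in> P" "0 < b p y" using P(2) by blast
    then show ?thesis using P(1) cb by (meson sum_pos2)
  qed
  with P(1) cb show thesis by (intro that[of P c b]) auto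
qed

lemma partition_of_unity:
  obtains J and \<rho> :: "'x set \<times> ('x \<Rightarrow> complex) \<Rightarrow> 'x \<Rightarrow> real"
  where "finite J" "J \<subseteq> A"
    "\<And>c. c \<in> J \<Longrightarrow> smooth_fun A UNIV (\<rho> c) \<and> (\<forall>x. 0 \<le> \<rho> c x) \<and> closure {x. \<rho> c x \<noteq> 0} \<subseteq> fst c"
    "\<And>x. (\<Sum>c\<in>J. \<rho> c x) = 1"
proof -
  obtain P c and b :: "'x \<Rightarrow> 'x \<Rightarrow> real" where P: "finite P" "\<And>p. c p \<in> A"
    and b: "\<And>p. smooth_fun A UNIV (b p)" "\<And>p y. 0 \<le> b p y"
      "\<And>p. closure {y. b p y \<noteq> 0} \<subseteq> UNIV \<inter> fst (c p)" "\<And>y. 0 < (\<Sum>p\<in>P. b p y)"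
    using bump_cover[of "\<lambda>_. UNIV"] by auto
  \<comment> \<open>\<open>has_form_integral\<close> indexes its functions by charts, while several
    bumps may live in one chart; those are added up.\<close>
  define \<rho> where "\<rho> d x = inverse (\<Sum>p\<in>P. b p x) * (\<Sum>p | p \<in> P \<and> c p = d. b p x)" for d x
  show thesis
  proof (rule that[of "c ` P" \<rho>])
    fix d assume "d \<in> c ` P"
    have "smooth_fun A UNIV (\<rho> d)"
      unfolding \<rho>_def using b(4)
      by (intro smooth_fun_mult smooth_fun_inverse smooth_fun_sum b(1)) auto
    moreover have "0 \<le> \<rho> d x" for x
      unfolding \<rho>_def using b(4)[of x] by (intro mult_nonneg_nonneg sum_nonneg b(2)) auto
    moreover have "closure {x. \<rho> d x \<noteq> 0} \<subseteq> (\<Union>p\<in>{p\<in>P. c p = d}. closure {y. b p y \<noteq> 0})"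
    proof (rule closure_minimal)
      show "{x. \<rho> d x \<noteq> 0} \<subseteq> (\<Union>p\<in>{p\<in>P. c p = d}. closure {y. b p y \<noteq> 0})"
      proof
        fix x assume "x \<in> {x. \<rho> d x \<noteq> 0}"
        then have "(\<Sum>p | p \<in> P \<and> c p = d. b p x) \<noteq> 0" by (auto simp: \<rho>_def)
        then obtain p where "p \<in> P" "c p = d" "b p x \<noteq> 0" by (auto elim: sum.not_neutral_contains_not_neutral)
        then show "x \<in> (\<Union>p\<in>{p\<in>P. c p = d}. closure {y. b p y \<noteq> 0})"
          using closure_subset[of "{y. b p y \<noteq> 0}"] by blast
      qed
    qed (use P(1) in \<open>auto intro!: closed_UN\<close>)
    ultimately show "smooth_fun A UNIV (\<rho> d) \<and> (\<forall>x. 0 \<le> \<rho> d x) \<and> closure {x. \<rho> d x \<noteq> 0} \<subseteq> fst d"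
      using b(3) by blast
  next
    fix x
    have "(\<Sum>d\<in>c ` P. \<rho> d x) = inverse (\<Sum>p\<in>P. b p x) * (\<Sum>p\<in>P. b p x)"
      unfolding \<rho>_def sum_distrib_left[symmetric] using P(1)
      by (simp add: sum.image_gen[symmetric, of P "\<lambda>p. b p x" c])
    then show "(\<Sum>d\<in>c ` P. \<rho> d x) = 1" using b(4)[of x] by simp
  qed (use P in auto)
qed

end

section \<open>Bases and pairings in a fibre\<close>

lemma matrix_inv:
  fixes M :: "complex ^ 'n ^ 'n"
  assumes "invertible M"
  shows "M ** matrix_inv M = mat 1" "matrix_inv M ** M = mat 1"
proof -
  have "\<exists>N. M ** N = mat 1 \<and> N ** M = mat 1"
    using assms by (simp add: invertible_def)
  then have "M ** matrix_inv M = mat 1 \<and> matrix_inv M ** M = mat 1"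
    unfolding matrix_inv_def by (rule someI_ex)
  then show "M ** matrix_inv M = mat 1" "matrix_inv M ** M = mat 1" by auto
qed

lemma matrix_inv_unique:
  fixes M N :: "complex ^ 'n ^ 'n"
  assumes "invertible M" "M ** N = mat 1"
  shows "N = matrix_inv M"
  using matrix_inv[OF assms(1)] assms(2) by (metis matrix_mul_assoc matrix_mul_lid matrix_mul_rid)

lemma invertible_matrix_inv: "invertible (M :: complex ^ 'n ^ 'n) \<Longrightarrow> invertible (matrix_inv M)"
  using matrix_inv invertible_def by blast

lemma matrix_inv_mult:
  fixes M N :: "complex ^ 'n ^ 'n"
  assumes "invertible M" "invertible N"
  shows "matrix_inv (M ** N) = matrix_inv N ** matrix_inv M"
proof -
  have "(M ** N) ** (matrix_inv N ** matrix_inv M) = M ** (N ** matrix_inv N) ** matrix_inv M"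
    by (simp add: matrix_mul_assoc)
  then have "(M ** N) ** (matrix_inv N ** matrix_inv M) = mat 1"
    using assms by (simp add: matrix_inv)
  from matrix_inv_unique[OF invertible_mult[OF assms] this] show ?thesis by simp
qed

lemma matrix_inv_vec:
  fixes M :: "complex ^ 'n ^ 'n"
  assumes "invertible M"
  shows "M *v (matrix_inv M *v v) = v" "matrix_inv M *v (M *v v) = v"
  using matrix_inv[OF assms] by (simp_all add: matrix_vector_mul_assoc)

lemma invertible_iff_ker:
  "invertible (M :: complex ^ 'n ^ 'n) \<longleftrightarrow> (\<forall>v. M *v v = 0 \<longrightarrow> v = 0)"
  by (simp add: invertible_left_inverse matrix_left_invertible_ker)

lemma matrix_vector_mult_sum:
  fixes M :: "complex ^ 'n ^ 'm"
  shows "M *v (\<Sum>i\<in>I. f i) = (\<Sum>i\<in>I. M *v f i)"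
  by (induction I rule: infinite_finite_induct) (simp_all add: matrix_vector_right_distrib)

lemma matrix_vector_mult_smult:
  fixes M :: "complex ^ 'n ^ 'm"
  shows "M *v (a *s v) = a *s (M *v v)"
  by (simp add: vec_eq_iff matrix_vector_mult_def sum_distrib_left mult.left_commute)

text \<open>The pointwise content of \<open>local_frame\<close>. Numbered vectors make it easy to
  truncate and concatenate bases.\<close>

definition is_basis :: "nat \<Rightarrow> (nat \<Rightarrow> complex ^ 'n) \<Rightarrow> (complex ^ 'n) set \<Rightarrow> bool" where
  "is_basis r v S \<longleftrightarrow>
     inj_on v {..<r} \<and> vec.independent (v ` {..<r}) \<and> vec.span (v ` {..<r}) = S"

lemma basis_sum:
  assumes "is_basis r v S" "w \<in> S"
  shows "\<exists>c. w = (\<Sum>i<r. c i *s v i)"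
proof -
  have "w \<in> range (\<lambda>u. \<Sum>a\<in>v ` {..<r}. u a *s a)"
    using assms vec.span_finite[of "v ` {..<r}"] by (auto simp: is_basis_def)
  then obtain u where "w = (\<Sum>a\<in>v ` {..<r}. u a *s a)" by blast
  then have "w = (\<Sum>i<r. u (v i) *s v i)"
    using assms(1) by (simp add: is_basis_def sum.reindex)
  then show ?thesis by (rule exI[of _ "\<lambda>i. u (v i)"])
qed

lemma basis_in: "is_basis r v S \<Longrightarrow> i < r \<Longrightarrow> v i \<in> S"
  unfolding is_basis_def using vec.span_base[of "v i" "v ` {..<r}"] by auto

lemma basis_subspace: "is_basis r v S \<Longrightarrow> vec.subspace S"
  unfolding is_basis_def using vec.subspace_span by blast

lemma basis_sum_in: "is_basis r v S \<Longrightarrow> (\<Sum>i<r. c i *s v i) \<in> S"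
proof (rule vec.subspace_sum)
  assume "is_basis r v S"
  then show "vec.subspace S" "\<And>i. i \<in> {..<r} \<Longrightarrow> c i *s v i \<in> S"
    using basis_subspace[of r v S] basis_in[of r v S] by (auto intro: vec.subspace_scale)
qed

lemma basis_independent:
  assumes "is_basis r v S" "(\<Sum>i<r. c i *s v i) = 0" "i < r"
  shows "c i = 0"
proof -
  define u where "u a = c (inv_into {..<r} v a)" for a
  have inj: "inj_on v {..<r}" and ind: "vec.independent (v ` {..<r})"
    using assms(1) by (auto simp: is_basis_def)
  have "(\<Sum>a\<in>v ` {..<r}. u a *s a) = (\<Sum>i<r. u (v i) *s v i)"
    using inj by (simp add: sum.reindex)
  also have "\<dots> = (\<Sum>i<r. c i *s v i)"
    by (rule sum.cong) (simp_all add: u_def inv_into_f_f[OF inj])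
  finally have "u (v i) = 0"
    using vec.independentD[OF ind, of "v ` {..<r}" u "v i"] assms(2,3) by simp
  then show ?thesis using inv_into_f_f[OF inj, of i] assms(3) by (simp add: u_def)
qed

lemma basisI:
  assumes ind: "\<And>c. (\<Sum>i<r. c i *s v i) = 0 \<Longrightarrow> \<forall>i<r. c i = 0"
    and mem: "\<And>i. i < r \<Longrightarrow> v i \<in> S" and sub: "vec.subspace S"
    and span: "\<And>w. w \<in> S \<Longrightarrow> \<exists>c. w = (\<Sum>i<r. c i *s v i)"
  shows "is_basis r v S"
proof -
  have inj: "inj_on v {..<r}"
  proof (rule inj_onI, rule ccontr)
    fix i j assume ij: "i \<in> {..<r}" "j \<in> {..<r}" "v i = v j" "i \<noteq> j"
    define c :: "nat \<Rightarrow> complex" where "c k = (if k = i then 1 else 0) - (if k = j then 1 else 0)" for k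
    have "(\<Sum>k<r. c k *s v k) =
        (\<Sum>k<r. if k = i then v k else 0) - (\<Sum>k<r. if k = j then v k else 0)"
      unfolding sum_subtractf[symmetric]
      by (rule sum.cong) (auto simp: c_def vec.scale_left_diff_distrib)
    also have "\<dots> = 0" using ij by simp
    finally have "c i = 0" using ind ij(1) by blast
    with ij(4) show False by (simp add: c_def)
  qed
  have "vec.independent (v ` {..<r})"
  proof (rule vec.independent_if_scalars_zero)
    fix u a assume 0: "(\<Sum>a\<in>v ` {..<r}. u a *s a) = 0" and a: "a \<in> v ` {..<r}"
    then have "(\<Sum>i<r. u (v i) *s v i) = 0" using inj by (simp add: sum.reindex)
    then show "u a = 0" using ind[of "\<lambda>i. u (v i)"] a by blast
  qed simp
  moreover have "vec.span (v ` {..<r}) = S"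
  proof
    show "vec.span (v ` {..<r}) \<subseteq> S" using mem sub by (intro vec.span_minimal) auto
    show "S \<subseteq> vec.span (v ` {..<r})"
    proof
      fix w assume "w \<in> S"
      then obtain c where c: "w = (\<Sum>i<r. c i *s v i)" using span by blast
      show "w \<in> vec.span (v ` {..<r})"
        unfolding c by (intro vec.span_sum vec.span_scale vec.span_base) auto
    qed
  qed
  ultimately show ?thesis using inj by (simp add: is_basis_def)
qed

lemma basis_rank:
  fixes v :: "nat \<Rightarrow> complex ^ 'n"
  assumes "is_basis r v S"
  shows "r = vec.dim S"
  using assms vec.dim_eq_card[of "v ` {..<r}" S]
  by (auto simp: is_basis_def card_image vec.span_span)

lemma basis_of_set:
  assumes "finite B" "vec.independent B" "vec.span B = S"
  obtains v where "is_basis (card B) v S"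
proof -
  obtain v where "bij_betw v {0..<card B} B" using ex_bij_betw_nat_finite[OF assms(1)] by blast
  then have "is_basis (card B) v S"
    using assms(2,3) by (simp add: is_basis_def bij_betw_def atLeast0LessThan)
  then show thesis by (rule that)
qed

lemma basis_exists:
  fixes S :: "(complex ^ 'n) set"
  assumes "vec.subspace S"
  obtains v where "is_basis (vec.dim S) v S"
proof -
  obtain B where B: "B \<subseteq> S" "vec.independent B" "S \<subseteq> vec.span B" "card B = vec.dim S"
    using vec.basis_exists[of S] by blast
  then have "vec.span B = S" using vec.span_minimal[OF B(1) assms] by blast
  then show thesis
    using basis_of_set[OF vec.finiteI_independent[OF B(2)] B(2)] B(4) that by metis
qed

lemma basis_extend:
  fixes v :: "nat \<Rightarrow> complex ^ 'n"
  assumes "is_basis r v S"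
  obtains f where "r \<le> CARD('n)" "\<And>i. i < r \<Longrightarrow> f i = v i" "is_basis CARD('n) f UNIV"
proof -
  let ?B = "v ` {..<r}"
  define E where "E = vec.extend_basis ?B"
  have inj: "inj_on v {..<r}" and ind: "vec.independent ?B" using assms by (auto simp: is_basis_def)
  have E: "?B \<subseteq> E" "vec.independent E" "vec.span E = UNIV"
    unfolding E_def using vec.extend_basis_superset[OF ind] vec.independent_extend_basis[OF ind]
      vec.span_extend_basis[OF ind] by auto
  have finE: "finite E" using vec.finiteI_independent[OF E(2)] .
  have cE: "card E = CARD('n)"
    using vec.dim_eq_card[of E UNIV] E(2,3) by (simp add: vec.dim_UNIV card_cart_basis)
  have cB: "card ?B = r" using inj by (simp add: card_image)
  have r: "r \<le> CARD('n)" using card_mono[OF finE E(1)] cE cB by simp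
  have "card (E - ?B) = card {r..<CARD('n)}"
    using card_Diff_subset[OF _ E(1)] cE cB by simp
  then obtain g where g: "bij_betw g {r..<CARD('n)} (E - ?B)"
    using finite_same_card_bij[of "{r..<CARD('n)}" "E - ?B"] finE by auto
  define f where "f i = (if i < r then v i else g i)" for i
  have "bij_betw f ({..<r} \<union> {r..<CARD('n)}) (?B \<union> (E - ?B))"
  proof (rule bij_betw_combine)
    show "bij_betw f {..<r} ?B"
      using inj by (auto simp: bij_betw_def f_def inj_on_def)
    show "bij_betw f {r..<CARD('n)} (E - ?B)"
      using g by (rule bij_betw_cong[THEN iffD1, rotated]) (simp add: f_def)
  qed auto
  moreover have "{..<r} \<union> {r..<CARD('n)} = {..<CARD('n)}" "?B \<union> (E - ?B) = E"
    using r E(1) by auto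
  ultimately have "is_basis CARD('n) f UNIV"
    using E(2,3) by (simp add: is_basis_def bij_betw_def)
  with r show thesis by (intro that[of f]) (auto simp: f_def)
qed

text \<open>A fixed numbering of the index type, with inverse \<open>xi\<close>; it translates
  between matrices indexed by \<open>'n\<close> and bases numbered by natural numbers.\<close>

definition ix :: "'n::finite \<Rightarrow> nat" where
  "ix = (SOME g. bij_betw g UNIV {..<CARD('n)})"

definition xi :: "nat \<Rightarrow> 'n::finite" where
  "xi = inv_into UNIV ix"

lemma ix_bij: "bij_betw (ix :: 'n::finite \<Rightarrow> nat) UNIV {..<CARD('n)}"
proof -
  have "\<exists>g. bij_betw g (UNIV :: 'n set) {..<CARD('n)}"
    using ex_bij_betw_finite_nat[of "UNIV :: 'n set"] by (simp add: atLeast0LessThan)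
  then show ?thesis unfolding ix_def by (rule someI_ex)
qed

lemma ix_less: "ix (b :: 'n::finite) < CARD('n)"
  using ix_bij by (auto simp: bij_betw_def)

lemma xi_ix: "xi (ix (b :: 'n::finite)) = b" "k < CARD('n) \<Longrightarrow> ix (xi k :: 'n::finite) = k"
  using ix_bij[where ?'n = 'n] f_inv_into_f[of k "ix :: 'n \<Rightarrow> nat" UNIV]
  by (simp_all add: xi_def bij_betw_def)

lemma sum_ix: "(\<Sum>b\<in>(UNIV :: 'n::finite set). g (ix b)) = (\<Sum>k<CARD('n). g k)"
  by (rule sum.reindex_bij_betw[OF ix_bij])

definition fm :: "(nat \<Rightarrow> complex ^ 'n) \<Rightarrow> complex ^ 'n ^ 'n" where
  "fm f = (\<chi> a b. f (ix b) $ a)"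

lemma fm_mult: "fm f *v (\<chi> b. c (ix b)) = (\<Sum>k<CARD('n). c k *s f k)"
  for f :: "nat \<Rightarrow> complex ^ 'n"
  by (simp add: vec_eq_iff fm_def matrix_vector_mult_def mult.commute
      flip: sum_ix[where ?'n = 'n])

lemma fm_comp: "M ** fm f = fm (\<lambda>i. M *v f i)"
  by (simp add: vec_eq_iff fm_def matrix_vector_mult_def matrix_matrix_mult_def)

text \<open>The coordinates of v in the basis f. The inverse of the frame matrix is used so that
  holomorphic dependence on a point can be read off.\<close>

definition cf :: "(nat \<Rightarrow> complex ^ 'n) \<Rightarrow> complex ^ 'n \<Rightarrow> nat \<Rightarrow> complex" where
  "cf f v k = (matrix_inv (fm f) *v v) $ xi k"

lemma cf_expand:
  fixes f :: "nat \<Rightarrow> complex ^ 'n"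
  assumes "invertible (fm f)"
  shows "v = (\<Sum>k<CARD('n). cf f v k *s f k)"
proof -
  have "(\<chi> b. cf f v (ix b)) = matrix_inv (fm f) *v v"
    by (simp add: vec_eq_iff cf_def xi_ix)
  then show ?thesis
    unfolding fm_mult[symmetric] by (simp add: matrix_inv_vec[OF assms])
qed

lemma cf_sum:
  fixes f :: "nat \<Rightarrow> complex ^ 'n"
  assumes "invertible (fm f)" "k < CARD('n)"
  shows "cf f (\<Sum>k<CARD('n). c k *s f k) k = c k"
  unfolding fm_mult[symmetric] cf_def using assms by (simp add: matrix_inv_vec xi_ix)

lemma basis_iff_fm:
  fixes f :: "nat \<Rightarrow> complex ^ 'n"
  shows "is_basis CARD('n) f UNIV \<longleftrightarrow> invertible (fm f)"
proof
  assume b: "is_basis CARD('n) f UNIV"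
  show "invertible (fm f)"
    unfolding invertible_iff_ker
  proof safe
    fix v :: "complex ^ 'n" assume "fm f *v v = 0"
    moreover have "v = (\<chi> b. (\<lambda>k. v $ xi k) (ix b))" by (simp add: vec_eq_iff xi_ix)
    ultimately have "(\<Sum>k<CARD('n). v $ xi k *s f k) = 0"
      using fm_mult[of f "\<lambda>k. v $ xi k"] by simp
    then have "v $ k = 0" for k :: 'n
      using basis_independent[OF b, of "\<lambda>k. v $ xi k" "ix k"] by (simp add: xi_ix ix_less)
    then show "v = 0" by (simp add: vec_eq_iff)
  qed
next
  assume i: "invertible (fm f)"
  show "is_basis CARD('n) f UNIV"
  proof (rule basisI)
    fix c assume "(\<Sum>k<CARD('n). c k *s f k) = 0"
    then show "\<forall>k<CARD('n). c k = 0" using cf_sum[OF i, of _ c] by (simp add: cf_def)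
  qed (use cf_expand[OF i] in auto)
qed

lemma cf_eq:
  fixes f :: "nat \<Rightarrow> complex ^ 'n"
  assumes "invertible (fm f)" "r \<le> CARD('n)" "k < CARD('n)"
  shows "cf f (\<Sum>i<r. c i *s f i) k = (if k < r then c k else 0)"
proof -
  have "(\<Sum>i<r. c i *s f i) = (\<Sum>i<CARD('n). (if i < r then c i else 0) *s f i)"
    using assms(2) by (intro sum.mono_neutral_cong_left) auto
  then show ?thesis using cf_sum[OF assms(1,3)] by simp
qed

subsection \<open>Projections\<close>

text \<open>For a basis f of the whole fibre, the projection onto the span of the first r vectors
  along the span of the others.\<close>

definition proj_mat :: "nat \<Rightarrow> (nat \<Rightarrow> complex ^ 'n) \<Rightarrow> complex ^ 'n ^ 'n" where
  "proj_mat r f = (\<chi> a b. \<Sum>k<r. f k $ a * matrix_inv (fm f) $ xi k $ b)"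

lemma proj_mat_mult: "proj_mat r f *v v = (\<Sum>k<r. cf f v k *s f k)"
proof -
  have "(\<Sum>b\<in>UNIV. (\<Sum>k<r. f k $ a * matrix_inv (fm f) $ xi k $ b) * v $ b) =
        (\<Sum>k<r. (\<Sum>b\<in>UNIV. matrix_inv (fm f) $ xi k $ b * v $ b) * f k $ a)" for a
    unfolding sum_distrib_right by (subst sum.swap) (simp add: mult_ac)
  then show ?thesis
    by (simp add: vec_eq_iff proj_mat_def cf_def matrix_vector_mult_def)
qed

text \<open>Only the image is prescribed; the kernel, that is, the choice of a complement, is kept
  separate.\<close>

definition projection :: "complex ^ 'n ^ 'n \<Rightarrow> (complex ^ 'n) set \<Rightarrow> bool" where
  "projection P S \<longleftrightarrow> (\<forall>v. P *v v \<in> S) \<and> (\<forall>v\<in>S. P *v v = v)"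

lemma proj_mat_projection:
  fixes f :: "nat \<Rightarrow> complex ^ 'n"
  assumes "is_basis r f S" "is_basis CARD('n) f UNIV" "r \<le> CARD('n)"
  shows "projection (proj_mat r f) S"
  unfolding projection_def
proof safe
  have i: "invertible (fm f)" using assms(2) basis_iff_fm by blast
  fix v
  show "proj_mat r f *v v \<in> S" unfolding proj_mat_mult by (rule basis_sum_in[OF assms(1)])
  assume "v \<in> S"
  then obtain c where c: "v = (\<Sum>k<r. c k *s f k)" using basis_sum[OF assms(1)] by blast
  have "cf f v k = c k" if "k < r" for k
    unfolding c using cf_eq[OF i assms(3), of k c] that assms(3) by simp
  then show "proj_mat r f *v v = v"
    unfolding proj_mat_mult c by simp
qed

lemma basis_cong: "is_basis r v S \<Longrightarrow> (\<And>i. i < r \<Longrightarrow> f i = v i) \<Longrightarrow> is_basis r f S"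
  unfolding is_basis_def
  by (metis (no_types, lifting) image_cong inj_on_cong lessThan_iff)

lemma projection_exists:
  fixes S :: "(complex ^ 'n) set"
  assumes "vec.subspace S"
  obtains P where "projection P S"
proof -
  obtain v where v: "is_basis (vec.dim S) v S" using basis_exists[OF assms] .
  obtain f where "vec.dim S \<le> CARD('n)" "\<And>i. i < vec.dim S \<Longrightarrow> f i = v i" "is_basis CARD('n) f UNIV"
    using basis_extend[OF v] by blast
  then show thesis
    using proj_mat_projection[OF basis_cong[OF v]] that by metis
qed

subsection \<open>Orthogonals and adjoints\<close>

lemma pairing_eq: "pairing q u v = (\<Sum>i\<in>UNIV. u $ i * (q *v v) $ i)"
  by (simp add: pairing_def matrix_vector_mult_def sum_distrib_left mult.assoc)

lemma pairing_add: "pairing q (u + u') v = pairing q u v + pairing q u' v"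
    "pairing q u (v + v') = pairing q u v + pairing q u v'"
  and pairing_diff: "pairing q (u - u') v = pairing q u v - pairing q u' v"
    "pairing q u (v - v') = pairing q u v - pairing q u v'"
  and pairing_scale: "pairing q (a *s u) v = a * pairing q u v"
    "pairing q u (a *s v) = a * pairing q u v"
  and pairing_0: "pairing q 0 v = 0" "pairing q u 0 = 0"
  by (simp_all add: pairing_eq matrix_vector_right_distrib matrix_vector_mult_diff_distrib
      matrix_vector_mult_smult sum.distrib sum_subtractf algebra_simps sum_distrib_left)

lemma pairing_sum: "pairing q (\<Sum>i\<in>I. f i) v = (\<Sum>i\<in>I. pairing q (f i) v)"
    "pairing q u (\<Sum>i\<in>I. g i) = (\<Sum>i\<in>I. pairing q u (g i))"
  by (induction I rule: infinite_finite_induct) (simp_all add: pairing_0 pairing_add)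

lemma pairing_vec: "pairing q (M *v u) (N *v v) = pairing (transpose M ** q ** N) u v"
proof -
  have "(\<Sum>i\<in>UNIV. (M *v u) $ i * y $ i) = (\<Sum>j\<in>UNIV. u $ j * (transpose M *v y) $ j)" for y
    unfolding matrix_vector_mult_def transpose_def vec_lambda_beta sum_distrib_left sum_distrib_right
    by (subst sum.swap) (simp add: mult_ac)
  then show ?thesis
    by (simp add: pairing_eq matrix_vector_mul_assoc[symmetric])
qed

definition nondeg :: "complex ^ 'n ^ 'n \<Rightarrow> bool" where
  "nondeg q \<longleftrightarrow> transpose q = q \<and> (\<forall>u. (\<forall>v. pairing q u v = 0) \<longrightarrow> u = 0)"

lemma pairing_sym: "nondeg q \<Longrightarrow> pairing q u v = pairing q v u"
proof -
  assume "nondeg q"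
  then have "q $ i $ j = q $ j $ i" for i j
    unfolding nondeg_def transpose_def by (metis vec_lambda_beta)
  then show ?thesis
    unfolding pairing_def by (subst sum.swap) (simp add: mult_ac)
qed

lemma nondegD: "nondeg q \<Longrightarrow> (\<And>v. pairing q u v = 0) \<Longrightarrow> u = 0"
  "nondeg q \<Longrightarrow> (\<And>v. pairing q v u = 0) \<Longrightarrow> u = 0"
  by (auto simp: nondeg_def pairing_sym[of q])

lemma nondeg_invertible: "nondeg q \<Longrightarrow> invertible q"
  unfolding invertible_iff_ker using nondegD(2)[of q] by (auto simp: pairing_eq)

text \<open>The adjoint for the bilinear form q: the formula solves
  \<open>q ** N = transpose M ** q\<close> for \<open>N\<close>.\<close>

definition adj :: "complex ^ 'n ^ 'n \<Rightarrow> complex ^ 'n ^ 'n \<Rightarrow> complex ^ 'n ^ 'n" where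
  "adj q M = matrix_inv q ** transpose M ** q"

lemma q_adj: "nondeg q \<Longrightarrow> q ** adj q M = transpose M ** q"
  using matrix_inv(1)[OF nondeg_invertible[of q]] by (simp add: adj_def matrix_mul_assoc)

lemma pairing_adj:
  assumes "nondeg q"
  shows "pairing q (M *v u) v = pairing q u (adj q M *v v)"
    "pairing q u (M *v v) = pairing q (adj q M *v u) v"
proof -
  show *: "pairing q (M *v u) v = pairing q u (adj q M *v v)" for u v
    using pairing_vec[of q M u "mat 1" v] pairing_vec[of q "mat 1" u "adj q M" v]
    by (simp add: q_adj[OF assms] transpose_mat)
  show "pairing q u (M *v v) = pairing q (adj q M *v u) v"
    using *[of v u] by (simp add: pairing_sym[OF assms])
qed

definition perp1 :: "complex ^ 'n ^ 'n \<Rightarrow> (complex ^ 'n) set \<Rightarrow> (complex ^ 'n) set" where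
  "perp1 q S = {v. \<forall>u\<in>S. pairing q u v = 0}"

lemma perp_eq: "perp Q S x = perp1 (Q x) (S x)"
  by (simp add: perp_def perp1_def)

lemma perp1_subspace: "vec.subspace (perp1 q S)"
  unfolding vec.subspace_def perp1_def by (simp add: pairing_0 pairing_add pairing_scale)

lemma perp1_0: "perp1 q {0} = UNIV"
  by (simp add: perp1_def pairing_0)

lemma perp1_UNIV: "nondeg q \<Longrightarrow> perp1 q UNIV = {0}"
  using nondegD(2)[of q] by (auto simp: perp1_def pairing_0)

text \<open>The q-dual basis of f: pairing with \<open>dualf q f j\<close> is the j-th coordinate
  function of f.\<close>

definition dualf :: "complex ^ 'n ^ 'n \<Rightarrow> (nat \<Rightarrow> complex ^ 'n) \<Rightarrow> nat \<Rightarrow> complex ^ 'n" where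
  "dualf q f j = matrix_inv q *v (transpose (matrix_inv (fm f)) *v axis (xi j) 1)"

lemma pairing_dualf:
  fixes f :: "nat \<Rightarrow> complex ^ 'n"
  assumes "nondeg q"
  shows "pairing q v (dualf q f j) = cf f v j"
proof -
  have "(transpose M *v axis b 1) $ i = M $ b $ i" for M :: "complex ^ 'n ^ 'n" and b i
    by (simp add: matrix_vector_mult_def transpose_def axis_def if_distrib cong: if_cong)
  then show ?thesis
    by (simp add: pairing_eq dualf_def matrix_inv_vec[OF nondeg_invertible[OF assms]] cf_def
        matrix_vector_mult_def[of "matrix_inv (fm f)"] mult.commute)
qed

lemma dualf_expand:
  fixes f :: "nat \<Rightarrow> complex ^ 'n"
  assumes "nondeg q" "invertible (fm f)"
  shows "v = (\<Sum>j<CARD('n). pairing q (f j) v *s dualf q f j)"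
proof -
  have "pairing q w (v - (\<Sum>j<CARD('n). pairing q (f j) v *s dualf q f j)) = 0" for w
  proof -
    have "pairing q w v = pairing q (\<Sum>k<CARD('n). cf f w k *s f k) v"
      using cf_expand[OF assms(2)] by metis
    then show ?thesis
      by (simp add: pairing_sum pairing_diff pairing_scale pairing_dualf[OF assms(1)] mult.commute)
  qed
  from nondegD(2)[OF assms(1) this] show ?thesis by simp
qed

text \<open>Dual vectors of index at least r annihilate the first r vectors of f. They span the
  orthogonal because the coefficients of w in the dual basis are its pairings with f, and the first
  r of these vanish.\<close>

lemma perp1_basis:
  fixes f :: "nat \<Rightarrow> complex ^ 'n"
  assumes q: "nondeg q" and S: "is_basis r f S" and f: "is_basis CARD('n) f UNIV"
    and r: "r \<le> CARD('n)"
  shows "is_basis (CARD('n) - r) (\<lambda>j. dualf q f (r + j)) (perp1 q S)"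
proof (rule basisI)
  have i: "invertible (fm f)" using f basis_iff_fm by blast
  have d: "pairing q (f i) (dualf q f j) = (if i = j then 1 else 0)"
    if "i < CARD('n)" "j < CARD('n)" for i j
  proof -
    have "f i = (\<Sum>k<CARD('n). (if k = i then 1 else 0) *s f k)"
      using that(1) by (subst sum.remove[of _ i]) (auto intro!: sum.neutral)
    then show ?thesis
      using pairing_dualf[OF q] cf_sum[OF i that(2), of "\<lambda>k. if k = i then 1 else 0"] by metis
  qed
  show "\<forall>j<CARD('n) - r. c j = 0" if 0: "(\<Sum>j<CARD('n) - r. c j *s dualf q f (r + j)) = 0" for c
  proof safe
    fix j assume j: "j < CARD('n) - r"
    have "0 = pairing q (f (r + j)) (\<Sum>j<CARD('n) - r. c j *s dualf q f (r + j))"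
      unfolding 0 by (simp add: pairing_0)
    also have "\<dots> = (\<Sum>k<CARD('n) - r. if j = k then c k else 0)"
      unfolding pairing_sum pairing_scale using j by (intro sum.cong) (auto simp: d)
    finally show "c j = 0" using j by simp
  qed
  show "dualf q f (r + j) \<in> perp1 q S" if "j < CARD('n) - r" for j
  proof -
    have "pairing q u (dualf q f (r + j)) = 0" if u: "u \<in> S" for u
    proof -
      obtain c where "u = (\<Sum>k<r. c k *s f k)" using basis_sum[OF S u] by blast
      then show ?thesis
        using \<open>j < CARD('n) - r\<close> by (simp add: pairing_sum pairing_scale d)
    qed
    then show ?thesis by (simp add: perp1_def)
  qed
  show "vec.subspace (perp1 q S)" by (rule perp1_subspace)
  show "\<exists>c. w = (\<Sum>j<CARD('n) - r. c j *s dualf q f (r + j))" if w: "w \<in> perp1 q S" for w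
  proof
    have "pairing q (f j) w = 0" if "j < r" for j
      using w basis_in[OF S that] by (simp add: perp1_def)
    then have "w = (\<Sum>j\<in>{r..<CARD('n)}. pairing q (f j) w *s dualf q f j)"
      by (subst dualf_expand[OF q i, of w]) (intro sum.mono_neutral_right, auto)
    also have "\<dots> = (\<Sum>j<CARD('n) - r. pairing q (f (r + j)) w *s dualf q f (r + j))"
      by (rule sum.reindex_bij_witness[of _ "\<lambda>j. r + j" "\<lambda>j. j - r"]) auto
    finally show "w = (\<Sum>j<CARD('n) - r. pairing q (f (r + j)) w *s dualf q f (r + j))" .
  qed
qed

lemma perp1_dim:
  fixes S :: "(complex ^ 'n) set"
  assumes "nondeg q" "vec.subspace S"
  shows "vec.dim S \<le> CARD('n)" "vec.dim (perp1 q S) = CARD('n) - vec.dim S"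
proof -
  obtain v where v: "is_basis (vec.dim S) v S" using basis_exists[OF assms(2)] .
  obtain f where f: "vec.dim S \<le> CARD('n)" "\<And>i. i < vec.dim S \<Longrightarrow> f i = v i"
    "is_basis CARD('n) f UNIV" using basis_extend[OF v] by blast
  show "vec.dim S \<le> CARD('n)" by fact
  show "vec.dim (perp1 q S) = CARD('n) - vec.dim S"
    using basis_rank[OF perp1_basis[OF assms(1) basis_cong[OF v f(2)] f(3,1)]] by simp
qed

text \<open>One inclusion is symmetry of the pairing; the other follows by comparing
  dimensions.\<close>

lemma perp1_perp1:
  fixes S :: "(complex ^ 'n) set"
  assumes "nondeg q" "vec.subspace S"
  shows "perp1 q (perp1 q S) = S"
proof -
  have "S \<subseteq> perp1 q (perp1 q S)" by (auto simp: perp1_def pairing_sym[OF assms(1)])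
  moreover have "vec.dim (perp1 q (perp1 q S)) = vec.dim S"
    using perp1_dim[OF assms] perp1_dim[OF assms(1) perp1_subspace[of q S]] by simp
  ultimately show ?thesis
    using vec.subspace_dim_equal[OF assms(2) perp1_subspace] by (metis order_refl)
qed

section \<open>Holomorphic sections and subbundles\<close>

lemma invertible_transpose: "invertible (M :: complex ^ 'n ^ 'n) \<Longrightarrow> invertible (transpose M)"
  by (simp add: invertible_det_nz)

context riemann_surface
begin

definition hol_vec :: "'x set \<Rightarrow> ('x \<Rightarrow> complex ^ 'n::finite) \<Rightarrow> bool" where
  "hol_vec U v \<longleftrightarrow> (\<forall>i. hol_fun A U (\<lambda>x. v x $ i))"

definition hol_mat :: "'x set \<Rightarrow> ('x \<Rightarrow> complex ^ 'n::finite ^ 'm::finite) \<Rightarrow> bool" where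
  "hol_mat U M \<longleftrightarrow> (\<forall>i j. hol_fun A U (\<lambda>x. M x $ i $ j))"

lemma hol_vec_cong: "(\<And>x. x \<in> U \<Longrightarrow> v x = w x) \<Longrightarrow> hol_vec U v \<Longrightarrow> hol_vec U w"
  unfolding hol_vec_def using hol_fun_cong[of U] by (metis (no_types, lifting))

lemma hol_vec_subset: "hol_vec U v \<Longrightarrow> T \<subseteq> U \<Longrightarrow> hol_vec T v"
  unfolding hol_vec_def using hol_fun_subset by blast

lemma hol_mat_subset: "hol_mat U M \<Longrightarrow> T \<subseteq> U \<Longrightarrow> hol_mat T M"
  unfolding hol_mat_def using hol_fun_subset by blast

lemma hol_mat_vec: "hol_mat U M \<Longrightarrow> hol_vec U v \<Longrightarrow> hol_vec U (\<lambda>x. M x *v v x)"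
  unfolding hol_mat_def hol_vec_def matrix_vector_mult_def
  by (auto intro!: hol_fun_sum hol_fun_mult)

lemma hol_mat_mult: "hol_mat U M \<Longrightarrow> hol_mat U N \<Longrightarrow> hol_mat U (\<lambda>x. M x ** N x)"
  unfolding hol_mat_def matrix_matrix_mult_def
  by (auto intro!: hol_fun_sum hol_fun_mult)

lemma hol_mat_transpose: "hol_mat U M \<Longrightarrow> hol_mat U (\<lambda>x. transpose (M x))"
  unfolding hol_mat_def transpose_def by simp

lemma hol_fun_det: "hol_mat U M \<Longrightarrow> hol_fun A U (\<lambda>x. det (M x))"
  unfolding hol_mat_def det_def by (intro hol_fun_sum hol_fun_mult hol_fun_prod hol_fun_const) auto

text \<open>By Cramer's rule the entries of the inverse are quotients of determinants whose
  denominator has no zero.\<close>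

lemma hol_mat_inverse:
  fixes M :: "'x \<Rightarrow> complex ^ 'n::finite ^ 'n"
  assumes "hol_mat U M" "\<And>x. x \<in> U \<Longrightarrow> invertible (M x)"
  shows "hol_mat U (\<lambda>x. matrix_inv (M x))"
  unfolding hol_mat_def
proof safe
  fix k l :: 'n
  \<comment> \<open>Cramer's numerator: the k-th column is replaced by the l-th unit vector, because
    the l-th column of the inverse solves \<open>M x *v y = axis l 1\<close>.\<close>
  let ?N = "\<lambda>x. \<chi> i j. if j = k then axis l 1 $ i else M x $ i $ j"
  have "hol_mat U ?N"
    unfolding hol_mat_def
  proof safe
    fix i j
    show "hol_fun A U (\<lambda>x. ?N x $ i $ j)"
      using assms(1) by (cases "j = k") (simp_all add: hol_mat_def hol_fun_const)
  qed
  then have "hol_fun A U (\<lambda>x. det (?N x) / det (M x))"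
    using assms by (intro hol_fun_divide hol_fun_det) (auto simp: invertible_det_nz)
  moreover have "det (?N x) / det (M x) = matrix_inv (M x) $ k $ l" if "x \<in> U" for x
  proof -
    have "M x *v (matrix_inv (M x) *v axis l 1) = axis l 1"
      by (rule matrix_inv_vec(1)[OF assms(2)[OF that]])
    then have "matrix_inv (M x) *v axis l 1 =
        (\<chi> k. det (\<chi> i j. if j = k then axis l 1 $ i else M x $ i $ j) / det (M x))"
      using assms(2)[OF that] by (subst (asm) cramer) (simp_all add: invertible_det_nz)
    then have "(matrix_inv (M x) *v axis l 1) $ k = det (?N x) / det (M x)" by simp
    then show ?thesis
      by (simp add: matrix_vector_mult_def axis_def if_distrib cong: if_cong)
  qed
  ultimately show "hol_fun A U (\<lambda>x. matrix_inv (M x) $ k $ l)"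
    by (rule hol_fun_cong[rotated])
qed

lemma open_nonzero:
  assumes "open U" "hol_fun A U f"
  shows "open {x \<in> U. f x \<noteq> 0}"
proof -
  have "open (U \<inter> f -` (- {0}))"
    by (rule continuous_open_preimage[OF hol_fun_continuous[OF assms] assms(1)])
      (rule open_Compl[OF closed_singleton])
  moreover have "U \<inter> f -` (- {0}) = {x \<in> U. f x \<noteq> 0}" by auto
  ultimately show ?thesis by simp
qed

end

section \<open>Sections, frames and subbundles of a bundle with a non-degenerate quadratic
  form\<close>

locale quadratic_bundle = riemann_surface A for A :: "('x::t2_space) atlas" +
  fixes W :: "('x, 'n::finite) vbundle" and Q :: "'x \<Rightarrow> complex ^ 'n ^ 'n"
  assumes vbundle: "hol_vbundle A W" and quadratic_form: "hol_nondeg_quadratic_form A W Q"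
begin

lemma nondeg: "nondeg (Q x)"
  using quadratic_form unfolding hol_nondeg_quadratic_form_def nondeg_def by blast

lemma triv:
  assumes "(V, t) \<in> W"
  shows "open V" "x \<in> V \<Longrightarrow> invertible (t x)"
    and "hol_mat V (\<lambda>x. transpose (matrix_inv (t x)) ** Q x ** matrix_inv (t x))"
  using vbundle quadratic_form assms unfolding hol_vbundle_def hol_nondeg_quadratic_form_def hol_mat_def
  by blast+

lemma triv_exists:
  obtains V t where "(V, t) \<in> W" "x \<in> V"
  using vbundle unfolding hol_vbundle_def by blast

lemma transition:
  "(V, t) \<in> W \<Longrightarrow> (V', t') \<in> W \<Longrightarrow> hol_mat (V \<inter> V') (\<lambda>x. t' x ** matrix_inv (t x))"
  using vbundle unfolding hol_vbundle_def hol_mat_def by blast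

lemma hol_section_iff:
  "hol_section A W U s \<longleftrightarrow> (\<forall>(V, t)\<in>W. hol_vec (U \<inter> V) (\<lambda>x. t x *v s x))"
  unfolding hol_section_def hol_vec_def ..

text \<open>Over the domain of one trivialization, testing in that one suffices: the transition
  functions are holomorphic.\<close>

lemma hol_section_triv:
  assumes c: "(V, t) \<in> W" and "U \<subseteq> V"
  shows "hol_section A W U s \<longleftrightarrow> hol_vec U (\<lambda>x. t x *v s x)"
proof
  assume "hol_section A W U s"
  then have "hol_vec (U \<inter> V) (\<lambda>x. t x *v s x)" using c unfolding hol_section_iff by blast
  then show "hol_vec U (\<lambda>x. t x *v s x)" using assms(2) by (simp add: Int_absorb2)
next
  assume h: "hol_vec U (\<lambda>x. t x *v s x)"
  show "hol_section A W U s"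
    unfolding hol_section_iff
  proof safe
    fix V' t' assume c': "(V', t') \<in> W"
    have "hol_vec (U \<inter> V') (\<lambda>x. (t' x ** matrix_inv (t x)) *v (t x *v s x))"
      using assms(2)
      by (intro hol_mat_vec hol_vec_subset[OF h] hol_mat_subset[OF transition[OF c c']]) auto
    then show "hol_vec (U \<inter> V') (\<lambda>x. t' x *v s x)"
    proof (rule hol_vec_cong[rotated])
      fix x assume "x \<in> U \<inter> V'"
      then have "invertible (t x)" using assms(2) triv(2)[OF c] by blast
      then show "(t' x ** matrix_inv (t x)) *v (t x *v s x) = t' x *v s x"
        by (simp add: matrix_inv_vec flip: matrix_vector_mul_assoc)
    qed
  qed
qed

lemma hol_section_subset: "hol_section A W U s \<Longrightarrow> T \<subseteq> U \<Longrightarrow> hol_section A W T s"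
  unfolding hol_section_iff by (fast intro: hol_vec_subset)

lemma hol_section_cong:
  "(\<And>x. x \<in> U \<Longrightarrow> s x = s' x) \<Longrightarrow> hol_section A W U s \<Longrightarrow> hol_section A W U s'"
  unfolding hol_section_iff using hol_vec_cong[of "U \<inter> _" "\<lambda>x. _ x *v s x" "\<lambda>x. _ x *v s' x"]
  by fastforce

lemma hol_section_local:
  assumes "open U" "\<And>x. x \<in> U \<Longrightarrow> \<exists>T. open T \<and> x \<in> T \<and> hol_section A W (U \<inter> T) s"
  shows "hol_section A W U s"
  unfolding hol_section_iff hol_vec_def
proof safe
  fix V t i assume c: "(V, t) \<in> W"
  show "hol_fun A (U \<inter> V) (\<lambda>x. (t x *v s x) $ i)"
  proof (rule hol_fun_local)
    fix x assume "x \<in> U \<inter> V"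
    then obtain T where T: "open T" "x \<in> T" "hol_section A W (U \<inter> T) s" using assms(2) by blast
    then have "hol_fun A (U \<inter> T \<inter> V) (\<lambda>x. (t x *v s x) $ i)"
      using c unfolding hol_section_iff hol_vec_def by blast
    moreover have "U \<inter> T \<inter> V = U \<inter> V \<inter> T" by blast
    ultimately show "\<exists>T. open T \<and> x \<in> T \<and> hol_fun A (U \<inter> V \<inter> T) (\<lambda>x. (t x *v s x) $ i)"
      using T by auto
  qed (use assms(1) triv(1)[OF c] in auto)
qed

lemma hol_section_local_triv:
  assumes "open U" "\<And>V t. (V, t) \<in> W \<Longrightarrow> hol_section A W (U \<inter> V) s"
  shows "hol_section A W U s"
proof (rule hol_section_local[OF assms(1)])
  fix x assume "x \<in> U"
  obtain V t where "(V, t) \<in> W" "x \<in> V" using triv_exists by blast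
  then show "\<exists>T. open T \<and> x \<in> T \<and> hol_section A W (U \<inter> T) s"
    using triv(1) assms(2) by blast
qed

lemma hol_fun_local_triv:
  assumes "open U" "\<And>V t. (V, t) \<in> W \<Longrightarrow> hol_fun A (U \<inter> V) f"
  shows "hol_fun A U f"
proof (rule hol_fun_local[OF assms(1)])
  fix x assume "x \<in> U"
  obtain V t where "(V, t) \<in> W" "x \<in> V" using triv_exists by blast
  then show "\<exists>T. open T \<and> x \<in> T \<and> hol_fun A (U \<inter> T) f"
    using triv(1) assms(2) by blast
qed

lemma hol_section_0: "hol_section A W U (\<lambda>x. 0)"
  unfolding hol_section_iff hol_vec_def by (simp add: hol_fun_const)

lemma hol_section_add:
  "hol_section A W U s \<Longrightarrow> hol_section A W U s' \<Longrightarrow> hol_section A W U (\<lambda>x. s x + s' x)"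
  unfolding hol_section_iff hol_vec_def
  by (fastforce simp: matrix_vector_right_distrib intro: hol_fun_add)

lemma hol_section_diff:
  "hol_section A W U s \<Longrightarrow> hol_section A W U s' \<Longrightarrow> hol_section A W U (\<lambda>x. s x - s' x)"
  unfolding hol_section_iff hol_vec_def
  by (fastforce simp: matrix_vector_mult_diff_distrib intro: hol_fun_diff)

lemma hol_section_scale:
  assumes "hol_fun A U c" "hol_section A W U s"
  shows "hol_section A W U (\<lambda>x. c x *s s x)"
  using assms(2) unfolding hol_section_iff hol_vec_def
  by (fastforce simp: matrix_vector_mult_smult intro: hol_fun_mult hol_fun_subset[OF assms(1)])

lemma hol_section_sum:
  "(\<And>i. i \<in> I \<Longrightarrow> hol_section A W U (s i)) \<Longrightarrow> hol_section A W U (\<lambda>x. \<Sum>i\<in>I. s i x)"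
  by (induction I rule: infinite_finite_induct) (auto intro: hol_section_0 hol_section_add)

lemma hol_section_inv_triv:
  assumes "(V, t) \<in> W" "U \<subseteq> V" "hol_vec U w"
  shows "hol_section A W U (\<lambda>x. matrix_inv (t x) *v w x)"
  unfolding hol_section_triv[OF assms(1,2)]
  by (rule hol_vec_cong[OF _ assms(3)]) (use assms(2) triv(2)[OF assms(1)] in \<open>auto simp: matrix_inv_vec\<close>)

lemma local_frame_iff:
  "local_frame A W S r U s \<longleftrightarrow>
     open U \<and> (\<forall>i<r. hol_section A W U (s i)) \<and> (\<forall>x\<in>U. is_basis r (\<lambda>i. s i x) (S x))"
  unfolding local_frame_def is_basis_def ..

lemma local_frame_subset:
  "local_frame A W S r U s \<Longrightarrow> open T \<Longrightarrow> T \<subseteq> U \<Longrightarrow> local_frame A W S r T s"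
  unfolding local_frame_iff using hol_section_subset by blast

lemma local_frame_cong:
  assumes "local_frame A W S r U s" "\<And>i x. i < r \<Longrightarrow> x \<in> U \<Longrightarrow> s i x = s' i x"
  shows "local_frame A W S r U s'"
  unfolding local_frame_iff
proof safe
  show "open U" using assms(1) by (simp add: local_frame_def)
  show "hol_section A W U (s' i)" if "i < r" for i
    using assms that by (intro hol_section_cong[of U "s i" "s' i"]) (auto simp: local_frame_def)
  show "is_basis r (\<lambda>i. s' i x) (S x)" if "x \<in> U" for x
    using assms that basis_cong[of r "\<lambda>i. s i x" "S x" "\<lambda>i. s' i x"]
    by (simp add: local_frame_iff)
qed

lemma hol_fm:
  assumes "(V, t) \<in> W" "U \<subseteq> V" "\<And>i. i < CARD('n) \<Longrightarrow> hol_section A W U (f i)"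
  shows "hol_mat U (\<lambda>x. t x ** fm (\<lambda>i. f i x))"
proof -
  have "hol_vec U (\<lambda>x. t x *v f (ix b) x)" for b :: 'n
    using assms(3)[OF ix_less[of b]] unfolding hol_section_triv[OF assms(1,2)] .
  then show ?thesis unfolding fm_comp hol_mat_def hol_vec_def by (simp add: fm_def)
qed

lemma frame_invertible:
  "local_frame A W whole_sub CARD('n) U f \<Longrightarrow> x \<in> U \<Longrightarrow> invertible (fm (\<lambda>i. f i x))"
  unfolding local_frame_iff basis_iff_fm by blast

text \<open>A basis completed at the single point \<open>x\<^sub>0\<close> is spread out by sections
  constant in a trivialization; being a basis is an open condition, so a smaller neighbourhood
  works.\<close>

lemma frame_extend:
  assumes "local_frame A W S r U s" "x\<^sub>0 \<in> U"
  obtains T f where "x\<^sub>0 \<in> T" "T \<subseteq> U" "r \<le> CARD('n)" "\<And>i. i < r \<Longrightarrow> f i = s i"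
    "local_frame A W whole_sub CARD('n) T f" "local_frame A W S r T f"
proof -
  obtain V t where c: "(V, t) \<in> W" "x\<^sub>0 \<in> V" using triv_exists by blast
  obtain g where g: "r \<le> CARD('n)" "\<And>i. i < r \<Longrightarrow> g i = s i x\<^sub>0" "is_basis CARD('n) g UNIV"
    using basis_extend[of r "\<lambda>i. s i x\<^sub>0" "S x\<^sub>0"] assms unfolding local_frame_iff by blast
  \<comment> \<open>The added sections are constant in the trivialization t and take the value
    \<open>g i\<close> at \<open>x\<^sub>0\<close>.\<close>
  define f where "f i x = (if i < r then s i x else matrix_inv (t x) *v (t x\<^sub>0 *v g i))" for i x
  have sec: "hol_section A W (U \<inter> V) (f i)" for i
  proof (cases "i < r")
    case True
    then have "f i = s i" by (simp add: f_def fun_eq_iff)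
    then show ?thesis using assms(1) True hol_section_subset[of U "s i" "U \<inter> V"]
      by (auto simp: local_frame_iff)
  next
    case False
    then have "f i = (\<lambda>x. matrix_inv (t x) *v (t x\<^sub>0 *v g i))" by (simp add: f_def fun_eq_iff)
    then show ?thesis using hol_section_inv_triv[OF c(1), of "U \<inter> V" "\<lambda>_. t x\<^sub>0 *v g i"]
      by (simp add: hol_vec_def hol_fun_const)
  qed
  \<comment> \<open>The factor \<open>t x\<close> makes this determinant holomorphic; the frame
    matrix in the arbitrary fibre coordinates has no regularity of its own.\<close>
  define T where "T = {x \<in> U \<inter> V. det (t x ** fm (\<lambda>i. f i x)) \<noteq> 0}"
  have "open T"
    unfolding T_def using assms(1) triv(1)[OF c(1)]
    by (intro open_nonzero hol_fun_det hol_fm[OF c(1)] sec) (auto simp: local_frame_def)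
  have inv: "invertible (fm (\<lambda>i. f i x))" if "x \<in> T" for x
    using that triv(2)[OF c(1)] by (auto simp: T_def det_mul invertible_det_nz)
  have "(\<lambda>i. f i x\<^sub>0) = g"
    using g(2) matrix_inv_vec(2)[OF triv(2)[OF c]] by (simp add: f_def fun_eq_iff)
  then have "x\<^sub>0 \<in> T"
    using assms(2) c(2) g(3) triv(2)[OF c] by (simp add: T_def det_mul invertible_det_nz basis_iff_fm)
  moreover have "local_frame A W whole_sub CARD('n) T f"
    unfolding local_frame_iff basis_iff_fm
    using \<open>open T\<close> inv hol_section_subset[OF sec, of T] by (auto simp: T_def)
  moreover have "T \<subseteq> U" by (auto simp: T_def)
  moreover have fs: "f i = s i" if "i < r" for i using that by (simp add: f_def fun_eq_iff)
  moreover have "local_frame A W S r T f"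
    using local_frame_cong[OF local_frame_subset[OF assms(1) \<open>open T\<close> \<open>T \<subseteq> U\<close>]] fs by simp
  ultimately show thesis using g(1) that by blast
qed

lemma zero_frame: "local_frame A W zero_sub 0 UNIV s"
  by (simp add: local_frame_def vec.independent_empty)

lemma frame_exists:
  obtains U f where "x \<in> U" "local_frame A W whole_sub CARD('n) U f"
  by (rule frame_extend[OF zero_frame[of "\<lambda>_ _. 0"] UNIV_I])

text \<open>Coordinates are independent of the trivialization: \<open>t x\<close> turns both the
  frame matrix and v into holomorphic objects and cancels in the product of the inverse with the
  vector.\<close>

lemma hol_fun_cf:
  assumes f: "local_frame A W whole_sub CARD('n) U f" and v: "hol_section A W U v"
  shows "hol_fun A U (\<lambda>x. cf (\<lambda>i. f i x) (v x) k)"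
proof (rule hol_fun_local_triv)
  fix V t assume c: "(V, t) \<in> W"
  have F: "hol_mat (U \<inter> V) (\<lambda>x. t x ** fm (\<lambda>i. f i x))"
    using f by (intro hol_fm[OF c]) (auto simp: local_frame_def intro: hol_section_subset)
  have v': "hol_vec (U \<inter> V) (\<lambda>x. t x *v v x)"
    using hol_section_subset[OF v, of "U \<inter> V"] hol_section_triv[OF c, of "U \<inter> V"] by blast
  have inv: "invertible (t x ** fm (\<lambda>i. f i x))" if "x \<in> U \<inter> V" for x
    using triv(2)[OF c] frame_invertible[OF f] that by (intro invertible_mult) auto
  have "hol_vec (U \<inter> V) (\<lambda>x. matrix_inv (t x ** fm (\<lambda>i. f i x)) *v (t x *v v x))"
    by (rule hol_mat_vec[OF hol_mat_inverse[OF F inv] v'])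
  then have "hol_vec (U \<inter> V) (\<lambda>x. matrix_inv (fm (\<lambda>i. f i x)) *v v x)"
  proof (rule hol_vec_cong[rotated])
    fix x assume "x \<in> U \<inter> V"
    then have "invertible (t x)" "invertible (fm (\<lambda>i. f i x))"
      using triv(2)[OF c] frame_invertible[OF f] by auto
    then show "matrix_inv (t x ** fm (\<lambda>i. f i x)) *v (t x *v v x) = matrix_inv (fm (\<lambda>i. f i x)) *v v x"
      by (simp add: matrix_inv_mult matrix_inv_vec flip: matrix_vector_mul_assoc)
  qed
  then show "hol_fun A (U \<inter> V) (\<lambda>x. cf (\<lambda>i. f i x) (v x) k)"
    unfolding cf_def hol_vec_def by blast
qed (use f in \<open>simp add: local_frame_def\<close>)

lemma pairing_triv:
  assumes "(V, t) \<in> W" "x \<in> V"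
  shows "pairing (Q x) u v =
    pairing (transpose (matrix_inv (t x)) ** Q x ** matrix_inv (t x)) (t x *v u) (t x *v v)"
  unfolding pairing_vec[symmetric] by (simp add: matrix_inv_vec[OF triv(2)[OF assms]])

lemma hol_fun_pairing:
  assumes "open U" "hol_section A W U a" "hol_section A W U b"
  shows "hol_fun A U (\<lambda>x. pairing (Q x) (a x) (b x))"
proof (rule hol_fun_local_triv[OF assms(1)])
  fix V t assume c: "(V, t) \<in> W"
  have h: "hol_vec (U \<inter> V) (\<lambda>x. t x *v a x)" "hol_vec (U \<inter> V) (\<lambda>x. t x *v b x)"
    using c assms(2,3) unfolding hol_section_iff by blast+
  have q: "hol_mat (U \<inter> V) (\<lambda>x. transpose (matrix_inv (t x)) ** Q x ** matrix_inv (t x))"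
    by (rule hol_mat_subset[OF triv(3)[OF c]]) simp
  have "hol_fun A (U \<inter> V) (\<lambda>x. pairing (transpose (matrix_inv (t x)) ** Q x ** matrix_inv (t x))
      (t x *v a x) (t x *v b x))"
    using h(1) hol_mat_vec[OF q h(2)] unfolding pairing_eq hol_vec_def
    by (intro hol_fun_sum hol_fun_mult) blast+
  then show "hol_fun A (U \<inter> V) (\<lambda>x. pairing (Q x) (a x) (b x))"
    by (rule hol_fun_cong[rotated]) (auto simp: pairing_triv[OF c])
qed

text \<open>In a trivialization the pairings with a frame are the entries of an invertible
  holomorphic matrix applied to v; inverting this matrix recovers v. Non-degeneracy of Q is what
  makes it invertible.\<close>

lemma hol_section_if_pairing:
  assumes f: "local_frame A W whole_sub CARD('n) U f"
    and p: "\<And>i. i < CARD('n) \<Longrightarrow> hol_fun A U (\<lambda>x. pairing (Q x) (f i x) (v x))"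
  shows "hol_section A W U v"
proof (rule hol_section_local_triv)
  fix V t assume c: "(V, t) \<in> W"
  let ?F = "\<lambda>x. t x ** fm (\<lambda>i. f i x)"
  let ?q = "\<lambda>x. transpose (matrix_inv (t x)) ** Q x ** matrix_inv (t x)"
  have F: "hol_mat (U \<inter> V) ?F"
    using f by (intro hol_fm[OF c]) (auto simp: local_frame_def intro: hol_section_subset)
  have q: "hol_mat (U \<inter> V) ?q"
    by (rule hol_mat_subset[OF triv(3)[OF c]]) simp
  have inv: "invertible (transpose (?F x) ** ?q x)" if "x \<in> U \<inter> V" for x
    using triv(2)[OF c, of x] frame_invertible[OF f, of x] that nondeg_invertible[OF nondeg[of x]]
    by (intro invertible_mult invertible_transpose invertible_matrix_inv) auto
  have eq: "((transpose (?F x) ** ?q x) *v (t x *v v x)) $ b = pairing (Q x) (f (ix b) x) (v x)"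
    if "x \<in> U \<inter> V" for x b
  proof -
    have "((transpose (?F x) ** ?q x) *v w) $ b = (\<Sum>i\<in>UNIV. ?F x $ i $ b * (?q x *v w) $ i)" for w
      unfolding matrix_vector_mul_assoc[symmetric] by (simp add: matrix_vector_mult_def transpose_def)
    also have "\<dots> w = pairing (?q x) (t x *v f (ix b) x) w" for w
      unfolding pairing_eq fm_comp by (simp add: fm_def)
    finally show ?thesis using pairing_triv[OF c, of x] that by simp
  qed
  have h: "hol_vec (U \<inter> V) (\<lambda>x. (transpose (?F x) ** ?q x) *v (t x *v v x))"
    unfolding hol_vec_def
  proof
    fix b
    show "hol_fun A (U \<inter> V) (\<lambda>x. ((transpose (?F x) ** ?q x) *v (t x *v v x)) $ b)"
      by (rule hol_fun_cong[OF eq[symmetric] hol_fun_subset[OF p[OF ix_less[of b]]]]) auto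
  qed
  have "hol_vec (U \<inter> V) (\<lambda>x. matrix_inv (transpose (?F x) ** ?q x) *v
      ((transpose (?F x) ** ?q x) *v (t x *v v x)))"
    by (rule hol_mat_vec[OF hol_mat_inverse[OF hol_mat_mult[OF hol_mat_transpose[OF F] q] inv] h])
  then have "hol_vec (U \<inter> V) (\<lambda>x. t x *v v x)"
    by (rule hol_vec_cong[rotated]) (rule matrix_inv_vec(2)[OF inv])
  then show "hol_section A W (U \<inter> V) v"
    using hol_section_triv[OF c, of "U \<inter> V"] by blast
qed (use f in \<open>simp add: local_frame_def\<close>)

lemma hol_section_dualf:
  assumes f: "local_frame A W whole_sub CARD('n) U f"
  shows "hol_section A W U (\<lambda>x. dualf (Q x) (\<lambda>i. f i x) j)"
proof (rule hol_section_if_pairing[OF f])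
  fix i assume i: "i < CARD('n)"
  show "hol_fun A U (\<lambda>x. pairing (Q x) (f i x) (dualf (Q x) (\<lambda>i. f i x) j))"
    unfolding pairing_dualf[OF nondeg]
    using f i by (intro hol_fun_cf[OF f]) (simp add: local_frame_def)
qed

lemma subbundle_subspace: "hol_subbundle A W S \<Longrightarrow> vec.subspace (S x)"
  unfolding hol_subbundle_def local_frame_iff using basis_subspace by metis

text \<open>Locally a frame of S is completed to one of W; the dual vectors of index at least r form
  the frame of the orthogonal.\<close>

lemma subbundle_perp:
  assumes "hol_subbundle A W S"
  shows "hol_subbundle A W (perp Q S)"
proof -
  obtain r where r: "\<And>x. \<exists>U s. x \<in> U \<and> local_frame A W S r U s"
    using assms unfolding hol_subbundle_def by blast
  have "\<exists>U s. x \<in> U \<and> local_frame A W (perp Q S) (CARD('n) - r) U s" for x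
  proof -
    obtain U s where "x \<in> U" "local_frame A W S r U s" using r by blast
    then obtain T f where T: "x \<in> T" "r \<le> CARD('n)" and f: "local_frame A W whole_sub CARD('n) T f"
      "local_frame A W S r T f"
      using frame_extend by metis
    have "local_frame A W (perp Q S) (CARD('n) - r) T (\<lambda>j x. dualf (Q x) (\<lambda>i. f i x) (r + j))"
      using f hol_section_dualf[OF f(1)] T(2) unfolding local_frame_iff perp_eq
      by (auto intro!: perp1_basis[OF nondeg])
    with T show ?thesis by blast
  qed
  then show ?thesis unfolding hol_subbundle_def by blast
qed

lemma perp_perp: "hol_subbundle A W S \<Longrightarrow> perp Q (perp Q S) = S"
  using perp1_perp1[OF nondeg subbundle_subspace] by (auto simp: fun_eq_iff perp_eq)

subsection \<open>Holomorphic endomorphisms\<close>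

text \<open>Holomorphy is tested on sections instead of matrix entries in trivializations, which
  makes it stable under composition at once.\<close>

definition hol_end :: "('x \<Rightarrow> complex ^ 'n ^ 'n) \<Rightarrow> bool" where
  "hol_end P \<longleftrightarrow> (\<forall>U s. open U \<longrightarrow> hol_section A W U s \<longrightarrow> hol_section A W U (\<lambda>x. P x *v s x))"

lemma hol_end_mult: "hol_end P \<Longrightarrow> hol_end P' \<Longrightarrow> hol_end (\<lambda>x. P x ** P' x)"
  unfolding hol_end_def by (auto simp flip: matrix_vector_mul_assoc)

lemma hol_end_1: "hol_end (\<lambda>x. mat 1)"
  unfolding hol_end_def by simp

lemma hol_end_0: "hol_end (\<lambda>x. 0)"
  unfolding hol_end_def by (simp add: hol_section_0)

lemma hol_end_diff: "hol_end P \<Longrightarrow> hol_end P' \<Longrightarrow> hol_end (\<lambda>x. P x - P' x)"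
  unfolding hol_end_def by (auto simp: matrix_vector_mult_diff_rdistrib intro: hol_section_diff)

text \<open>Pairing the image of s under the adjoint with a frame vector equals pairing s with the
  image of that vector under P, which is holomorphic.\<close>

lemma hol_end_adj:
  assumes "hol_end P"
  shows "hol_end (\<lambda>x. adj (Q x) (P x))"
  unfolding hol_end_def
proof safe
  fix U s assume U: "open U" "hol_section A W U s"
  show "hol_section A W U (\<lambda>x. adj (Q x) (P x) *v s x)"
  proof (rule hol_section_local[OF U(1)])
    fix x assume "x \<in> U"
    obtain T f where T: "x \<in> T" and f: "local_frame A W whole_sub CARD('n) T f"
      using frame_exists by blast
    have "open T" using f by (simp add: local_frame_def)
    have UT: "open (U \<inter> T)" "hol_section A W (U \<inter> T) s"
      using U \<open>open T\<close> hol_section_subset by auto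
    have f': "local_frame A W whole_sub CARD('n) (U \<inter> T) f"
      by (rule local_frame_subset[OF f UT(1)]) simp
    have "hol_section A W (U \<inter> T) (\<lambda>x. adj (Q x) (P x) *v s x)"
    proof (rule hol_section_if_pairing[OF f'])
      fix i assume "i < CARD('n)"
      then have "hol_section A W (U \<inter> T) (\<lambda>x. P x *v f i x)"
        using assms f' UT(1) unfolding hol_end_def local_frame_def by blast
      from hol_fun_pairing[OF UT(1) this UT(2)]
      show "hol_fun A (U \<inter> T) (\<lambda>x. pairing (Q x) (f i x) (adj (Q x) (P x) *v s x))"
        by (simp add: pairing_adj(1)[OF nondeg])
    qed
    with T \<open>open T\<close> show "\<exists>T. open T \<and> x \<in> T \<and> hol_section A W (U \<inter> T) (\<lambda>x. adj (Q x) (P x) *v s x)"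
      by blast
  qed
qed

text \<open>
  Near a point, the orthogonal of the kernel is spanned by the images under the adjoint of the
  vectors dual to a frame of \<open>S\<close>; the kernel is the orthogonal of that subbundle.
\<close>

lemma subbundle_kernel:
  assumes P: "hol_end P" and S: "hol_subbundle A W S" and range: "\<And>x. range ((*v) (P x)) = S x"
  shows "hol_subbundle A W (\<lambda>x. {w. P x *v w = 0})"
proof -
  define K where "K x = {w. P x *v w = 0}" for x
  obtain r where r: "\<And>x. \<exists>U s. x \<in> U \<and> local_frame A W S r U s"
    using S unfolding hol_subbundle_def by blast
  have "\<exists>U s. x \<in> U \<and> local_frame A W (perp Q K) r U s" for x
  proof -
    obtain U s where "x \<in> U" "local_frame A W S r U s" using r by blast
    then obtain T f where T: "x \<in> T" "r \<le> CARD('n)" and f: "local_frame A W whole_sub CARD('n) T f"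
      "local_frame A W S r T f"
      using frame_extend by metis
    define g where "g i y = adj (Q y) (P y) *v dualf (Q y) (\<lambda>i. f i y) i" for i y
    have "open T" using f by (simp add: local_frame_def)
    have "hol_section A W T (g i)" for i
      unfolding g_def using hol_end_adj[OF P] hol_section_dualf[OF f(1)] \<open>open T\<close>
      unfolding hol_end_def by blast
    moreover have "is_basis r (\<lambda>i. g i y) (perp Q K y)" if y: "y \<in> T" for y
    proof -
      have i: "invertible (fm (\<lambda>i. f i y))" by (rule frame_invertible[OF f(1) y])
      have Sb: "is_basis r (\<lambda>i. f i y) (S y)" using f(2) y by (simp add: local_frame_iff)
      \<comment> \<open>Pairing with \<open>g i\<close> reads off the i-th coordinate of the image
        of w. Independence of the \<open>g i\<close> and the description of the kernel both come
        from this.\<close>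
      have pg: "pairing (Q y) w (g i y) = cf (\<lambda>i. f i y) (P y *v w) i" for w i
        unfolding g_def pairing_adj(1)[OF nondeg, symmetric] by (rule pairing_dualf[OF nondeg])
      have b: "is_basis r (\<lambda>i. g i y) (vec.span ((\<lambda>i. g i y) ` {..<r}))"
      proof (rule basisI)
        show "\<forall>i<r. c i = 0" if 0: "(\<Sum>i<r. c i *s g i y) = 0" for c
        proof safe
          fix i assume "i < r"
          then have "f i y \<in> S y" by (rule basis_in[OF Sb])
          \<comment> \<open>Pairing the linear relation with a preimage of \<open>f i\<close>
            isolates the coefficient \<open>c i\<close>.\<close>
          then obtain w where w: "P y *v w = f i y" using range[of y] by (metis imageE)
          have "f i y = (\<Sum>k<r. (if k = i then 1 else 0) *s f k y)"
            using \<open>i < r\<close> by (subst sum.remove[of _ i]) (auto intro!: sum.neutral)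
          then have cfk: "cf (\<lambda>i. f i y) (f i y) k = (if k = i then 1 else 0)" if "k < r" for k
            using cf_eq[OF i T(2), of k "\<lambda>k. if k = i then 1 else 0"] that T(2) by simp
          have "0 = pairing (Q y) w (\<Sum>i<r. c i *s g i y)" unfolding 0 by (simp add: pairing_0)
          also have "\<dots> = (\<Sum>k<r. if k = i then c k else 0)"
            unfolding pairing_sum pairing_scale pg w by (intro sum.cong) (auto simp: cfk)
          finally show "c i = 0" using \<open>i < r\<close> by simp
        qed
        show "\<exists>c. w = (\<Sum>i<r. c i *s g i y)" if "w \<in> vec.span ((\<lambda>i. g i y) ` {..<r})" for w
          using that
        proof (induction rule: vec.span_induct_alt)
          case base
          show ?case by (rule exI[of _ "\<lambda>_. 0"]) simp
        next
          case (step a u v)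
          then obtain j c where "j < r" "u = g j y" "v = (\<Sum>i<r. c i *s g i y)" by auto
          then have "a *s u + v = (\<Sum>i<r. ((if i = j then a else 0) + c i) *s g i y)"
            by (simp add: vec.scale_left_distrib sum.distrib if_distrib[of "\<lambda>a. a *s _"] cong: if_cong)
          then show ?case by (rule exI[of _ "\<lambda>i. (if i = j then a else 0) + c i"])
        qed
      qed (auto intro: vec.span_base vec.subspace_span)
      have "perp1 (Q y) (vec.span ((\<lambda>i. g i y) ` {..<r})) = K y"
      proof (intro equalityI subsetI)
        fix w assume w: "w \<in> perp1 (Q y) (vec.span ((\<lambda>i. g i y) ` {..<r}))"
        have "cf (\<lambda>i. f i y) (P y *v w) i = 0" if "i < r" for i
          using w basis_in[OF b that] unfolding pg[symmetric] perp1_def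
          by (simp add: pairing_sym[OF nondeg, of _ w])
        moreover obtain c where c: "P y *v w = (\<Sum>i<r. c i *s f i y)"
          using basis_sum[OF Sb, of "P y *v w"] range[of y] by blast
        ultimately have "c i = 0" if "i < r" for i
          using cf_eq[OF i T(2), of i c] that T(2) by simp
        then show "w \<in> K y" using c by (simp add: K_def)
      next
        fix w assume "w \<in> K y"
        then have "pairing (Q y) w (g i y) = 0" for i
          unfolding pg by (simp add: K_def cf_def)
        moreover have "\<exists>c. u = (\<Sum>i<r. c i *s g i y)" if "u \<in> vec.span ((\<lambda>i. g i y) ` {..<r})" for u
          using basis_sum[OF b that] .
        ultimately show "w \<in> perp1 (Q y) (vec.span ((\<lambda>i. g i y) ` {..<r}))"
          unfolding perp1_def
          by (force simp: pairing_sym[OF nondeg, of _ w] pairing_sum pairing_scale)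
      qed
      then show ?thesis
        using b perp1_perp1[OF nondeg vec.subspace_span] by (metis perp_eq)
    qed
    ultimately have "local_frame A W (perp Q K) r T g"
      using \<open>open T\<close> by (simp add: local_frame_iff)
    with T show ?thesis by blast
  qed
  then have "hol_subbundle A W (perp Q K)" unfolding hol_subbundle_def by blast
  moreover have "perp Q (perp Q K) = K"
  proof -
    have "vec.subspace (K x)" for x
      unfolding K_def vec.subspace_def by (simp add: matrix_vector_right_distrib matrix_vector_mult_smult)
    then show ?thesis using perp1_perp1[OF nondeg] by (simp add: fun_eq_iff perp_eq)
  qed
  ultimately have "hol_subbundle A W K" using subbundle_perp by metis
  then show ?thesis by (simp add: K_def[abs_def])
qed

lemma splits_basis:
  fixes v w :: "nat \<Rightarrow> complex ^ 'n"
  assumes "is_basis r v S" "is_basis m w T" "S \<inter> T = {0}" "{a + b | a b. a \<in> S \<and> b \<in> T} = UNIV"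
  shows "r + m = CARD('n)" "is_basis CARD('n) (\<lambda>i. if i < r then v i else w (i - r)) UNIV"
proof -
  let ?f = "\<lambda>i. if i < r then v i else w (i - r)"
  have sum: "(\<Sum>i<r + m. c i *s ?f i) = (\<Sum>i<r. c i *s v i) + (\<Sum>i<m. c (r + i) *s w i)" for c
    by (induction m) (simp_all add: add.assoc cong: sum.cong_simp)
  have b: "is_basis (r + m) ?f UNIV"
  proof (rule basisI)
    fix c assume "(\<Sum>i<r + m. c i *s ?f i) = 0"
    then have 0: "(\<Sum>i<r. c i *s v i) = - (\<Sum>i<m. c (r + i) *s w i)"
      unfolding sum by (simp add: eq_neg_iff_add_eq_0)
    moreover have "(\<Sum>i<r. c i *s v i) \<in> S" by (rule basis_sum_in[OF assms(1)])
    moreover have "- (\<Sum>i<m. c (r + i) *s w i) \<in> T"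
      by (rule vec.subspace_neg[OF basis_subspace[OF assms(2)] basis_sum_in[OF assms(2)]])
    ultimately have "(\<Sum>i<r. c i *s v i) \<in> S \<inter> T" by simp
    then have z: "(\<Sum>i<r. c i *s v i) = 0" "(\<Sum>i<m. c (r + i) *s w i) = 0"
      using 0 assms(3) by auto
    show "\<forall>i<r + m. c i = 0"
    proof safe
      fix i assume "i < r + m"
      then show "c i = 0"
        using basis_independent[OF assms(1) z(1), of i]
          basis_independent[OF assms(2) z(2), of "i - r"]
        by (cases "i < r") auto
    qed
  next
    fix u :: "complex ^ 'n"
    obtain a b where ab: "u = a + b" "a \<in> S" "b \<in> T" using assms(4) by blast
    obtain c d where "a = (\<Sum>i<r. c i *s v i)" "b = (\<Sum>i<m. d i *s w i)"
      using basis_sum[OF assms(1) ab(2)] basis_sum[OF assms(2) ab(3)] by blast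
    then have "u = (\<Sum>i<r + m. (if i < r then c i else d (i - r)) *s ?f i)"
      unfolding sum ab(1) by simp
    then show "\<exists>c. u = (\<Sum>i<r + m. c i *s ?f i)" by (rule exI[of _ "\<lambda>i. if i < r then c i else d (i - r)"])
  qed auto
  show "r + m = CARD('n)"
    using basis_rank[OF b] by (simp add: vec.dim_UNIV card_cart_basis)
  with b show "is_basis CARD('n) ?f UNIV" by simp
qed

text \<open>The frames of S and T concatenate to frames of W, in which the projection onto S along T
  is \<open>proj_mat\<close>.\<close>

lemma subbundle_projection:
  assumes "hol_subbundle A W S" "hol_subbundle A W T" "splits S T"
  obtains P where "hol_end P" "\<And>x. projection (P x) (S x)" "\<And>x v. v \<in> T x \<Longrightarrow> P x *v v = 0"
proof -
  obtain r where r: "\<And>x. \<exists>U s. x \<in> U \<and> local_frame A W S r U s"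
    using assms(1) unfolding hol_subbundle_def by blast
  obtain m where m: "\<And>x. \<exists>U s. x \<in> U \<and> local_frame A W T m U s"
    using assms(2) unfolding hol_subbundle_def by blast
  have loc: "\<exists>U f. x \<in> U \<and> local_frame A W whole_sub CARD('n) U f \<and> local_frame A W S r U f \<and>
      r + m = CARD('n) \<and> local_frame A W T m U (\<lambda>i. f (r + i))" for x
  proof -
    obtain U s where U: "x \<in> U" "local_frame A W S r U s" using r by blast
    obtain V t where V: "x \<in> V" "local_frame A W T m V t" using m by blast
    define f where "f i = (if i < r then s i else t (i - r))" for i
    have o: "open (U \<inter> V)" using U V by (auto simp: local_frame_def)
    have 1: "local_frame A W S r (U \<inter> V) f"
      by (rule local_frame_cong[OF local_frame_subset[OF U(2) o]]) (auto simp: f_def)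
    have 2: "local_frame A W T m (U \<inter> V) (\<lambda>i. f (r + i))"
      by (rule local_frame_cong[OF local_frame_subset[OF V(2) o]]) (auto simp: f_def)
    have b: "r + m = CARD('n) \<and> is_basis CARD('n) (\<lambda>i. f i y) UNIV" if "y \<in> U \<inter> V" for y
    proof -
      have "is_basis r (\<lambda>i. f i y) (S y)" "is_basis m (\<lambda>i. f (r + i) y) (T y)"
        using 1 2 that by (auto simp: local_frame_iff)
      moreover have "S y \<inter> T y = {0}" "{a + b | a b. a \<in> S y \<and> b \<in> T y} = UNIV"
        using assms(3) by (auto simp: splits_def)
      moreover have "(\<lambda>i. if i < r then f i y else f (r + (i - r)) y) = (\<lambda>i. f i y)"
        by (auto simp: fun_eq_iff)
      ultimately show ?thesis
        using splits_basis[of r "\<lambda>i. f i y" "S y" m "\<lambda>i. f (r + i) y" "T y"] by simp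
    qed
    have rm: "r + m = CARD('n)" using b U(1) V(1) by blast
    have "hol_section A W (U \<inter> V) (f i)" if "i < CARD('n)" for i
    proof (cases "i < r")
      case False
      then have "i - r < m" "f (r + (i - r)) = f i" using that rm by auto
      with 2 show ?thesis by (metis local_frame_def)
    qed (use 1 in \<open>auto simp: local_frame_def\<close>)
    with b o have "local_frame A W whole_sub CARD('n) (U \<inter> V) f"
      unfolding local_frame_iff by blast
    with 1 2 rm U(1) V(1) show ?thesis by blast
  qed
  have proj: "projection (proj_mat r (\<lambda>i. f i y)) (S y) \<and> (\<forall>v\<in>T y. proj_mat r (\<lambda>i. f i y) *v v = 0)"
    if f: "local_frame A W whole_sub CARD('n) U f" "local_frame A W S r U f" "r + m = CARD('n)"
      "local_frame A W T m U (\<lambda>i. f (r + i))" and y: "y \<in> U" for U f y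
  proof -
    have b: "is_basis r (\<lambda>i. f i y) (S y)" "is_basis m (\<lambda>i. f (r + i) y) (T y)"
      "is_basis CARD('n) (\<lambda>i. f i y) UNIV"
      using f y by (auto simp: local_frame_iff)
    have "proj_mat r (\<lambda>i. f i y) *v v = 0" if v: "v \<in> T y" for v
    proof -
      obtain c where c: "v = (\<Sum>i<m. c i *s f (r + i) y)" using basis_sum[OF b(2) v] by blast
      have "v = (\<Sum>i\<in>{r..<CARD('n)}. c (i - r) *s f i y)"
        unfolding c using f(3)
        by (intro sum.reindex_bij_witness[of _ "\<lambda>j. j - r" "\<lambda>j. r + j"]) auto
      also have "\<dots> = (\<Sum>i<CARD('n). (if i < r then 0 else c (i - r)) *s f i y)"
        by (intro sum.mono_neutral_cong_left) auto
      finally have "cf (\<lambda>i. f i y) v k = 0" if "k < r" for k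
        using cf_sum[OF b(3)[unfolded basis_iff_fm], of k "\<lambda>i. if i < r then 0 else c (i - r)"] that f(3)
        by simp
      then show ?thesis by (simp add: proj_mat_mult)
    qed
    then show ?thesis using proj_mat_projection[OF b(1,3)] f(3) by simp
  qed
  have ex: "\<exists>P. projection P (S x) \<and> (\<forall>v\<in>T x. P *v v = 0)" for x
  proof -
    obtain U f where "x \<in> U" "local_frame A W whole_sub CARD('n) U f" "local_frame A W S r U f"
      "r + m = CARD('n)" "local_frame A W T m U (\<lambda>i. f (r + i))"
      using loc[of x] by blast
    then show ?thesis using proj by blast
  qed
  \<comment> \<open>A pointwise choice can be holomorphic because image and kernel determine the
    projection: it agrees with \<open>proj_mat\<close> in every adapted local frame.\<close>
  define P where "P x = (SOME P. projection P (S x) \<and> (\<forall>v\<in>T x. P *v v = 0))" for x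
  have P: "projection (P x) (S x)" "v \<in> T x \<Longrightarrow> P x *v v = 0" for x v
    using someI_ex[OF ex[of x]] unfolding P_def by auto
  have "hol_end P"
    unfolding hol_end_def
  proof safe
    fix U s assume U: "open U" "hol_section A W U s"
    show "hol_section A W U (\<lambda>x. P x *v s x)"
    proof (rule hol_section_local[OF U(1)])
      fix x assume "x \<in> U"
      obtain V f where V: "x \<in> V" and f: "local_frame A W whole_sub CARD('n) V f"
        "local_frame A W S r V f" "r + m = CARD('n)" "local_frame A W T m V (\<lambda>i. f (r + i))"
        using loc by blast
      have o: "open V" "open (U \<inter> V)" using f(1) U(1) by (auto simp: local_frame_def)
      have "hol_section A W (U \<inter> V) (f k)" if "k < r" for k
        using hol_section_subset[of V "f k" "U \<inter> V"] f(2) that by (simp add: local_frame_def)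
      moreover have "hol_fun A (U \<inter> V) (\<lambda>y. cf (\<lambda>i. f i y) (s y) k)" for k
        using hol_fun_cf[OF local_frame_subset[OF f(1) o(2)] hol_section_subset[OF U(2)]] by simp
      ultimately have "hol_section A W (U \<inter> V) (\<lambda>y. proj_mat r (\<lambda>i. f i y) *v s y)"
        unfolding proj_mat_mult by (intro hol_section_sum hol_section_scale) auto
      then have "hol_section A W (U \<inter> V) (\<lambda>x. P x *v s x)"
      proof (rule hol_section_cong[rotated])
        fix y assume "y \<in> U \<inter> V"
        obtain a b where ab: "s y = a + b" "a \<in> S y" "b \<in> T y"
          using assms(3) unfolding splits_def by blast
        have p: "projection (proj_mat r (\<lambda>i. f i y)) (S y)" "proj_mat r (\<lambda>i. f i y) *v b = 0"
          using proj[OF f, of y] \<open>y \<in> U \<inter> V\<close> ab(3) by auto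
        show "proj_mat r (\<lambda>i. f i y) *v s y = P y *v s y"
          using p P(1)[of y] P(2)[OF ab(3)] ab(2)
          unfolding ab(1) matrix_vector_right_distrib projection_def by simp
      qed
      with V o show "\<exists>T. open T \<and> x \<in> T \<and> hol_section A W (U \<inter> T) (\<lambda>x. P x *v s x)"
        by blast
    qed
  qed
  then show thesis using P by (rule that)
qed

end

section \<open>Gram determinants\<close>

definition hermitian_on :: "(complex ^ 'n) set \<Rightarrow> (complex ^ 'n \<Rightarrow> complex ^ 'n \<Rightarrow> complex) \<Rightarrow> bool" where
  "hermitian_on S h \<longleftrightarrow> (\<forall>u\<in>S. \<forall>v\<in>S.
     (\<forall>w\<in>S. \<forall>a b. h (a *s u + b *s v) w = a * h u w + b * h v w) \<and>
     h v u = cnj (h u v) \<and> (u \<noteq> 0 \<longrightarrow> 0 < Re (h u u)))"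

text \<open>For a Hermitian h this is the squared norm of the exterior product of the
  \<open>s i\<close> in the metric induced on the determinant line; for a bilinear form it is a
  discriminant.\<close>

abbreviation gram :: "nat \<Rightarrow> ('v \<Rightarrow> 'v \<Rightarrow> complex) \<Rightarrow> (nat \<Rightarrow> 'v) \<Rightarrow> complex" where
  "gram r h s \<equiv> det_n r (\<lambda>i j. h (s i) (s j))"

lemma hermitian_on_sum_left:
  assumes "hermitian_on S h" "vec.subspace S" "\<And>i. i \<in> I \<Longrightarrow> s i \<in> S" "w \<in> S"
  shows "h (\<Sum>i\<in>I. c i *s s i) w = (\<Sum>i\<in>I. c i * h (s i) w)"
proof -
  have "h (0 *s w + 0 *s w) w = 0 * h w w + 0 * h w w"
    using assms(1,4) unfolding hermitian_on_def by blast
  then have 0: "h 0 w = 0" by simp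
  show ?thesis
    using assms(3)
  proof (induction I rule: infinite_finite_induct)
  case (insert i I)
  have "(\<Sum>i\<in>I. c i *s s i) \<in> S"
    using insert.prems by (intro vec.subspace_sum vec.subspace_scale assms(2)) auto
  then have "h (c i *s s i + 1 *s (\<Sum>i\<in>I. c i *s s i)) w = c i * h (s i) w + 1 * h (\<Sum>i\<in>I. c i *s s i) w"
    using assms(1,4) insert.prems unfolding hermitian_on_def by blast
  then show ?case using insert by simp
  qed (simp_all add: 0)
qed

lemma hermitian_on_sum:
  assumes "hermitian_on S h" "vec.subspace S" "\<And>i. i \<in> I \<Longrightarrow> s i \<in> S"
  shows "h (\<Sum>i\<in>I. c i *s s i) (\<Sum>j\<in>I. d j *s s j) = (\<Sum>i\<in>I. \<Sum>j\<in>I. c i * h (s i) (s j) * cnj (d j))"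
proof -
  have sym: "h v u = cnj (h u v)" if "u \<in> S" "v \<in> S" for u v
    using assms(1) that unfolding hermitian_on_def by blast
  have d: "(\<Sum>j\<in>I. d j *s s j) \<in> S"
    using assms(3) by (intro vec.subspace_sum vec.subspace_scale assms(2)) auto
  have left: "h (\<Sum>i\<in>I. a i *s s i) w = (\<Sum>i\<in>I. a i * h (s i) w)" if "w \<in> S" for a w
    using hermitian_on_sum_left[of S h I s w a] assms that by blast
  have "h (s i) (\<Sum>j\<in>I. d j *s s j) = (\<Sum>j\<in>I. h (s i) (s j) * cnj (d j))" if "i \<in> I" for i
  proof -
    have "h (s i) (\<Sum>j\<in>I. d j *s s j) = cnj (h (\<Sum>j\<in>I. d j *s s j) (s i))"
      by (rule sym[OF d assms(3)[OF that]])
    also have "\<dots> = (\<Sum>j\<in>I. cnj (d j) * cnj (h (s j) (s i)))"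
      using left[OF assms(3)[OF that], of d] by simp
    also have "\<dots> = (\<Sum>j\<in>I. h (s i) (s j) * cnj (d j))"
      using sym[OF assms(3) assms(3)[OF that]] by (intro sum.cong) (auto simp: mult.commute)
    finally show ?thesis .
  qed
  then show ?thesis
    unfolding left[OF d]
    by (intro sum.cong refl) (simp add: sum_distrib_left mult.assoc)
qed

lemma gram_pos:
  assumes "hermitian_on S h" "is_basis r s S"
  shows "0 < Re (gram r h s)" "gram r h s = of_real (Re (gram r h s))"
proof -
  note S = basis_subspace[OF assms(2)] and s = basis_in[OF assms(2)]
  have 1: "h (s j) (s i) = cnj (h (s i) (s j))" if "i < r" "j < r" for i j
    using assms(1) s that unfolding hermitian_on_def by blast
  have 2: "0 < Re (\<Sum>i<r. \<Sum>j<r. cnj (y i) * h (s i) (s j) * y j)" if "\<exists>i<r. y i \<noteq> 0" for y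
  proof -
    \<comment> \<open>With conjugated coefficients \<open>h v v\<close> becomes exactly the
      quadratic form required by \<open>det_n_pos\<close>.\<close>
    define v where "v = (\<Sum>i<r. cnj (y i) *s s i)"
    have "v \<noteq> 0"
    proof
      assume "v = 0"
      then have "cnj (y i) = 0" if "i < r" for i
        using basis_independent[OF assms(2), of "\<lambda>i. cnj (y i)"] that unfolding v_def by blast
      then have "\<forall>i<r. y i = 0" by simp
      with that show False by blast
    qed
    moreover have "v \<in> S" unfolding v_def by (rule basis_sum_in[OF assms(2)])
    ultimately have "0 < Re (h v v)" using assms(1) unfolding hermitian_on_def by blast
    then show ?thesis
      unfolding v_def using hermitian_on_sum[OF assms(1) S, of "{..<r}" s "\<lambda>i. cnj (y i)" "\<lambda>i. cnj (y i)"] s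
      by simp
  qed
  show "0 < Re (gram r h s)" "gram r h s = of_real (Re (gram r h s))"
    using det_n_pos[of r "\<lambda>i j. h (s i) (s j)", OF 1 2] by auto
qed

lemma gram_change:
  assumes "hermitian_on S h" "is_basis r s S" "\<And>j. j < r \<Longrightarrow> s' j = (\<Sum>k<r. B k j *s s k)"
  shows "Re (gram r h s') = (cmod (det_n r B))\<^sup>2 * Re (gram r h s)"
proof -
  have "gram r h s' = det_n r (\<lambda>i j. \<Sum>k<r. \<Sum>l<r. B k i * h (s k) (s l) * cnj (B l j))"
    using assms(3) hermitian_on_sum[OF assms(1) basis_subspace[OF assms(2)], of "{..<r}" s] basis_in[OF assms(2)]
    by (intro det_n_cong) simp
  also have "\<dots> = det_n r B * gram r h s * cnj (det_n r B)"
    unfolding det_n_congruence by (simp only: det_n_cnj)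
  also have "\<dots> = of_real ((cmod (det_n r B))\<^sup>2) * of_real (Re (gram r h s))"
    using gram_pos(2)[OF assms(1,2)] by (simp only: complex_norm_square) (simp add: mult_ac)
  finally show ?thesis by (simp only: of_real_mult[symmetric] Re_complex_of_real)
qed

section \<open>Determinants of pairings and the logarithmic ratio of two metrics\<close>

lemma pairing_full_eq_0:
  fixes f :: "nat \<Rightarrow> complex ^ 'n"
  assumes "nondeg q" "is_basis CARD('n) f UNIV" "\<And>k. k < CARD('n) \<Longrightarrow> pairing q (f k) v = 0"
  shows "v = 0"
  using dualf_expand[OF assms(1) assms(2)[unfolded basis_iff_fm], of v] assms(3) by simp

lemma gram_pairing_nonzero:
  fixes f :: "nat \<Rightarrow> complex ^ 'n"
  assumes "nondeg q" "is_basis CARD('n) f UNIV"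
  shows "gram CARD('n) (pairing q) f \<noteq> 0"
proof
  assume "gram CARD('n) (pairing q) f = 0"
  then obtain y where y: "\<exists>i<CARD('n). y i \<noteq> 0"
    "\<forall>i<CARD('n). (\<Sum>j<CARD('n). pairing q (f i) (f j) * y j) = 0"
    using det_n_eq_0 by blast
  have "(\<Sum>j<CARD('n). y j *s f j) = 0"
    by (rule pairing_full_eq_0[OF assms]) (use y(2) in \<open>simp add: pairing_sum pairing_scale mult.commute\<close>)
  with y(1) basis_independent[OF assms(2)] show False by blast
qed

text \<open>The orthogonal pairs perfectly with the quotient by S: a vector of the orthogonal is
  already orthogonal to the first r vectors of f, so if it is orthogonal to the others too, it
  vanishes.\<close>

lemma mixed_pairing_nonzero:
  fixes f :: "nat \<Rightarrow> complex ^ 'n"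
  assumes "nondeg q" "is_basis CARD('n) f UNIV" "is_basis r f S" "is_basis m t (perp1 q S)"
    "r + m = CARD('n)"
  shows "det_n m (\<lambda>i j. pairing q (f (r + i)) (t j)) \<noteq> 0"
proof
  assume "det_n m (\<lambda>i j. pairing q (f (r + i)) (t j)) = 0"
  then obtain y where y: "\<exists>i<m. y i \<noteq> 0"
    "\<forall>i<m. (\<Sum>j<m. pairing q (f (r + i)) (t j) * y j) = 0"
    using det_n_eq_0 by blast
  have "(\<Sum>j<m. y j *s t j) = 0"
  proof (rule pairing_full_eq_0[OF assms(1,2)])
    fix k assume k: "k < CARD('n)"
    show "pairing q (f k) (\<Sum>j<m. y j *s t j) = 0"
    proof (cases "k < r")
      case True
      then show ?thesis
        using basis_sum_in[OF assms(4), of y] basis_in[OF assms(3)] by (auto simp: perp1_def)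
    next
      case False
      then obtain i where "k = r + i" "i < m" using k assms(5) by (metis add_diff_inverse_nat nat_add_left_cancel_less)
      then show ?thesis using y(2) by (simp add: pairing_sum pairing_scale mult.commute)
    qed
  qed
  with y(1) basis_independent[OF assms(4)] show False by blast
qed

lemma basis_change:
  assumes "is_basis m t T" "\<And>j. j < m' \<Longrightarrow> t' j \<in> T"
  obtains B where "\<And>j. j < m' \<Longrightarrow> t' j = (\<Sum>k<m. B k j *s t k)"
proof -
  have "\<forall>j. \<exists>c. j < m' \<longrightarrow> t' j = (\<Sum>k<m. c k *s t k)"
    using basis_sum[OF assms(1)] assms(2) by blast
  then obtain c where "\<And>j. j < m' \<Longrightarrow> t' j = (\<Sum>k<m. c j k *s t k)" by metis
  then show thesis by (intro that[of "\<lambda>k j. c j k"])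
qed

text \<open>
  The pairing identifies \<open>S\<^sup>\<bottom>\<close> with the dual of the quotient by \<open>S\<close>, so that \<open>det S\<^sup>\<bottom>\<close> is
  isomorphic to \<open>det S\<close> up to a factor whose modulus is determined by \<open>q\<close>. The following number
  is the logarithm of the ratio of the metrics induced by \<open>h\<close> and \<open>g\<close>; it depends neither
  on the basis \<open>f\<close> extending one of \<open>S\<close> nor on the basis \<open>t\<close> of \<open>S\<^sup>\<bottom>\<close>.
\<close>

definition log_ratio ::
  "complex ^ 'n ^ 'n \<Rightarrow> (complex ^ 'n \<Rightarrow> complex ^ 'n \<Rightarrow> complex) \<Rightarrow>
   (complex ^ 'n \<Rightarrow> complex ^ 'n \<Rightarrow> complex) \<Rightarrow> nat \<Rightarrow> nat \<Rightarrow>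
   (nat \<Rightarrow> complex ^ 'n) \<Rightarrow> (nat \<Rightarrow> complex ^ 'n) \<Rightarrow> real" where
  "log_ratio q h g r m f t =
     ln (Re (gram r h f)) + 2 * ln (cmod (det_n m (\<lambda>i j. pairing q (f (r + i)) (t j))))
     - ln (cmod (gram (r + m) (pairing q) f)) - ln (Re (gram m g t))"

text \<open>Let a, c and b be the determinants of the changes of basis on S, on the quotient by S
  and on the orthogonal. The four terms change by 2 ln|a|, by 2 ln|c| + 2 ln|b|, by - 2 ln|a| - 2
  ln|c| and by - 2 ln|b|, and these cancel.\<close>

lemma log_ratio_eq:
  fixes f f' :: "nat \<Rightarrow> complex ^ 'n"
  assumes q: "nondeg q" and h: "hermitian_on S h" and g: "hermitian_on (perp1 q S) g"
    and rm: "r + m = CARD('n)"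
    and f: "is_basis CARD('n) f UNIV" "is_basis r f S" and t: "is_basis m t (perp1 q S)"
    and f': "is_basis CARD('n) f' UNIV" "is_basis r f' S" and t': "is_basis m t' (perp1 q S)"
  shows "log_ratio q h g r m f' t' = log_ratio q h g r m f t"
proof -
  define M where "M k j = cf f (f' j) k" for k j
  have i: "invertible (fm f)" using f(1) basis_iff_fm by blast
  have M: "f' j = (\<Sum>k<CARD('n). M k j *s f k)" for j
    unfolding M_def by (rule cf_expand[OF i])
  \<comment> \<open>Both bases begin with a basis of S, so the transition matrix is block
    triangular.\<close>
  have M0: "M k j = 0" if jk: "j < r" "r \<le> k" "k < CARD('n)" for k j
  proof -
    obtain c where "f' j = (\<Sum>k<r. c k *s f k)"
      using basis_sum[OF f(2) basis_in[OF f'(2) jk(1)]] by blast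
    then show ?thesis unfolding M_def using cf_eq[OF i, of r k c] jk rm by simp
  qed
  have A: "f' j = (\<Sum>k<r. M k j *s f k)" if "j < r" for j
    unfolding M[of j] using rm M0[OF that] by (intro sum.mono_neutral_right) auto
  have "t' j \<in> perp1 q S" if "j < m" for j using basis_in[OF t' that] .
  with t obtain B where B: "\<And>j. j < m \<Longrightarrow> t' j = (\<Sum>k<m. B k j *s t k)"
    by (rule basis_change[where t' = t' and m' = m]) (assumption, rule that)
  \<comment> \<open>The block describing the change of basis in the quotient by S.\<close>
  define C where "C k j = M (r + k) (r + j)" for k j
  have block: "det_n (r + m) M = det_n r M * det_n m C"
    unfolding C_def by (rule det_n_block) (use M0 rm in auto)
  have F: "gram (r + m) (pairing q) f' = det_n (r + m) M * gram (r + m) (pairing q) f * det_n (r + m) M"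
    unfolding det_n_congruence[symmetric]
  proof (rule det_n_cong)
    fix i j
    have "pairing q (f' i) (f' j) = (\<Sum>k<r + m. M k i * pairing q (f k) (f' j))"
      by (subst (1) M) (simp add: rm pairing_sum pairing_scale)
    also have "\<dots> = (\<Sum>k<r + m. \<Sum>l<r + m. M k i * pairing q (f k) (f l) * M l j)"
      unfolding M[of j] by (simp add: rm pairing_sum pairing_scale sum_distrib_left mult_ac)
    finally show "pairing q (f' i) (f' j) = (\<Sum>k<r + m. \<Sum>l<r + m. M k i * pairing q (f k) (f l) * M l j)" .
  qed
  have "gram (r + m) (pairing q) f' \<noteq> 0" using gram_pairing_nonzero[OF q f'(1)] rm by simp
  then have nz: "det_n r M \<noteq> 0" "det_n m C \<noteq> 0" using F block by auto
  have P: "det_n m (\<lambda>i j. pairing q (f' (r + i)) (t' j)) =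
      det_n m C * det_n m (\<lambda>i j. pairing q (f (r + i)) (t j)) * det_n m B"
    unfolding det_n_congruence[symmetric]
  proof (rule det_n_cong)
    fix i j assume ij: "i < m" "j < m"
    have 0: "pairing q (f k) (t' j) = 0" if "k < r" for k
      using basis_in[OF f(2) that] basis_in[OF t' ij(2)] by (simp add: perp1_def)
    have "pairing q (f' (r + i)) (t' j) = (\<Sum>k<r + m. M k (r + i) * pairing q (f k) (t' j))"
      by (subst M) (simp add: rm pairing_sum pairing_scale)
    also have "\<dots> = (\<Sum>k\<in>{r..<r + m}. M k (r + i) * pairing q (f k) (t' j))"
      using 0 by (intro sum.mono_neutral_right) auto
    also have "\<dots> = (\<Sum>k<m. C k i * pairing q (f (r + k)) (t' j))"
      unfolding C_def by (rule sum.reindex_bij_witness[of _ "\<lambda>k. r + k" "\<lambda>k. k - r"]) auto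
    also have "\<dots> = (\<Sum>k<m. \<Sum>l<m. C k i * pairing q (f (r + k)) (t l) * B l j)"
      unfolding B[OF ij(2)] by (simp add: pairing_sum pairing_scale sum_distrib_left mult_ac)
    finally show "pairing q (f' (r + i)) (t' j) =
        (\<Sum>k<m. \<Sum>l<m. C k i * pairing q (f (r + k)) (t l) * B l j)" .
  qed
  have H: "Re (gram r h f') = (cmod (det_n r M))\<^sup>2 * Re (gram r h f)"
    by (rule gram_change[OF h f(2) A])
  have G: "Re (gram m g t') = (cmod (det_n m B))\<^sup>2 * Re (gram m g t)"
    by (rule gram_change[OF g t B])
  have "Re (gram m g t') \<noteq> 0" using gram_pos(1)[OF g t'] by simp
  then have "det_n m B \<noteq> 0" using G by auto
  moreover have "0 < Re (gram r h f)" "0 < Re (gram m g t)"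
    using gram_pos(1)[OF h f(2)] gram_pos(1)[OF g t] .
  moreover have "gram (r + m) (pairing q) f \<noteq> 0"
    "det_n m (\<lambda>i j. pairing q (f (r + i)) (t j)) \<noteq> 0"
    using gram_pairing_nonzero[OF q f(1)] mixed_pairing_nonzero[OF q f t rm] rm by simp_all
  ultimately show ?thesis
    using nz unfolding log_ratio_def H G P F block
    by (simp add: norm_mult ln_mult ln_realpow)
qed

section \<open>The degree of an orthogonal\<close>

context riemann_surface
begin

lemma hol_fun_det_n:
  assumes "\<And>i j. i < r \<Longrightarrow> j < r \<Longrightarrow> hol_fun A U (\<lambda>x. M x i j)"
  shows "hol_fun A U (\<lambda>x. det_n r (M x))"
proof -
  have "p i < r" if "p permutes {..<r}" "i < r" for p i
    using permutes_in_image[OF that(1), of i] that(2) by simp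
  then show ?thesis
    unfolding det_n_def
    by (intro hol_fun_sum hol_fun_mult hol_fun_const hol_fun_prod assms) auto
qed

lemma smooth_fun_det_n:
  assumes "open U" "\<And>i j. i < r \<Longrightarrow> j < r \<Longrightarrow> smooth_fun A U (\<lambda>x. M x i j)"
  shows "smooth_fun A U (\<lambda>x. det_n r (M x))"
proof -
  have "p i < r" if "p permutes {..<r}" "i < r" for p i
    using permutes_in_image[OF that(1), of i] that(2) by simp
  then show ?thesis
    unfolding det_n_def
    by (intro smooth_fun_sum smooth_fun_mult smooth_fun_const smooth_fun_prod assms) auto
qed

lemma smooth_fun_ln_cmod:
  assumes "open U" "hol_fun A U f" "\<And>x. x \<in> U \<Longrightarrow> f x \<noteq> 0"
  shows "smooth_fun A U (\<lambda>x. ln (cmod (f x)))"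
  unfolding smooth_fun_def
proof safe
  fix V \<phi> k assume c: "(V, \<phi>) \<in> A"
  show "Ck_on k (\<phi> ` (U \<inter> V)) (\<lambda>z. ln (cmod (f (inv_into V \<phi> z))))"
    by (rule Ck_on_ln_cmod[OF open_chart_image[OF c assms(1)] hol_funD[OF assms(2) c]])
      (use assms(3) chart_inv_in[OF c] in blast)
qed

end

context quadratic_bundle
begin

text \<open>Standard Hermitian products of finitely many trivializations are added with bump
  functions as weights; at every point one of the weights is positive.\<close>

lemma hermitian_metric_exists:
  obtains g where "\<And>x. hermitian_on UNIV (g x)"
    "\<And>U a b. open U \<Longrightarrow> hol_section A W U a \<Longrightarrow> hol_section A W U b \<Longrightarrow>
      smooth_fun A U (\<lambda>x. g x (a x) (b x))"
proof -
  have "\<exists>c. c \<in> W \<and> x \<in> fst c" for x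
  proof -
    obtain V t where "(V, t) \<in> W" "x \<in> V" by (rule triv_exists)
    then show ?thesis by (intro exI[of _ "(V, t)"]) simp
  qed
  then have "\<exists>c. \<forall>x. c x \<in> W \<and> x \<in> fst (c x)" by (intro choice allI)
  then obtain c where c: "c x \<in> W" "x \<in> fst (c x)" for x by blast
  then have ct: "(fst (c x), snd (c x)) \<in> W" for x by simp
  have "open (fst (c x)) \<and> x \<in> fst (c x)" for x
    using c(2) triv(1)[OF ct] by blast
  then obtain P d and b :: "'x \<Rightarrow> 'x \<Rightarrow> real" where P: "finite P"
    and "\<And>p. d p \<in> A" and b: "\<And>p. smooth_fun A UNIV (b p)"
    "\<And>p y. 0 \<le> b p y" "\<And>p. closure {y. b p y \<noteq> 0} \<subseteq> fst (c p) \<inter> fst (d p)"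
    "\<And>y. 0 < (\<Sum>p\<in>P. b p y)"
    by (rule bump_cover[of "\<lambda>p. fst (c p)"]) (rule that)
  \<comment> \<open>The standard product in the trivialization \<open>c p\<close>; it is meaningful
    only over its domain, which contains the closed support of the weight
    \<open>b p\<close>.\<close>
  define e where "e p x u v = (\<Sum>i\<in>UNIV. (snd (c p) x *v u) $ i * cnj ((snd (c p) x *v v) $ i))"
    for p x and u v :: "complex ^ 'n"
  define g where "g x u v = (\<Sum>p\<in>P. of_real (b p x) * e p x u v)" for x u v
  have herm: "hermitian_on UNIV (g x)" for x
    unfolding hermitian_on_def
  proof (intro ballI conjI allI impI)
    fix u v w :: "complex ^ 'n" and \<alpha> \<beta>
    have "e p x (\<alpha> *s u + \<beta> *s v) w = \<alpha> * e p x u w + \<beta> * e p x v w" for p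
      unfolding e_def sum_distrib_left sum.distrib[symmetric]
      by (intro sum.cong refl)
        (simp add: matrix_vector_right_distrib matrix_vector_mult_smult algebra_simps)
    then show "g x (\<alpha> *s u + \<beta> *s v) w = \<alpha> * g x u w + \<beta> * g x v w"
      unfolding g_def by (simp add: sum_distrib_left sum.distrib distrib_left mult_ac)
    have "e p x v u = cnj (e p x u v)" for p unfolding e_def by (simp add: mult.commute)
    then show "g x v u = cnj (g x u v)" unfolding g_def by simp
    have e: "Re (e p x u u) = (\<Sum>i\<in>UNIV. (cmod ((snd (c p) x *v u) $ i))\<^sup>2)" for p
      unfolding e_def Re_sum by (intro sum.cong refl) (simp add: cmod_power2 power2_eq_square[of "Re _"] power2_eq_square[of "Im _"])
    have g: "Re (g x u u) = (\<Sum>p\<in>P. b p x * Re (e p x u u))" unfolding g_def by simp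
    assume "u \<noteq> 0"
    have pos: "0 \<le> b p x * Re (e p x u u)" for p
      unfolding e by (intro mult_nonneg_nonneg b(2) sum_nonneg) auto
    obtain p where p: "p \<in> P" "b p x \<noteq> 0"
      using b(4)[of x] by (metis less_irrefl sum.neutral)
    have "x \<in> fst (c p)" using b(3)[of p] closure_subset[of "{y. b p y \<noteq> 0}"] p(2) by blast
    then have "snd (c p) x *v u \<noteq> 0"
      using triv(2)[OF ct] \<open>u \<noteq> 0\<close> unfolding invertible_iff_ker by blast
    then obtain i where "(snd (c p) x *v u) $ i \<noteq> 0" by (auto simp: vec_eq_iff)
    then have "0 < Re (e p x u u)" unfolding e by (intro sum_pos2[of _ i]) auto
    moreover have "0 < b p x" using b(2)[of p x] p(2) by simp
    ultimately show "0 < Re (g x u u)"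
      unfolding g using pos by (intro sum_pos2[OF P p(1)]) auto
  qed
  have smooth: "smooth_fun A U (\<lambda>x. g x (a x) (a' x))"
    if U: "open U" "hol_section A W U a" "hol_section A W U a'" for U a a'
    unfolding g_def
  proof (intro smooth_fun_sum U(1))
    fix p
    let ?F = "\<lambda>x. of_real (b p x) * e p x (a x) (a' x)" and ?K = "closure {y. b p y \<noteq> 0}"
    let ?V = "fst (c p)"
    have o: "open ?V" "open (U \<inter> ?V)" "open (U \<inter> - ?K)" using triv(1)[OF ct] U(1) by auto
    have "hol_fun A (U \<inter> ?V) (\<lambda>x. (snd (c p) x *v a x) $ i)" "hol_fun A (U \<inter> ?V) (\<lambda>x. (snd (c p) x *v a' x) $ i)" for i
      using U(2,3) ct[of p] unfolding hol_section_def by blast+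
    then have "smooth_fun A (U \<inter> ?V) (\<lambda>x. e p x (a x) (a' x))"
      unfolding e_def
      by (intro smooth_fun_sum smooth_fun_mult smooth_fun_linear[OF bounded_linear_cnj] smooth_fun_hol o)
    moreover have "smooth_fun A (U \<inter> ?V) (\<lambda>x. complex_of_real (b p x))"
      by (intro smooth_fun_linear[OF bounded_linear_of_real] o smooth_fun_subset[OF b(1)]) auto
    ultimately have 1: "smooth_fun A (U \<inter> ?V) ?F" by (intro smooth_fun_mult o)
    have b0: "b p x = 0" if "x \<notin> ?K" for x
      using closure_subset[of "{y. b p y \<noteq> 0}"] that by blast
    have z: "smooth_fun A (U \<inter> - ?K) (\<lambda>_. 0 :: complex)"
      by (rule smooth_fun_const[OF o(3)])
    have 2: "smooth_fun A (U \<inter> - ?K) ?F"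
    proof (rule smooth_fun_cong[OF o(3) _ z])
      fix x assume "x \<in> U \<inter> - ?K"
      then have "b p x = 0" by (intro b0) simp
      then show "0 = ?F x" by simp
    qed
    \<comment> \<open>U is covered by the domain of the trivialization, where all factors are
      smooth, and the complement of the closed support, where the term vanishes.\<close>
    show "smooth_fun A U ?F"
    proof (rule smooth_fun_local[OF U(1)])
      fix x assume "x \<in> U"
      show "\<exists>T. open T \<and> x \<in> T \<and> smooth_fun A (U \<inter> T) ?F"
      proof (cases "x \<in> ?V")
        case True
        with 1 o(1) show ?thesis by (intro exI[of _ ?V]) simp
      next
        case False
        then have "x \<in> - ?K" using b(3)[of p] by blast
        with 2 show ?thesis by (intro exI[of _ "- ?K"]) (simp add: open_Compl)
      qed
    qed
  qed
  from herm smooth show thesis by (rule that[of g])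
qed

lemma hermitian_metric_iff:
  "hermitian_metric A W S h \<longleftrightarrow> (\<forall>x. hermitian_on (S x) (h x)) \<and>
     (\<forall>r U s. local_frame A W S r U s \<longrightarrow>
        (\<forall>i<r. \<forall>j<r. smooth_fun A U (\<lambda>x. h x (s i x) (s j x))))"
  unfolding hermitian_metric_def hermitian_on_def ..

end

section \<open>Transfer of Chern forms to the orthogonal, and the degree of the zero bundle\<close>

context quadratic_bundle
begin

text \<open>Scaling an auxiliary metric g by c multiplies its Gram determinant by the m-th power of
  c, here exp L. The result is H |P|^2 / |F|, with H the Gram determinant of h and P, F holomorphic
  without zeros, so both metrics have the same Laplacian of the log determinant.\<close>

lemma metric_on_perp:
  assumes S: "hol_subbundle A W S" and ne: "perp Q S \<noteq> zero_sub"
    and h: "hermitian_metric A W S h" and \<omega>: "chern_form A W S h \<omega>"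
  shows "\<exists>h'. hermitian_metric A W (perp Q S) h' \<and> chern_form A W (perp Q S) h' \<omega>"
proof -
  obtain r where r: "\<And>x. \<exists>U s. x \<in> U \<and> local_frame A W S r U s"
    using S unfolding hol_subbundle_def by blast
  have frame0: "\<exists>T f. x \<in> T \<and> local_frame A W whole_sub CARD('n) T f \<and> local_frame A W S r T f \<and>
      r \<le> CARD('n)" for x
  proof -
    obtain U s where "x \<in> U" "local_frame A W S r U s" using r by blast
    from frame_extend[OF this(2,1)] show ?thesis by metis
  qed
  then have rn: "r \<le> CARD('n)" by blast
  have frame: "\<exists>T f. x \<in> T \<and> local_frame A W whole_sub CARD('n) T f \<and> local_frame A W S r T f" for x
    using frame0 by blast
  define m where "m = CARD('n) - r"
  have rm: "r + m = CARD('n)" using rn by (simp add: m_def)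
  have dual: "local_frame A W (perp Q S) m T (\<lambda>j x. dualf (Q x) (\<lambda>i. f i x) (r + j))"
    if "local_frame A W whole_sub CARD('n) T f" "local_frame A W S r T f" for T f
    using that hol_section_dualf[OF that(1)] rn unfolding local_frame_iff perp_eq m_def
    by (auto intro!: perp1_basis[OF nondeg])
  \<comment> \<open>\<open>chern_form\<close> quantifies over frames of any length; at a point of
    its domain a frame of the orthogonal has length m.\<close>
  have rank: "r' = m" if "is_basis r' t (perp1 (Q x) (S x))" for r' t x
  proof -
    obtain T f where "x \<in> T" "local_frame A W whole_sub CARD('n) T f" "local_frame A W S r T f"
      using frame by blast
    from dual[OF this(2,3)] this(1) have "m = vec.dim (perp1 (Q x) (S x))"
      unfolding local_frame_iff perp_eq using basis_rank by blast
    with basis_rank[OF that] show ?thesis by simp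
  qed
  \<comment> \<open>The conformal factor is an m-th root; this is where \<open>ne\<close>
    enters.\<close>
  have m: "m \<noteq> 0"
  proof
    assume "m = 0"
    have "perp Q S x = {0}" for x
    proof -
      obtain T f where "x \<in> T" "local_frame A W whole_sub CARD('n) T f" "local_frame A W S r T f"
        using frame by blast
      from dual[OF this(2,3)] this(1) \<open>m = 0\<close>
      have "is_basis 0 (\<lambda>j. dualf (Q x) (\<lambda>i. f i x) (r + j)) (perp Q S x)"
        by (simp add: local_frame_iff)
      then show ?thesis by (auto simp: is_basis_def)
    qed
    with ne show False by auto
  qed
  obtain g where g: "\<And>x. hermitian_on UNIV (g x)"
    and g_smooth: "\<And>U a b. open U \<Longrightarrow> hol_section A W U a \<Longrightarrow> hol_section A W U b \<Longrightarrow>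
      smooth_fun A U (\<lambda>x. g x (a x) (b x))"
    using hermitian_metric_exists by blast
  have g': "hermitian_on T (g x)" for T x using g[of x] unfolding hermitian_on_def by blast
  have hx: "hermitian_on (S x) (h x)" for x using h unfolding hermitian_metric_iff by blast
  let ?ratio = "\<lambda>f t x. log_ratio (Q x) (h x) (g x) r m (\<lambda>i. f i x) (\<lambda>j. t j x)"
  \<comment> \<open>Bases are chosen point by point, but by \<open>log_ratio_eq\<close> the value
    agrees with the one computed in any local frames. This makes L global and smooth at the same
    time.\<close>
  define L where "L x = (SOME l. \<exists>f t. is_basis CARD('n) f UNIV \<and> is_basis r f (S x) \<and>
      is_basis m t (perp1 (Q x) (S x)) \<and> l = log_ratio (Q x) (h x) (g x) r m f t)" for x
  have L: "L x = ?ratio f t x" if "x \<in> T"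
    "local_frame A W whole_sub CARD('n) T f" "local_frame A W S r T f" "local_frame A W (perp Q S) m T t"
    for x T and f t :: "nat \<Rightarrow> 'x \<Rightarrow> complex ^ 'n"
  proof -
    have b: "is_basis CARD('n) (\<lambda>i. f i x) UNIV" "is_basis r (\<lambda>i. f i x) (S x)"
      "is_basis m (\<lambda>j. t j x) (perp1 (Q x) (S x))"
      using that by (auto simp: local_frame_iff perp_eq)
    have "\<exists>f' t'. is_basis CARD('n) f' UNIV \<and> is_basis r f' (S x) \<and>
      is_basis m t' (perp1 (Q x) (S x)) \<and> L x = log_ratio (Q x) (h x) (g x) r m f' t'"
      unfolding L_def by (rule someI[of _ "?ratio f t x"]) (use b in blast)
    then obtain f' t' where "is_basis CARD('n) f' UNIV" "is_basis r f' (S x)"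
      "is_basis m t' (perp1 (Q x) (S x))" "L x = log_ratio (Q x) (h x) (g x) r m f' t'" by blast
    then show ?thesis using log_ratio_eq[OF nondeg hx g' rm b] by simp
  qed
  have nz: "gram (r + m) (pairing (Q x)) (\<lambda>i. f i x) \<noteq> 0"
    "det_n m (\<lambda>i j. pairing (Q x) (f (r + i) x) (t j x)) \<noteq> 0"
    "0 < Re (gram r (h x) (\<lambda>i. f i x))" "0 < Re (gram m (g x) (\<lambda>i. t i x))"
    if "x \<in> T" "local_frame A W whole_sub CARD('n) T f" "local_frame A W S r T f" "local_frame A W (perp Q S) m T t"
    for x T f t
  proof -
    have b: "is_basis CARD('n) (\<lambda>i. f i x) UNIV" "is_basis r (\<lambda>i. f i x) (S x)"
      "is_basis m (\<lambda>j. t j x) (perp1 (Q x) (S x))"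
      using that by (auto simp: local_frame_iff perp_eq)
    show "gram (r + m) (pairing (Q x)) (\<lambda>i. f i x) \<noteq> 0"
      using gram_pairing_nonzero[OF nondeg b(1)] rm by simp
    show "det_n m (\<lambda>i j. pairing (Q x) (f (r + i) x) (t j x)) \<noteq> 0"
      by (rule mixed_pairing_nonzero[OF nondeg b rm])
    show "0 < Re (gram r (h x) (\<lambda>i. f i x))" "0 < Re (gram m (g x) (\<lambda>i. t i x))"
      by (rule gram_pos(1)[OF hx b(2)], rule gram_pos(1)[OF g' b(3)])
  qed
  have hol: "hol_fun A T (\<lambda>x. gram (r + m) (pairing (Q x)) (\<lambda>i. f i x))"
    "hol_fun A T (\<lambda>x. det_n m (\<lambda>i j. pairing (Q x) (f (r + i) x) (t j x)))"
    if "local_frame A W whole_sub CARD('n) T f" "local_frame A W (perp Q S) m T t"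
    for T f t
  proof -
    have "open T" "\<And>i. i < r + m \<Longrightarrow> hol_section A W T (f i)" "\<And>j. j < m \<Longrightarrow> hol_section A W T (t j)"
      using that rm by (auto simp: local_frame_def)
    then show "hol_fun A T (\<lambda>x. gram (r + m) (pairing (Q x)) (\<lambda>i. f i x))"
      "hol_fun A T (\<lambda>x. det_n m (\<lambda>i j. pairing (Q x) (f (r + i) x) (t j x)))"
      by (auto intro!: hol_fun_det_n hol_fun_pairing)
  qed
  have smooth: "smooth_fun A T (\<lambda>x. ln (Re (gram r (h x) (\<lambda>i. f i x))))"
    "smooth_fun A T (\<lambda>x. ln (Re (gram m (g x) (\<lambda>i. t i x))))"
    if T: "local_frame A W whole_sub CARD('n) T f" "local_frame A W S r T f" "local_frame A W (perp Q S) m T t"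
    for T f t
  proof -
    have o: "open T" and t: "\<And>j. j < m \<Longrightarrow> hol_section A W T (t j)"
      using that rm by (auto simp: local_frame_def)
    have hs: "smooth_fun A T (\<lambda>x. h x (f i x) (f j x))" if "i < r" "j < r" for i j
      using h T(2) that unfolding hermitian_metric_iff by blast
    show "smooth_fun A T (\<lambda>x. ln (Re (gram r (h x) (\<lambda>i. f i x))))"
      by (intro smooth_fun_ln smooth_fun_linear[OF bounded_linear_Re] smooth_fun_det_n hs o nz(3)[OF _ T])
    show "smooth_fun A T (\<lambda>x. ln (Re (gram m (g x) (\<lambda>i. t i x))))"
      by (intro smooth_fun_ln smooth_fun_linear[OF bounded_linear_Re] smooth_fun_det_n g_smooth o t nz(4)[OF _ T])
  qed
  have L_smooth: "smooth_fun A UNIV L"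
  proof (rule smooth_fun_local)
    fix x
    obtain T f where T: "x \<in> T" and f: "local_frame A W whole_sub CARD('n) T f" "local_frame A W S r T f"
      using frame by blast
    note t = dual[OF f]
    have o: "open T" using f by (simp add: local_frame_def)
    have "smooth_fun A T (\<lambda>x. ln (Re (gram r (h x) (\<lambda>i. f i x))) +
       2 * ln (cmod (det_n m (\<lambda>i j. pairing (Q x) (f (r + i) x) (dualf (Q x) (\<lambda>i. f i x) (r + j))))) +
       - ln (cmod (gram (r + m) (pairing (Q x)) (\<lambda>i. f i x))) +
       - ln (Re (gram m (g x) (\<lambda>j. dualf (Q x) (\<lambda>i. f i x) (r + j)))))"
      by (intro smooth_fun_add smooth_fun_mult smooth_fun_const smooth[OF f t] o
          smooth_fun_linear[OF bounded_linear_minus[OF bounded_linear_ident]]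
          smooth_fun_ln_cmod hol[OF f(1) t] nz[OF _ f t])
    then have "smooth_fun A T L"
      by (rule smooth_fun_cong[OF o, rotated]) (simp add: L[OF _ f t] log_ratio_def)
    with T o show "\<exists>T. open T \<and> x \<in> T \<and> smooth_fun A (UNIV \<inter> T) L" by auto
  qed simp
  \<comment> \<open>A metric of rank m scaled by c has its determinant scaled by the m-th power of
    c, hence the division by m.\<close>
  define c where "c x = exp (L x * (1 / real m))" for x
  have c_smooth: "smooth_fun A UNIV c"
    unfolding c_def by (intro smooth_fun_exp smooth_fun_mult smooth_fun_const L_smooth) simp_all
  define h' where "h' x u v = of_real (c x) * g x u v" for x u v
  have h'_herm: "hermitian_on T (h' x)" for T x
    unfolding hermitian_on_def
  proof (intro ballI conjI allI impI)
    fix u v w \<alpha> \<beta>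
    have "g x (\<alpha> *s u + \<beta> *s v) w = \<alpha> * g x u w + \<beta> * g x v w" "g x v u = cnj (g x u v)"
      "u \<noteq> 0 \<longrightarrow> 0 < Re (g x u u)"
      using g[of x] unfolding hermitian_on_def by blast+
    then show "h' x (\<alpha> *s u + \<beta> *s v) w = \<alpha> * h' x u w + \<beta> * h' x v w" "h' x v u = cnj (h' x u v)"
      "u \<noteq> 0 \<Longrightarrow> 0 < Re (h' x u u)"
      by (simp_all add: h'_def distrib_left mult_ac c_def)
  qed
  have "hermitian_metric A W (perp Q S) h'"
    unfolding hermitian_metric_iff
  proof (intro conjI allI impI h'_herm)
    fix r' U t i j assume f: "local_frame A W (perp Q S) r' U t" and "i < r'" "j < r'"
    then have U: "open U" "hol_section A W U (t i)" "hol_section A W U (t j)"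
      by (auto simp: local_frame_def)
    show "smooth_fun A U (\<lambda>x. h' x (t i x) (t j x))"
      unfolding h'_def
      by (intro smooth_fun_mult smooth_fun_linear[OF bounded_linear_of_real]
          smooth_fun_subset[OF c_smooth] g_smooth U) simp
  qed
  moreover have "chern_form A W (perp Q S) h' \<omega>"
    unfolding chern_form_def
  proof safe
    fix V \<phi> r' U t x
    assume ch: "(V, \<phi>) \<in> A" and t: "local_frame A W (perp Q S) r' U t" and x: "x \<in> U" "x \<in> V"
    have "r' = m" using t x(1) rank unfolding local_frame_iff perp_eq by blast
    note t = t[unfolded this]
    obtain T f where T: "x \<in> T" and f: "local_frame A W whole_sub CARD('n) T f" "local_frame A W S r T f"
      using frame by blast
    define N where "N = U \<inter> T"
    have N: "open N" "N \<subseteq> T" "N \<subseteq> U" "x \<in> N" using f t x T by (auto simp: N_def local_frame_def)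
    note f' = local_frame_subset[OF f(1) N(1,2)] local_frame_subset[OF f(2) N(1,2)]
    note t' = local_frame_subset[OF t N(1,3)]
    let ?H = "\<lambda>x. Re (gram r (h x) (\<lambda>i. f i x))"
    let ?P = "\<lambda>x. det_n m (\<lambda>i j. pairing (Q x) (f (r + i) x) (t j x))"
    let ?F = "\<lambda>x. gram (r + m) (pairing (Q x)) (\<lambda>i. f i x)"
    let ?x = "inv_into V \<phi>" and ?S = "\<phi> ` (N \<inter> V)"
    have oS: "open ?S" and zS: "\<phi> x \<in> ?S" using open_chart_image[OF ch N(1)] N(4) x(2) by auto
    have inN: "?x z \<in> N" if "z \<in> ?S" for z using chart_inv_in[OF ch that] by blast
    have "ln (Re (gram m (h' y) (\<lambda>i. t i y))) = ln (?H y) + 2 * ln (cmod (?P y)) - ln (cmod (?F y))"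
      if "y \<in> N" for y
    proof -
      have "gram m (h' y) (\<lambda>i. t i y) = of_real (c y ^ m) * gram m (g y) (\<lambda>i. t i y)"
        unfolding h'_def det_n_scale by simp
      then have "Re (gram m (h' y) (\<lambda>i. t i y)) = c y ^ m * Re (gram m (g y) (\<lambda>i. t i y))" by simp
      moreover have "c y ^ m = exp (L y)" using m by (simp add: c_def exp_of_nat_mult[symmetric])
      ultimately have "ln (Re (gram m (h' y) (\<lambda>i. t i y))) = L y + ln (Re (gram m (g y) (\<lambda>i. t i y)))"
        using nz(4)[OF that f' t'] by (simp add: ln_mult)
      then show ?thesis unfolding L[OF that f' t'] log_ratio_def by simp
    qed
    \<comment> \<open>The last two terms are logarithms of moduli of holomorphic functions without
      zeros, so only the Laplacian belonging to h survives.\<close>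
    then have "laplacian (\<lambda>z. ln (Re (gram m (h' (?x z)) (\<lambda>i. t i (?x z))))) (\<phi> x) =
        laplacian (\<lambda>z. 1 * ln (?H (?x z)) + 1 * (2 * ln (cmod (?P (?x z))) + (-1) * ln (cmod (?F (?x z))))) (\<phi> x)"
      using inN by (intro laplacian_cong[OF oS zS]) simp
    also have "\<dots> = 1 * laplacian (\<lambda>z. ln (?H (?x z))) (\<phi> x) + 1 *
        laplacian (\<lambda>z. 2 * ln (cmod (?P (?x z))) + (-1) * ln (cmod (?F (?x z)))) (\<phi> x)"
      using smooth_funD[OF smooth(1)[OF f' t'] ch]
        smooth_funD[OF smooth_fun_ln_cmod[OF N(1) hol(1)[OF f'(1) t'] nz(1)[OF _ f' t']] ch]
        smooth_funD[OF smooth_fun_ln_cmod[OF N(1) hol(2)[OF f'(1) t'] nz(2)[OF _ f' t']] ch]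
      by (intro laplacian_linear_combination[OF oS zS] Ck_on_add Ck_on_mult Ck_on_const oS)
    also have "laplacian (\<lambda>z. 2 * ln (cmod (?P (?x z))) + (-1) * ln (cmod (?F (?x z)))) (\<phi> x) =
        2 * laplacian (\<lambda>z. ln (cmod (?P (?x z)))) (\<phi> x) + (-1) * laplacian (\<lambda>z. ln (cmod (?F (?x z)))) (\<phi> x)"
      using smooth_funD[OF smooth_fun_ln_cmod[OF N(1) hol(1)[OF f'(1) t'] nz(1)[OF _ f' t']] ch]
        smooth_funD[OF smooth_fun_ln_cmod[OF N(1) hol(2)[OF f'(1) t'] nz(2)[OF _ f' t']] ch]
      by (intro laplacian_linear_combination[OF oS zS])
    also have "laplacian (\<lambda>z. ln (cmod (?P (?x z)))) (\<phi> x) = 0"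
      using nz(2)[OF inN f' t'] by (intro laplacian_ln_cmod[OF oS hol_funD[OF hol(2)[OF f'(1) t'] ch] _ zS])
    also have "laplacian (\<lambda>z. ln (cmod (?F (?x z)))) (\<phi> x) = 0"
      using nz(1)[OF inN f' t'] by (intro laplacian_ln_cmod[OF oS hol_funD[OF hol(1)[OF f'(1) t'] ch] _ zS])
    finally have "laplacian (\<lambda>z. ln (Re (gram m (h' (?x z)) (\<lambda>i. t i (?x z))))) (\<phi> x) =
        laplacian (\<lambda>z. ln (?H (?x z))) (\<phi> x)" by simp
    moreover have "\<omega> (V, \<phi>) (\<phi> x) = - laplacian (\<lambda>z. ln (?H (?x z))) (\<phi> x) / (4 * pi)"
      using \<omega> ch f(2) T x(2) unfolding chern_form_def Let_def by blast
    ultimately show "\<omega> (V, \<phi>) (\<phi> x) = - laplacian (\<lambda>z. let x = inv_into V \<phi> z in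
        ln (Re (det_n r' (\<lambda>i j. h' x (t i x) (t j x))))) (\<phi> x) / (4 * pi)"
      unfolding \<open>r' = m\<close> Let_def by simp
  qed
  ultimately show ?thesis by blast
qed

text \<open>Applied to S and to its orthogonal, \<open>metric_on_perp\<close> shows that the two
  bundles have the same set of Chern forms; hence the two definite descriptions are the
  same.\<close>

lemma deg_perp:
  assumes S: "hol_subbundle A W S" and "S \<noteq> zero_sub" "perp Q S \<noteq> zero_sub"
  shows "deg A W (perp Q S) = deg A W S"
proof -
  have eq: "(\<exists>h. hermitian_metric A W (perp Q S) h \<and> chern_form A W (perp Q S) h \<omega>) \<longleftrightarrow>
      (\<exists>h. hermitian_metric A W S h \<and> chern_form A W S h \<omega>)" for \<omega>
  proof
    assume "\<exists>h. hermitian_metric A W (perp Q S) h \<and> chern_form A W (perp Q S) h \<omega>"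
    then obtain h where "hermitian_metric A W (perp Q S) h" "chern_form A W (perp Q S) h \<omega>" by auto
    with metric_on_perp[OF subbundle_perp[OF S], unfolded perp_perp[OF S], OF assms(2)]
    show "\<exists>h. hermitian_metric A W S h \<and> chern_form A W S h \<omega>" by simp
  next
    assume "\<exists>h. hermitian_metric A W S h \<and> chern_form A W S h \<omega>"
    then obtain h where "hermitian_metric A W S h" "chern_form A W S h \<omega>" by auto
    with metric_on_perp[OF S assms(3)]
    show "\<exists>h. hermitian_metric A W (perp Q S) h \<and> chern_form A W (perp Q S) h \<omega>" by simp
  qed
  \<comment> \<open>Exhibits \<open>deg\<close> as depending on the bundle only through its set of
    Chern forms.\<close>
  have swap: "(\<exists>h \<omega>. p h \<and> c h \<omega> \<and> i \<omega>) \<longleftrightarrow> (\<exists>\<omega>. (\<exists>h. p h \<and> c h \<omega>) \<and> i \<omega>)"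
    for p c i by auto
  show ?thesis unfolding deg_def swap eq ..
qed

lemma det_n_0: "det_n 0 M = 1"
  by (simp add: det_n_def)

lemma laplacian_const: "laplacian (\<lambda>z. a) z = 0"
  using has_derivative_pd[OF has_derivative_const[of a], abs_def]
    has_derivative_pd[OF has_derivative_const[of "0::real"]]
  by (simp add: laplacian_def)

text \<open>The semistability criterion admits the zero subbundle. Its Gram determinants are empty,
  so its Chern forms vanish on the charts; a partition of unity provides existence in the definite
  description.\<close>

lemma deg_zero: "deg A W zero_sub = 0"
proof -
  \<comment> \<open>The point x matters: over the empty set a frame may have any length.\<close>
  have frame0: "r = 0" if "local_frame A W zero_sub r U s" "x \<in> U" for r U s x
  proof (rule ccontr)
    assume "r \<noteq> 0"
    have b: "is_basis r (\<lambda>i. s i x) {0}" using that by (simp add: local_frame_iff)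
    then have "s 0 x = 0" using basis_in[OF b, of 0] \<open>r \<noteq> 0\<close> by simp
    then have "0 \<in> (\<lambda>i. s i x) ` {..<r}" using \<open>r \<noteq> 0\<close> by force
    from vec.dependent_zero[OF this] b show False by (simp add: is_basis_def)
  qed
  have "hermitian_metric A W zero_sub (\<lambda>x u v. 0)"
    unfolding hermitian_metric_def
  proof (intro conjI allI impI)
    fix r U s i j assume "local_frame A W zero_sub r U s"
    then have "open U" by (simp add: local_frame_def)
    then show "smooth_fun A U (\<lambda>x. 0 :: complex)" by (rule smooth_fun_const)
  qed simp
  moreover have "chern_form A W zero_sub (\<lambda>x u v. 0) (\<lambda>c z. 0)"
    unfolding chern_form_def
  proof safe
    fix V \<phi> r U s x assume "local_frame A W zero_sub r U s" "x \<in> U"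
    from frame0[OF this] show "0 = - laplacian (\<lambda>z. let x = inv_into V \<phi> z in
        ln (Re (det_n r (\<lambda>i j. 0)))) (\<phi> x) / (4 * pi)"
      by (simp add: det_n_0 laplacian_const)
  qed
  moreover have "has_form_integral A (\<lambda>c z. 0) 0"
  proof (rule partition_of_unity)
    fix J and \<rho> :: "'x set \<times> ('x \<Rightarrow> complex) \<Rightarrow> 'x \<Rightarrow> real"
    assume "finite J" "J \<subseteq> A"
      "\<And>c. c \<in> J \<Longrightarrow> smooth_fun A UNIV (\<rho> c) \<and> (\<forall>x. 0 \<le> \<rho> c x) \<and> closure {x. \<rho> c x \<noteq> 0} \<subseteq> fst c"
      "\<And>x. (\<Sum>c\<in>J. \<rho> c x) = 1"
    then show ?thesis
      unfolding has_form_integral_def by (intro exI[of _ J] exI[of _ \<rho>]) simp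
  qed
  ultimately have ex: "\<exists>h \<omega>. hermitian_metric A W zero_sub h \<and> chern_form A W zero_sub h \<omega> \<and> has_form_integral A \<omega> 0"
    by blast
  \<comment> \<open>The empty frame is defined over the whole surface and forces the form to vanish
    in every chart, so every way of integrating it gives zero.\<close>
  have unique: "d = 0" if d: "chern_form A W zero_sub h \<omega>" "has_form_integral A \<omega> d" for d h \<omega>
  proof -
    have \<omega>: "\<omega> c z = 0" if c: "c \<in> A" and z: "z \<in> snd c ` fst c" for c z
    proof -
      obtain V \<phi> where c': "c = (V, \<phi>)" by (cases c)
      have A: "(V, \<phi>) \<in> A" and z': "z \<in> \<phi> ` (UNIV \<inter> V)" using c z by (auto simp: c')
      note d(1)[unfolded chern_form_def, THEN bspec, OF A, unfolded prod.case, rule_format,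
          OF zero_frame[of "\<lambda>_ _. 0"] z']
      then show ?thesis by (simp add: c' det_n_0 laplacian_const)
    qed
    have int: "integral (snd c ` fst c) (\<lambda>z. f z * \<omega> c z) = 0" if "c \<in> A" for c and f :: "complex \<Rightarrow> real"
    proof -
      have "integral (snd c ` fst c) (\<lambda>z. f z * \<omega> c z) = integral (snd c ` fst c) (\<lambda>z. 0)"
        by (rule Henstock_Kurzweil_Integration.integral_cong) (simp add: \<omega>[OF that])
      then show ?thesis by simp
    qed
    obtain J \<rho> where J: "J \<subseteq> A" and
      "d = (\<Sum>c\<in>J. integral (snd c ` fst c) (\<lambda>z. \<rho> c (inv_into (fst c) (snd c) z) * \<omega> c z))"
      using d(2) unfolding has_form_integral_def by (elim exE conjE) (rule that)
    moreover have "\<dots> = 0"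
      by (intro sum.neutral ballI int) (use J in auto)
    ultimately show ?thesis by simp
  qed
  show ?thesis
    unfolding deg_def
  proof (rule the_equality)
    show "\<exists>h \<omega>. hermitian_metric A W zero_sub h \<and> chern_form A W zero_sub h \<omega> \<and> has_form_integral A \<omega> 0"
      by (rule ex)
  next
    fix d assume "\<exists>h \<omega>. hermitian_metric A W zero_sub h \<and> chern_form A W zero_sub h \<omega> \<and> has_form_integral A \<omega> d"
    then show "d = 0" by (elim exE conjE) (rule unique)
  qed
qed

end

section \<open>Invariance and the subbundles \<open>N\<close>\<close>

lemma sym_tensor_vec:
  "(sym_tensor l u v ** q) *v w = (l $ 1 / 2) *s (pairing q v w *s u + pairing q u w *s v)"
proof -
  have K: "(sym_tensor l u v *v y) $ i =
      l $ 1 / 2 * ((\<Sum>j\<in>UNIV. v $ j * y $ j) * u $ i + (\<Sum>j\<in>UNIV. u $ j * y $ j) * v $ i)" for i y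
    unfolding matrix_vector_mult_def sym_tensor_def vec_lambda_beta
      sum_distrib_left sum_distrib_right sum.distrib[symmetric]
    by (intro sum.cong refl) (simp add: field_simps)
  show ?thesis
    by (simp only: vec_eq_iff matrix_vector_mul_assoc[symmetric] K pairing_eq
        vector_smult_component vector_add_component simp_thms)
qed

text \<open>Reduces invariance for a span of tensors to the simple ones. The span is real, while T
  is closed under complex and hence under real scalars.\<close>

lemma span_sym_tensor_maps_into:
  fixes M :: "complex ^ 'n ^ 'n"
  assumes M: "M \<in> span X" and T: "vec.subspace T"
    and X: "\<And>N w. N \<in> X \<Longrightarrow> w \<in> S \<Longrightarrow> (N ** q) *v w \<in> T" and w: "w \<in> S"
  shows "(M ** q) *v w \<in> T"
proof -
  let ?V = "{N :: complex ^ 'n ^ 'n. (N ** q) *v w \<in> T}"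
  have "subspace ?V"
    unfolding subspace_def
  proof (intro conjI ballI allI)
    have "((0 :: complex ^ 'n ^ 'n) ** q) *v w = 0" by (simp flip: matrix_vector_mul_assoc)
    then show "0 \<in> ?V" using vec.subspace_0[OF T] by simp
  next
    fix N N' assume "N \<in> ?V" "N' \<in> ?V"
    then show "N + N' \<in> ?V"
      using vec.subspace_add[OF T, of "(N ** q) *v w" "(N' ** q) *v w"]
      by (simp add: matrix_vector_mult_add_rdistrib flip: matrix_vector_mul_assoc)
  next
    fix c and N assume "N \<in> ?V"
    moreover have "(c *\<^sub>R N) $ i $ j = of_real c * N $ i $ j" for i j
      by (simp only: vector_scaleR_component) (simp only: scaleR_conv_of_real)
    then have "((c *\<^sub>R N) ** q) *v w = of_real c *s ((N ** q) *v w)"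
      unfolding matrix_vector_mul_assoc[symmetric]
      by (simp add: vec_eq_iff matrix_vector_mult_def[of "c *\<^sub>R N"] matrix_vector_mult_def[of N]
          sum_distrib_left mult.assoc)
    ultimately show "c *\<^sub>R N \<in> ?V" using vec.subspace_scale[OF T] by simp
  qed
  moreover have "X \<subseteq> ?V" using X w by auto
  ultimately have "span X \<subseteq> ?V" by (intro span_minimal)
  with M show ?thesis by auto
qed

text \<open>Expanding in the entries of Y writes the sum as a combination of the simple tensors of
  the columns of M and N.\<close>

lemma sym_sum_in_span:
  fixes M N Y :: "complex ^ 'n ^ 'n"
  assumes "transpose Y = Y" "\<And>v. M *v v \<in> S" "\<And>v. N *v v \<in> T"
  shows "M ** Y ** transpose N + N ** Y ** transpose M \<in> span (sym_tensors S T)"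
proof -
  have Y: "Y $ a $ b = Y $ b $ a" for a b
    using assms(1) unfolding transpose_def by (metis vec_lambda_beta)
  have col: "(P *v axis a 1) $ i = P $ i $ a" for P :: "complex ^ 'n ^ 'n" and a i
    by (simp add: matrix_vector_mult_def axis_def if_distrib cong: if_cong)
  have mult: "(P ** Y ** transpose R) $ i $ j = (\<Sum>a\<in>UNIV. \<Sum>b\<in>UNIV. Y $ a $ b * (P $ i $ a * R $ j $ b))"
    for P R :: "complex ^ 'n ^ 'n" and i j
    unfolding matrix_matrix_mult_def transpose_def vec_lambda_beta sum_distrib_right
    by (subst sum.swap) (simp add: mult_ac)
  \<comment> \<open>The factor 2 offsets the division by 2 in \<open>sym_tensor\<close>.\<close>
  let ?t = "\<lambda>a b. sym_tensor (\<chi> _. 2 * Y $ a $ b) (M *v axis a 1) (N *v axis b 1)"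
  have "M ** Y ** transpose N + N ** Y ** transpose M = (\<Sum>a\<in>UNIV. \<Sum>b\<in>UNIV. ?t a b)"
  proof -
    have "(N ** Y ** transpose M) $ i $ j = (\<Sum>a\<in>UNIV. \<Sum>b\<in>UNIV. Y $ a $ b * (N $ i $ b * M $ j $ a))" for i j
      unfolding mult by (subst sum.swap) (simp add: Y[of _ _])
    moreover have "?t a b $ i $ j = Y $ a $ b * (M $ i $ a * N $ j $ b) + Y $ a $ b * (N $ i $ b * M $ j $ a)"
      for a b i j
      by (simp add: sym_tensor_def col field_simps)
    ultimately show ?thesis
      by (simp add: vec_eq_iff mult[of M N] sum.distrib)
  qed
  also have "\<dots> \<in> span (sym_tensors S T)"
  proof (intro span_sum span_base)
    fix a b
    show "?t a b \<in> sym_tensors S T" using assms(2,3) unfolding sym_tensors_def by blast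
  qed
  finally show ?thesis .
qed

lemma matrix_sub_ldistrib: "M ** (N - P) = M ** N - M ** (P :: complex ^ 'n ^ 'n)"
  by (simp add: vec_eq_iff matrix_matrix_mult_def right_diff_distrib sum_subtractf)

lemma matrix_sub_rdistrib: "(N - P) ** M = N ** M - P ** (M :: complex ^ 'n ^ 'n)"
  by (simp add: vec_eq_iff matrix_matrix_mult_def left_diff_distrib sum_subtractf)

lemma matrix_eqI:
  fixes M N :: "complex ^ 'n ^ 'n"
  assumes "\<And>v. M *v v = N *v v"
  shows "M = N"
  using assms by (simp add: matrix_eq)

lemma transpose_diff: "transpose (M - N) = transpose M - transpose (N :: complex ^ 'n ^ 'n)"
  by (simp add: vec_eq_iff transpose_def)

text \<open>
  With \<open>E = 1 - P2\<close>, where \<open>P1\<close> and \<open>P2\<close> are projections onto \<open>S\<close> and \<open>S\<^sup>\<bottom>\<close>, invariance gives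
  \<open>E Y (1 - P1)\<^sup>T = 0\<close>, and \<open>Y = E Y P1\<^sup>T + (E Y P1\<^sup>T)\<^sup>T + P2 Y P2\<^sup>T\<close> follows.
\<close>

lemma invariant_in_span:
  fixes Y q :: "complex ^ 'n ^ 'n"
  assumes q: "nondeg q" and Y: "transpose Y = Y" and S: "vec.subspace S" "S \<subseteq> perp1 q S"
    and inv: "\<And>w. w \<in> perp1 q S \<Longrightarrow> (Y ** q) *v w \<in> perp1 q S"
  shows "Y \<in> span (sym_tensors UNIV S \<union> sym_tensors (perp1 q S) (perp1 q S))"
proof -
  obtain P1 where P1: "projection P1 S" using projection_exists[OF S(1)] .
  obtain P2 where P2: "projection P2 (perp1 q S)" using projection_exists[OF perp1_subspace] .
  define E where "E = mat 1 - P2"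
  have P21: "P2 ** P1 = P1"
    using P1 P2 S(2) by (intro matrix_eqI) (auto simp: projection_def simp flip: matrix_vector_mul_assoc)
  have "E ** Y ** transpose (mat 1 - P1) = 0"
  proof (rule matrix_eqI)
    fix y
    \<comment> \<open>The covector \<open>q *v z\<close> factors through \<open>mat 1 - P1\<close>
      and thus annihilates S, so z lies in the orthogonal and invariance applies to it.\<close>
    define z where "z = matrix_inv q *v (transpose (mat 1 - P1) *v y)"
    have qz: "q *v z = transpose (mat 1 - P1) *v y"
      unfolding z_def by (rule matrix_inv_vec(1)[OF nondeg_invertible[OF q]])
    have "pairing q u z = 0" if "u \<in> S" for u
    proof -
      have "pairing q u z = (\<Sum>i\<in>UNIV. u $ i * (transpose (mat 1 - P1) *v y) $ i)"
        unfolding pairing_eq qz ..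
      also have "\<dots> = pairing (mat 1) u (transpose (mat 1 - P1) *v y)"
        unfolding pairing_eq by simp
      also have "\<dots> = pairing (mat 1) ((mat 1 - P1) *v u) y"
        using pairing_vec[of "mat 1" "mat 1" u "transpose (mat 1 - P1)" y]
          pairing_vec[of "mat 1" "mat 1 - P1" u "mat 1" y] by (simp add: transpose_mat)
      also have "(mat 1 - P1) *v u = 0"
        using P1 that by (simp add: projection_def matrix_vector_mult_diff_rdistrib)
      finally show ?thesis by (simp add: pairing_0)
    qed
    then have "z \<in> perp1 q S" by (simp add: perp1_def)
    then have "(Y ** q) *v z \<in> perp1 q S" by (rule inv)
    then have "E *v ((Y ** q) *v z) = 0"
      using P2 by (simp add: projection_def E_def matrix_vector_mult_diff_rdistrib)
    then show "(E ** Y ** transpose (mat 1 - P1)) *v y = 0 *v y"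
      by (simp add: qz flip: matrix_vector_mul_assoc)
  qed
  then have EY: "E ** Y = E ** Y ** transpose P1"
    by (simp add: transpose_diff transpose_mat matrix_sub_ldistrib)
  have EP1: "E ** P1 = 0" by (simp add: E_def matrix_sub_rdistrib P21)
  have "E ** Y ** transpose P2 = E ** Y ** transpose P1 ** transpose P2" using EY by simp
  also have "\<dots> = E ** Y ** transpose (P2 ** P1)" by (simp add: matrix_transpose_mul matrix_mul_assoc)
  finally have 1: "E ** Y ** transpose P2 = E ** Y ** transpose P1" by (simp add: P21)
  have "E ** Y ** transpose E = E ** Y ** transpose P1 ** transpose E" using EY by simp
  also have "\<dots> = E ** Y ** transpose (E ** P1)" by (simp add: matrix_transpose_mul matrix_mul_assoc)
  finally have 2: "E ** Y ** transpose E = 0" by (simp add: EP1 transpose_def zero_vec_def[symmetric])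
  have 3: "E ** Y ** transpose E = E ** Y - E ** Y ** transpose P2"
    by (simp add: E_def transpose_diff transpose_mat matrix_sub_ldistrib)
  have 4: "E ** Y = Y - P2 ** Y" by (simp add: E_def matrix_sub_rdistrib)
  have 5: "P2 ** Y ** transpose E = P2 ** Y - P2 ** Y ** transpose P2"
    by (simp add: E_def transpose_diff transpose_mat matrix_sub_ldistrib)
  have "transpose (E ** Y ** transpose P2) = P2 ** Y ** transpose E"
    by (simp add: matrix_transpose_mul Y matrix_mul_assoc)
  moreover have "transpose (E ** Y ** transpose P1) = P1 ** Y ** transpose E"
    by (simp add: matrix_transpose_mul Y matrix_mul_assoc)
  ultimately have 6: "P2 ** Y ** transpose E = P1 ** Y ** transpose E" using 1 by simp
  \<comment> \<open>The last product is doubled and halved to give it the symmetrized shape of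
    \<open>sym_sum_in_span\<close>.\<close>
  have dec: "Y = (E ** Y ** transpose P1 + P1 ** Y ** transpose E) +
      (1 / 2) *\<^sub>R (P2 ** Y ** transpose P2 + P2 ** Y ** transpose P2)"
  proof -
    have "Y = E ** Y + P2 ** Y" using 4 by simp
    also have "P2 ** Y = P1 ** Y ** transpose E + P2 ** Y ** transpose P2" using 5 6 by (simp add: algebra_simps)
    also have "E ** Y = E ** Y ** transpose P1" by (rule EY)
    finally show ?thesis by (simp add: scaleR_2[symmetric] add.assoc)
  qed
  have 7: "E ** Y ** transpose P1 + P1 ** Y ** transpose E \<in> span (sym_tensors UNIV S)"
    using P1 by (intro sym_sum_in_span Y) (auto simp: projection_def)
  have 8: "P2 ** Y ** transpose P2 + P2 ** Y ** transpose P2 \<in> span (sym_tensors (perp1 q S) (perp1 q S))"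
    using P2 by (intro sym_sum_in_span Y) (auto simp: projection_def)
  show ?thesis
    by (subst dec) (rule span_add[OF subsetD[OF span_mono 7] span_scale[OF subsetD[OF span_mono 8]]];
      rule Un_upper1 Un_upper2)
qed

section \<open>The Higgs field, filtrations, and the criteria for semistability and
  stability\<close>

locale higgs_bundle = quadratic_bundle A W Q
  for A :: "('x::t2_space) atlas" and W :: "('x, 'n::finite) vbundle" and Q +
  fixes L :: "('x, 1) vbundle" and \<psi> :: "'x \<Rightarrow> complex ^ 'n ^ 'n"
  assumes field: "hol_section_LS2 A L W \<psi>"
begin

abbreviation \<theta> :: "'x \<Rightarrow> complex ^ 'n ^ 'n" where
  "\<theta> x \<equiv> \<psi> x ** Q x"

lemma psi_sym: "transpose (\<psi> x) = \<psi> x"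
  using field unfolding hol_section_LS2_def by blast

text \<open>This is the symmetry of \<open>\<psi> x\<close> seen through Q; it transports invariance
  to orthogonals.\<close>

lemma adj_theta: "adj (Q x) (\<theta> x) = \<theta> x"
proof -
  have "transpose (Q x) = Q x" using nondeg[of x] by (simp add: nondeg_def)
  then have "adj (Q x) (\<theta> x) = matrix_inv (Q x) ** Q x ** \<psi> x ** Q x"
    by (simp add: adj_def matrix_transpose_mul psi_sym matrix_mul_assoc)
  then show ?thesis using matrix_inv(2)[OF nondeg_invertible[OF nondeg[of x]]] by simp
qed

lemma in_H0: "\<psi> \<in> H0 A L W N \<longleftrightarrow> (\<forall>x. \<psi> x \<in> N x)"
  by (simp add: H0_def field)

lemma psi_invariantD: "psi_invariant Q \<psi> S \<Longrightarrow> w \<in> S x \<Longrightarrow> \<theta> x *v w \<in> S x"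
  by (simp add: psi_invariant_def)

lemma psi_invariant_perp:
  assumes "psi_invariant Q \<psi> S"
  shows "psi_invariant Q \<psi> (perp Q S)"
  unfolding psi_invariant_def perp_eq perp1_def
proof safe
  fix x w u assume w: "\<forall>u\<in>S x. pairing (Q x) u w = 0" and "u \<in> S x"
  then have "\<theta> x *v u \<in> S x" using psi_invariantD[OF assms] by blast
  with w show "pairing (Q x) u (\<theta> x *v w) = 0"
    by (simp add: pairing_adj(2)[OF nondeg] adj_theta)
qed

lemma zero_subbundle: "hol_subbundle A W zero_sub"
  unfolding hol_subbundle_def using zero_frame by blast

lemma perp_zero: "perp Q zero_sub = whole_sub"
  by (simp add: fun_eq_iff perp_eq perp1_0)

lemma perp_whole: "perp Q whole_sub = zero_sub"
  by (simp add: fun_eq_iff perp_eq perp1_UNIV[OF nondeg])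

lemma whole_subbundle: "hol_subbundle A W whole_sub"
  using subbundle_perp[OF zero_subbundle] by (simp add: perp_zero)

text \<open>Index types are non-empty, so W has positive rank.\<close>

lemma zero_neq_whole: "(zero_sub :: 'x \<Rightarrow> (complex ^ 'n) set) \<noteq> whole_sub"
proof
  assume "(zero_sub :: 'x \<Rightarrow> (complex ^ 'n) set) = whole_sub"
  from fun_cong[OF this] have "(axis undefined 1 :: complex ^ 'n) \<in> {0}" by simp
  then show False by (simp add: axis_eq_0_iff)
qed

lemma perp_eq_whole: "hol_subbundle A W S \<Longrightarrow> perp Q S = whole_sub \<longleftrightarrow> S = zero_sub"
  using perp_perp[of S] by (auto simp: perp_whole perp_zero)

lemma perp_eq_zero: "hol_subbundle A W S \<Longrightarrow> perp Q S = zero_sub \<longleftrightarrow> S = whole_sub"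
  using perp_perp[of S] by (auto simp: perp_whole perp_zero)

lemma isotropic_iff: "isotropic Q S \<longleftrightarrow> S \<le> perp Q S"
  by (simp add: isotropic_def le_fun_def)

lemma coisotropic_iff: "coisotropic Q S \<longleftrightarrow> perp Q S \<le> S"
  by (simp add: coisotropic_def le_fun_def)

lemma isotropic_neq_whole:
  assumes "isotropic Q S"
  shows "S \<noteq> whole_sub"
proof
  assume S: "S = whole_sub"
  have "S x \<subseteq> {0}" for x using assms unfolding isotropic_def S perp_whole by simp
  then have "zero_sub = S" unfolding S by auto
  with S zero_neq_whole show False by simp
qed

lemma deg_perp': "hol_subbundle A W S \<Longrightarrow> S \<noteq> zero_sub \<Longrightarrow> S \<noteq> whole_sub \<Longrightarrow> deg A W (perp Q S) = deg A W S"
  by (rule deg_perp) (simp_all add: perp_eq_zero)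

subsection \<open>Filtrations\<close>

context
  fixes k and F :: "nat \<Rightarrow> 'x \<Rightarrow> (complex ^ 'n) set"
  assumes F: "q_filtration A W Q k F"
begin

lemma filtration_0: "F 0 = zero_sub" and filtration_k: "F k = whole_sub"
  and filtration_sub: "j \<le> k \<Longrightarrow> hol_subbundle A W (F j)"
  and filtration_less: "j < k \<Longrightarrow> F j < F (Suc j)"
  and filtration_perp: "j \<le> k \<Longrightarrow> F j = perp Q (F (k - j))"
  using F unfolding q_filtration_def by blast+

lemma filtration_k_pos: "0 < k"
proof (rule ccontr)
  assume "\<not> 0 < k"
  then show False using filtration_0 filtration_k zero_neq_whole by simp
qed

lemma filtration_mono: "i \<le> j \<Longrightarrow> j \<le> k \<Longrightarrow> F i \<le> F j"
proof (induction j rule: dec_induct)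
  case (step n)
  then have "F i \<le> F n" by simp
  also have "F n \<le> F (Suc n)" using step.prems by (intro less_imp_le filtration_less) simp
  finally show ?case .
qed simp

lemma filtration_strict: "i < j \<Longrightarrow> j \<le> k \<Longrightarrow> F i < F j"
  by (rule less_le_trans[OF filtration_less filtration_mono]) auto

lemma filtration_mono_mem: "i \<le> j \<Longrightarrow> j \<le> k \<Longrightarrow> w \<in> F i x \<Longrightarrow> w \<in> F j x"
  using le_funD[OF filtration_mono, of i j x] by auto

lemma filtration_proper: "0 < j \<Longrightarrow> j < k \<Longrightarrow> F j \<noteq> zero_sub \<and> F j \<noteq> whole_sub"
  using filtration_strict[of 0 j] filtration_strict[of j k] by (auto simp: filtration_0 filtration_k)

lemma filtration_subspace: "j \<le> k \<Longrightarrow> vec.subspace (F j x)"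
  by (rule subbundle_subspace[OF filtration_sub])

lemma filtration_isotropic: "2 * j \<le> k \<Longrightarrow> isotropic Q (F j)"
  unfolding isotropic_iff using filtration_mono[of j "k - j"] filtration_perp[of "k - j"] by simp

text \<open>Either \<open>F j\<close> or its orthogonal is isotropic.\<close>

lemma filtration_half:
  assumes "0 < j" "j < k" "psi_invariant Q \<psi> (F j)"
  shows "\<exists>S. hol_subbundle A W S \<and> isotropic Q S \<and> psi_invariant Q \<psi> S \<and>
    S \<noteq> zero_sub \<and> S \<noteq> whole_sub \<and> deg A W S = deg A W (F j)"
proof (cases "2 * j \<le> k")
  case True
  then show ?thesis
    using assms filtration_sub[of j] filtration_isotropic[of j] filtration_proper[of j]
    by (intro exI[of _ "F j"]) simp
next
  case False
  have e: "F (k - j) = perp Q (F j)" using filtration_perp[of "k - j"] assms(2) by simp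
  have "deg A W (F (k - j)) = deg A W (F j)"
    unfolding e using filtration_sub[of j] filtration_proper[of j] assms by (intro deg_perp') auto
  moreover have "psi_invariant Q \<psi> (F (k - j))" unfolding e by (rule psi_invariant_perp[OF assms(3)])
  ultimately show ?thesis
    using False assms filtration_sub[of "k - j"] filtration_isotropic[of "k - j"] filtration_proper[of "k - j"]
    by (intro exI[of _ "F (k - j)"]) simp
qed

context
  fixes lam assumes lam: "lam \<in> Weights k"
begin

lemma weights_mono: "i \<le> j \<Longrightarrow> 1 \<le> i \<Longrightarrow> j \<le> k \<Longrightarrow> lam i \<le> lam j"
proof (induction j rule: dec_induct)
  case (step n)
  then have "lam n \<le> lam (n + 1)" using lam unfolding Weights_def by auto
  with step show ?case by simp
qed simp

lemma weights_sym: "1 \<le> i \<Longrightarrow> i \<le> k \<Longrightarrow> lam (k - i + 1) = - lam i"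
  using lam unfolding Weights_def by (simp add: add_eq_0_iff)

text \<open>Let u in \<open>F i\<close> and v in \<open>F j\<close> be the factors of a simple
  tensor and w in \<open>F m\<close>. If v pairs non-trivially with w, then j > k - m, because
  \<open>F m\<close> is orthogonal to \<open>F (k - m)\<close>. Hence \<open>lam j\<close> is at
  least - \<open>lam m\<close>, so \<open>lam i\<close> is at most \<open>lam m\<close>, and the
  jump after m gives i \<le> m.\<close>

lemma jump_invariant:
  assumes m: "1 \<le> m" "m < k" "lam m < lam (m + 1)" and N: "\<psi> \<in> H0 A L W (N_bundle k F lam)"
  shows "psi_invariant Q \<psi> (F m)"
  unfolding psi_invariant_def
proof (intro allI ballI)
  fix x w assume w: "w \<in> F m x"
  have sub: "vec.subspace (F m x)" by (rule filtration_subspace) (use m in simp)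
  have "\<psi> x \<in> N_bundle k F lam x" using N in_H0 by blast
  then show "\<theta> x *v w \<in> F m x"
    unfolding N_bundle_def
  proof (rule span_sym_tensor_maps_into[OF _ sub _ w])
    fix Y w
    assume Y: "Y \<in> \<Union> {sym_tensors (F i x) (F j x) |i j. i \<in> {1..k} \<and> j \<in> {1..k} \<and> lam i + lam j \<le> 0}"
      and w: "w \<in> F m x"
    obtain i j where ij: "i \<in> {1..k}" "j \<in> {1..k}" "lam i + lam j \<le> 0" "Y \<in> sym_tensors (F i x) (F j x)"
      using Y by blast
    obtain l u v where uv: "Y = sym_tensor l u v" "u \<in> F i x" "v \<in> F j x"
      using ij(4) unfolding sym_tensors_def by blast
    have key: "pairing (Q x) b w *s a \<in> F m x"
      if "i \<in> {1..k}" "j \<in> {1..k}" "lam i + lam j \<le> 0" "a \<in> F i x" "b \<in> F j x" for i j a b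
    proof (cases "pairing (Q x) b w = 0")
      case True
      then show ?thesis using vec.subspace_0[OF sub] by simp
    next
      case False
      have "\<not> j \<le> k - m"
      proof
        assume "j \<le> k - m"
        then have "b \<in> F (k - m) x" using filtration_mono_mem[OF _ _ that(5)] by simp
        moreover have "w \<in> perp Q (F (k - m)) x" using w filtration_perp[of m] m by simp
        ultimately show False using False by (simp add: perp_def)
      qed
      then have "lam (k - m + 1) \<le> lam j" using that(2) m by (intro weights_mono) auto
      then have "lam i \<le> lam m" using weights_sym[of m] m that(3) by simp
      moreover have "lam (m + 1) \<le> lam i" if "m < i" using that \<open>i \<in> {1..k}\<close> by (intro weights_mono) auto
      ultimately have "i \<le> m" using m(3) by (cases "m < i") auto
      then have "a \<in> F m x" using filtration_mono_mem[OF _ _ that(4)] m by simp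
      then show ?thesis by (rule vec.subspace_scale[OF sub])
    qed
    have 1: "pairing (Q x) v w *s u \<in> F m x" by (rule key[OF ij(1-3) uv(2,3)])
    have 2: "pairing (Q x) u w *s v \<in> F m x"
      by (rule key[OF ij(2,1) _ uv(3,2)]) (use ij(3) in simp)
    show "(Y ** Q x) *v w \<in> F m x"
      unfolding uv(1) sym_tensor_vec by (rule vec.subspace_scale[OF sub vec.subspace_add[OF sub 1 2]])
  qed
qed

end
end

text \<open>Besides the degree, the conclusion records \<open>lam 1 \<noteq> 0\<close> for stability
  and strict monotonicity of the weights for polystability.\<close>

lemma isotropic_filtration:
  assumes S: "hol_subbundle A W S" "isotropic Q S" "psi_invariant Q \<psi> S" "S \<noteq> zero_sub"
  shows "\<exists>k F lam. q_filtration A W Q k F \<and> lam \<in> Weights k \<and> 2 \<le> k \<and> F 1 = S \<and> lam 1 \<noteq> 0 \<and>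
    (\<forall>i. 1 \<le> i \<and> i < k \<longrightarrow> lam i < lam (i + 1)) \<and> \<psi> \<in> H0 A L W (N_bundle k F lam) \<and>
    weighted_deg A W k F lam = - 2 * deg A W S"
proof -
  \<comment> \<open>Steps of a filtration must be distinct, so the middle step is dropped when S is
    Lagrangian.\<close>
  define k :: nat where "k = (if perp Q S = S then 2 else 3)"
  define F where "F j = (if j = 0 then zero_sub else if j = 1 then S else if j = k then whole_sub else perp Q S)" for j
  \<comment> \<open>The weights are -1, 1 for two steps and -1, 0, 1 for three.\<close>
  define lam :: "nat \<Rightarrow> real" where "lam j = (if j = 1 then - 1 else if j = k then 1 else 0)" for j
  have k: "k = 2 \<or> k = 3" by (simp add: k_def)
  have whole: "S \<noteq> whole_sub" by (rule isotropic_neq_whole[OF S(2)])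
  have 0: "zero_sub \<le> S"
    using vec.subspace_0[OF subbundle_subspace[OF S(1)]] by (simp add: le_fun_def)
  have lt: "zero_sub < S" using 0 S(4) by (simp add: less_le)
  have lt2: "S < whole_sub" "perp Q S < whole_sub"
    using whole S(4) perp_eq_whole[OF S(1)] by (simp_all add: less_le le_fun_def)
  have iso: "S \<le> perp Q S" using S(2) by (simp add: isotropic_iff)
  have pp: "perp Q (perp Q S) = S" by (rule perp_perp[OF S(1)])
  have sub: "hol_subbundle A W (F j)" for j
    using S(1) zero_subbundle whole_subbundle subbundle_perp[OF S(1)] by (simp add: F_def)
  have k2: "perp Q S = S" if "k = 2" using that by (simp add: k_def split: if_splits)
  have k3: "S < perp Q S" if "k = 3" using that iso by (simp add: k_def less_le split: if_splits)
  have less: "F j < F (Suc j)" if j: "j < k" for j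
  proof -
    consider "k = 2" "j = 0" | "k = 2" "j = 1" | "k = 3" "j = 0" | "k = 3" "j = 1" | "k = 3" "j = 2"
      using j k by linarith
    then show ?thesis by cases (simp_all add: F_def lt lt2 k3)
  qed
  have perpF: "F j = perp Q (F (k - j))" if j: "j \<le> k" for j
  proof -
    consider "k = 2" "j = 0" | "k = 2" "j = 1" | "k = 2" "j = 2"
      | "k = 3" "j = 0" | "k = 3" "j = 1" | "k = 3" "j = 2" | "k = 3" "j = 3"
      using j k by linarith
    then show ?thesis by cases (simp_all add: F_def perp_zero perp_whole pp k2)
  qed
  have "q_filtration A W Q k F"
    unfolding q_filtration_def
  proof (intro conjI allI impI sub less perpF)
    show "F 0 = zero_sub" "F k = whole_sub" using k by (auto simp: F_def)
  qed
  moreover have "lam \<in> Weights k"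
  proof -
    have "lam i \<le> lam (i + 1)" if "1 \<le> i" "i < k" for i using k that by (auto simp: lam_def)
    moreover have "lam i + lam (k - i + 1) = 0" if "i \<in> {1..k}" for i
    proof -
      have "i = 1 \<or> i = 2 \<or> i = 3" using that k by auto
      then show ?thesis using k that by (auto simp: lam_def)
    qed
    ultimately show ?thesis by (simp add: Weights_def)
  qed
  moreover have "\<forall>i. 1 \<le> i \<and> i < k \<longrightarrow> lam i < lam (i + 1)" using k by (auto simp: lam_def)
  moreover have "\<psi> x \<in> N_bundle k F lam x" for x
  proof -
    have "\<psi> x \<in> span (sym_tensors UNIV (S x) \<union> sym_tensors (perp1 (Q x) (S x)) (perp1 (Q x) (S x)))"
      using psi_invariantD[OF psi_invariant_perp[OF S(3)]] iso
      by (intro invariant_in_span nondeg psi_sym subbundle_subspace[OF S(1)]) (simp_all add: perp_eq le_fun_def)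
    moreover have "sym_tensors UNIV (S x) \<union> sym_tensors (perp1 (Q x) (S x)) (perp1 (Q x) (S x)) \<subseteq>
        \<Union> {sym_tensors (F i x) (F j x) |i j. i \<in> {1..k} \<and> j \<in> {1..k} \<and> lam i + lam j \<le> 0}"
    proof -
      \<comment> \<open>Both generating sets are admissible: W with S has total weight 0, and the
        orthogonal, which is step k - 1 in either case, has weight 0 or -1.\<close>
      have "sym_tensors UNIV (S x) = sym_tensors (F k x) (F 1 x)" "k \<in> {1..k}" "1 \<in> {1..k}" "lam k + lam 1 \<le> 0"
        using k by (auto simp: F_def lam_def)
      moreover have "F (k - 1) x = perp Q S x" "k - 1 \<in> {1..k}" "lam (k - 1) + lam (k - 1) \<le> 0"
        using k k2 by (auto simp: F_def lam_def)
      then have "sym_tensors (perp1 (Q x) (S x)) (perp1 (Q x) (S x)) = sym_tensors (F (k - 1) x) (F (k - 1) x)"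
        "k - 1 \<in> {1..k}" "lam (k - 1) + lam (k - 1) \<le> 0"
        by (simp_all add: perp_eq)
      ultimately show ?thesis by blast
    qed
    ultimately show ?thesis unfolding N_bundle_def using span_mono by blast
  qed
  then have "\<psi> \<in> H0 A L W (N_bundle k F lam)" by (simp add: in_H0)
  moreover have "weighted_deg A W k F lam = - 2 * deg A W S"
  proof -
    \<comment> \<open>Either one jump of size 2, or two jumps of size 1 at subbundles of equal
      degree.\<close>
    have "{1..k - 1} = {1} \<or> k = 3 \<and> {1..k - 1} = {1, 2}" using k by auto
    then show ?thesis
      using k deg_perp'[OF S(1,4) whole] by (auto simp: weighted_deg_def F_def lam_def)
  qed
  moreover have "2 \<le> k" "F 1 = S" "lam 1 \<noteq> 0" using k by (auto simp: F_def lam_def)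
  ultimately show ?thesis by (intro exI[of _ k] exI[of _ F] exI[of _ lam]) simp
qed

subsection \<open>Semistability and stability\<close>

definition slope_condition :: bool where
  "slope_condition \<longleftrightarrow>
     (\<forall>S. hol_subbundle A W S \<and> isotropic Q S \<and> psi_invariant Q \<psi> S \<longrightarrow> deg A W S \<le> 0)"

text \<open>At a jump the step is invariant and has the degree of an isotropic invariant subbundle,
  so both factors are non-positive; otherwise the first factor is zero.\<close>

lemma weighted_deg_term:
  assumes ss: slope_condition and F: "q_filtration A W Q k F" and lam: "lam \<in> Weights k"
    and N: "\<psi> \<in> H0 A L W (N_bundle k F lam)" and j: "1 \<le> j" "j < k"
  shows "0 \<le> (lam j - lam (j + 1)) * deg A W (F j)"
proof (cases "lam j < lam (j + 1)")
  case True
  have "psi_invariant Q \<psi> (F j)" by (rule jump_invariant[OF F lam j True N])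
  then obtain S where S: "hol_subbundle A W S \<and> isotropic Q S \<and> psi_invariant Q \<psi> S"
    "deg A W S = deg A W (F j)"
    using filtration_half[OF F, of j] j by auto
  have "deg A W (F j) \<le> 0" using ss[unfolded slope_condition_def, rule_format, OF S(1)] S(2) by simp
  with True show ?thesis by (simp add: mult_nonpos_nonpos)
next
  case False
  moreover have "lam j \<le> lam (j + 1)" using weights_mono[OF F lam, of j "j + 1"] j by simp
  ultimately show ?thesis by simp
qed

lemma semistable_iff: "semistable A L W Q \<psi> \<longleftrightarrow> slope_condition"
proof
  assume ss: "semistable A L W Q \<psi>"
  show slope_condition
    unfolding slope_condition_def
  proof (intro allI impI, elim conjE)
    fix S assume S: "hol_subbundle A W S" "isotropic Q S" "psi_invariant Q \<psi> S"
    show "deg A W S \<le> 0"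
    proof (cases "S = zero_sub")
      case True
      then show ?thesis by (simp add: deg_zero)
    next
      case False
      obtain k F lam where F: "q_filtration A W Q k F" "lam \<in> Weights k" "\<psi> \<in> H0 A L W (N_bundle k F lam)"
        "weighted_deg A W k F lam = - 2 * deg A W S"
        using isotropic_filtration[OF S False] by auto
      have "0 \<le> weighted_deg A W k F lam"
        using F(1-3) by (intro ss[unfolded semistable_def, rule_format] conjI)
      with F(4) show ?thesis by simp
    qed
  qed
next
  assume ss: slope_condition
  show "semistable A L W Q \<psi>"
    unfolding semistable_def weighted_deg_def
  proof (intro allI impI sum_nonneg, elim conjE)
    fix k F lam j
    assume "q_filtration A W Q k F" "lam \<in> Weights k" "\<psi> \<in> H0 A L W (N_bundle k F lam)" "j \<in> {1..k - 1}"
    then show "0 \<le> (lam j - lam (j + 1)) * deg A W (F j)"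
      by (intro weighted_deg_term[OF ss]) auto
  qed
qed

lemma stable_iff:
  "stable A L W Q \<psi> \<longleftrightarrow> semistable A L W Q \<psi> \<and>
     (\<forall>S. hol_subbundle A W S \<and> isotropic Q S \<and> psi_invariant Q \<psi> S \<and> S \<noteq> zero_sub \<and> S \<noteq> whole_sub \<longrightarrow>
        deg A W S < 0)"
proof (intro iffI conjI)
  assume st: "stable A L W Q \<psi>"
  then show "semistable A L W Q \<psi>" by (simp add: stable_def)
  show "\<forall>S. hol_subbundle A W S \<and> isotropic Q S \<and> psi_invariant Q \<psi> S \<and> S \<noteq> zero_sub \<and> S \<noteq> whole_sub \<longrightarrow>
        deg A W S < 0"
  proof (intro allI impI, elim conjE)
    fix S assume S: "hol_subbundle A W S" "isotropic Q S" "psi_invariant Q \<psi> S" "S \<noteq> zero_sub"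
    obtain k F lam where F: "q_filtration A W Q k F" "lam \<in> Weights k" "\<psi> \<in> H0 A L W (N_bundle k F lam)"
      "weighted_deg A W k F lam = - 2 * deg A W S" "2 \<le> k" "lam 1 \<noteq> 0"
      using isotropic_filtration[OF S] by auto
    have "\<exists>i\<in>{1..k}. lam i \<noteq> 0" using F(5,6) by (intro bexI[of _ 1]) auto
    with F(1-3) have "weighted_deg A W k F lam > 0"
      by (intro st[unfolded stable_def, THEN conjunct2, rule_format] conjI)
    with F(4) show "deg A W S < 0" by simp
  qed
next
  assume a: "semistable A L W Q \<psi> \<and>
     (\<forall>S. hol_subbundle A W S \<and> isotropic Q S \<and> psi_invariant Q \<psi> S \<and> S \<noteq> zero_sub \<and> S \<noteq> whole_sub \<longrightarrow>
        deg A W S < 0)"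
  then have ss: slope_condition by (simp add: semistable_iff)
  show "stable A L W Q \<psi>"
    unfolding stable_def
  proof (intro conjI allI impI, goal_cases)
    case 1
    with a show ?case by simp
  next
    case (2 k F lam)
    then have F: "q_filtration A W Q k F" "lam \<in> Weights k" "\<psi> \<in> H0 A L W (N_bundle k F lam)" by auto
    \<comment> \<open>Weights without a jump are constant, and antisymmetry makes a constant weight
      zero.\<close>
    have "\<exists>j. 1 \<le> j \<and> j < k \<and> lam j < lam (j + 1)"
    proof (rule ccontr)
      assume no: "\<not> ?thesis"
      have le: "lam i \<le> lam 1" if "1 \<le> i" "i \<le> k" for i
        using that
      proof (induction i rule: dec_induct)
        case (step n)
        then have "\<not> lam n < lam (n + 1)" using no by auto
        with step show ?case by simp
      qed simp
      have "1 \<le> k" using filtration_k_pos[OF F(1)] by simp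
      have "lam k = - lam 1" using weights_sym[OF F(1,2), of 1] \<open>1 \<le> k\<close> by simp
      moreover have "lam k = lam 1"
        using le[of k] weights_mono[OF F(1,2), of 1 k] \<open>1 \<le> k\<close> by simp
      ultimately have "lam 1 = 0" by simp
      moreover have "lam i = lam 1" if "i \<in> {1..k}" for i
        using le[of i] weights_mono[OF F(1,2), of 1 i] that by simp
      ultimately show False using 2 by auto
    qed
    then obtain j where j: "1 \<le> j" "j < k" "lam j < lam (j + 1)" by blast
    have "psi_invariant Q \<psi> (F j)" by (rule jump_invariant[OF F(1,2) j F(3)])
    then obtain S where S: "hol_subbundle A W S \<and> isotropic Q S \<and> psi_invariant Q \<psi> S \<and> S \<noteq> zero_sub \<and> S \<noteq> whole_sub"
      "deg A W S = deg A W (F j)"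
      using filtration_half[OF F(1), of j] j by auto
    have "deg A W (F j) < 0" using a[THEN conjunct2, rule_format, OF S(1)] S(2) by simp
    with j have "0 < (lam j - lam (j + 1)) * deg A W (F j)" by (simp add: mult_neg_neg)
    then show ?case
      unfolding weighted_deg_def using j weighted_deg_term[OF ss F(1-3)]
      by (intro sum_pos2[of _ j]) auto
  qed
qed

end

section \<open>Complements from splittings\<close>

lemma coset_iff: "w \<in> coset T u \<longleftrightarrow> w - u \<in> T"
proof
  assume "w - u \<in> T"
  moreover have "w = u + (w - u)" by simp
  ultimately show "w \<in> coset T u" unfolding coset_def by (rule image_eqI[rotated])
qed (auto simp: coset_def)

lemma coset_eq_iff:
  assumes "vec.subspace T"
  shows "coset T u = coset T v \<longleftrightarrow> u - v \<in> T"
proof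
  assume "coset T u = coset T v"
  moreover have "u \<in> coset T u" using vec.subspace_0[OF assms] by (simp add: coset_iff)
  ultimately show "u - v \<in> T" by (simp add: coset_iff)
next
  assume uv: "u - v \<in> T"
  have "w - u \<in> T \<longleftrightarrow> w - v \<in> T" for w
    using vec.subspace_add[OF assms _ uv, of "w - u"] vec.subspace_diff[OF assms _ uv, of "w - v"] by auto
  then show "coset T u = coset T v" by (auto simp: coset_iff)
qed

lemma coset_0: "coset T 0 = T"
  by (simp add: coset_def)

lemma coset_eq_self: "vec.subspace T \<Longrightarrow> coset T u = T \<longleftrightarrow> u \<in> T"
  using coset_eq_iff[of T u 0] by (simp add: coset_0)

lemma quot_add_coset:
  assumes "vec.subspace T"
  shows "quot_add (coset T u) (coset T v) = coset T (u + v)"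
proof (intro equalityI subsetI)
  fix w assume "w \<in> quot_add (coset T u) (coset T v)"
  then obtain c d where "w = c + d" "c - u \<in> T" "d - v \<in> T"
    unfolding quot_add_def coset_iff by blast
  then show "w \<in> coset T (u + v)"
    using vec.subspace_add[OF assms, of "c - u" "d - v"] by (simp add: coset_iff add_diff_add)
next
  fix w assume "w \<in> coset T (u + v)"
  then have "w = (w - v) + v" "w - v \<in> coset T u" "v \<in> coset T v"
    using vec.subspace_0[OF assms] by (simp_all add: coset_iff algebra_simps)
  then show "w \<in> quot_add (coset T u) (coset T v)" unfolding quot_add_def by blast
qed

lemma quot_scale_coset:
  assumes "vec.subspace T"
  shows "quot_scale T a (coset T u) = coset T (a *s u)"
proof (intro equalityI subsetI)
  fix w assume "w \<in> quot_scale T a (coset T u)"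
  then obtain c t where c: "w = a *s c + t" "c - u \<in> T" "t \<in> T"
    unfolding quot_scale_def coset_iff by blast
  have "w - a *s u = a *s (c - u) + t" unfolding c(1) by (simp add: vec.scale_right_diff_distrib)
  then show "w \<in> coset T (a *s u)"
    using vec.subspace_add[OF assms vec.subspace_scale[OF assms c(2), of a] c(3)] by (simp only: coset_iff)
next
  fix w assume "w \<in> coset T (a *s u)"
  then have "w = a *s u + (w - a *s u)" "u \<in> coset T u" "w - a *s u \<in> T"
    using vec.subspace_0[OF assms] by (simp_all add: coset_iff)
  then show "w \<in> quot_scale T a (coset T u)" unfolding quot_scale_def by blast
qed

section \<open>The complement of the first step cut out by a splitting of a filtration\<close>

context higgs_bundle
begin

context
  fixes k and F :: "nat \<Rightarrow> 'x \<Rightarrow> (complex ^ 'n) set" and \<Phi>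
  assumes F: "q_filtration A W Q k F" and \<Phi>: "graded_iso A W k F \<Phi>"
begin

lemma graded_bij: "bij_betw (\<Phi> x) UNIV (graded_fibre k F x)"
  by (rule \<Phi>[unfolded graded_iso_def, THEN conjunct1, THEN spec, THEN conjunct1])

lemma graded_add: "i \<in> {1..k} \<Longrightarrow> \<Phi> x (u + v) i = quot_add (\<Phi> x u i) (\<Phi> x v i)"
  by (rule \<Phi>[unfolded graded_iso_def, THEN conjunct1, THEN spec, THEN conjunct2, THEN bspec,
        THEN spec, THEN spec, THEN spec, THEN conjunct1])

lemma graded_scale: "i \<in> {1..k} \<Longrightarrow> \<Phi> x (a *s u) i = quot_scale (F (i - 1) x) a (\<Phi> x u i)"
  by (rule \<Phi>[unfolded graded_iso_def, THEN conjunct1, THEN spec, THEN conjunct2, THEN bspec,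
        THEN spec, THEN spec, THEN spec, THEN conjunct2])

lemma graded_hol: "open U \<Longrightarrow> hol_section A W U s \<Longrightarrow> i \<in> {1..k} \<Longrightarrow>
    hol_quot_section A W (F i) (F (i - 1)) U (\<lambda>x. \<Phi> x (s x) i)"
  using \<Phi>[unfolded graded_iso_def, THEN conjunct2, THEN conjunct1, THEN spec, THEN spec, of U s] by simp

lemma graded_image: "j \<le> k \<Longrightarrow>
    \<Phi> x ` F j x = {c \<in> graded_fibre k F x. \<forall>i\<in>{j<..k}. c i = F (i - 1) x}"
  by (rule \<Phi>[unfolded graded_iso_def, THEN conjunct2, THEN conjunct2, THEN spec, THEN spec, THEN mp])

lemma graded_in: "\<Phi> x w \<in> graded_fibre k F x"
  using graded_bij[of x] by (auto simp: bij_betw_def)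

lemma graded_coset:
  assumes "i \<in> {1..k}"
  obtains v where "v \<in> F i x" "\<Phi> x w i = coset (F (i - 1) x) v"
  using graded_in[of x w] assms unfolding graded_fibre_def by (auto dest: PiE_mem)

lemma graded_inj:
  assumes "\<And>i. i \<in> {1..k} \<Longrightarrow> \<Phi> x u i = \<Phi> x v i"
  shows "u = v"
proof -
  have "\<Phi> x u = \<Phi> x v"
    using graded_in[of x u] graded_in[of x v] assms unfolding graded_fibre_def by (rule PiE_ext)
  then show ?thesis using graded_bij[of x] by (auto simp: bij_betw_def inj_on_def)
qed

lemma filtration_sub': "i \<in> {1..k} \<Longrightarrow> vec.subspace (F (i - 1) x)"
  by (rule filtration_subspace[OF F]) auto

lemma graded_0:
  assumes "i \<in> {1..k}"
  shows "\<Phi> x 0 i = F (i - 1) x"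
proof -
  obtain v where "\<Phi> x 0 i = coset (F (i - 1) x) v" using graded_coset[OF assms, of x 0] by metis
  then have "\<Phi> x (0 *s 0) i = coset (F (i - 1) x) (0 *s v)"
    using graded_scale[OF assms, of x 0 0] quot_scale_coset[OF filtration_sub'[OF assms]] by simp
  then show ?thesis by (simp add: coset_0)
qed

text \<open>Surjectivity of \<open>\<Phi> x\<close> lets each component of the image of w be lifted
  separately; additivity and injectivity identify w with the sum of the lifts.\<close>

lemma graded_decomposition:
  obtains d where "\<And>i. i \<in> {1..k} \<Longrightarrow> d i \<in> summand k F \<Phi> i x" "w = (\<Sum>i\<in>{1..k}. d i)"
    "\<And>i. i \<in> {1..k} \<Longrightarrow> \<Phi> x (d i) i = \<Phi> x w i"
proof -
  have "\<exists>d. \<forall>j\<in>{1..k}. \<Phi> x d j = (if j = i then \<Phi> x w i else F (j - 1) x)" if i: "i \<in> {1..k}" for i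
  proof -
    \<comment> \<open>The i-th component alone; \<open>F (j - 1) x\<close> is the zero of the j-th
      quotient.\<close>
    define c where "c = (\<lambda>j\<in>{1..k}. if j = i then \<Phi> x w i else F (j - 1) x)"
    have "c \<in> graded_fibre k F x"
      unfolding graded_fibre_def c_def
    proof (rule restrict_PiE_iff[THEN iffD2], rule ballI)
      fix j assume j: "j \<in> {1..k}"
      have "F (j - 1) x = coset (F (j - 1) x) 0" by (simp add: coset_0)
      moreover have "0 \<in> F j x" using j by (intro vec.subspace_0 filtration_subspace[OF F]) simp
      ultimately have 1: "F (j - 1) x \<in> coset (F (j - 1) x) ` F j x" by (rule image_eqI)
      obtain v where "v \<in> F j x" "\<Phi> x w j = coset (F (j - 1) x) v" using graded_coset[OF j, of x w] by metis
      then show "(if j = i then \<Phi> x w i else F (j - 1) x) \<in> coset (F (j - 1) x) ` F j x"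
        using 1 by auto
    qed
    then have "c \<in> range (\<Phi> x)" using bij_betw_imp_surj_on[OF graded_bij] by simp
    then obtain d where "\<Phi> x d = c" by auto
    then show ?thesis by (intro exI[of _ d]) (simp add: c_def)
  qed
  then have "\<forall>i\<in>{1..k}. \<exists>d. \<forall>j\<in>{1..k}. \<Phi> x d j = (if j = i then \<Phi> x w i else F (j - 1) x)" by blast
  from bchoice[OF this] obtain d where
    d: "\<forall>i\<in>{1..k}. \<forall>j\<in>{1..k}. \<Phi> x (d i) j = (if j = i then \<Phi> x w i else F (j - 1) x)" by blast
  have sum: "\<Phi> x (\<Sum>i\<in>I. d i) j = (if j \<in> I then \<Phi> x w j else F (j - 1) x)"
    if "finite I" "I \<subseteq> {1..k}" and j: "j \<in> {1..k}" for I j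
    using that(1,2)
  proof (induction I)
    case empty
    then show ?case using graded_0[OF j] by simp
  next
    case (insert i I)
    define T where "T = F (j - 1) x"
    have T: "vec.subspace T" unfolding T_def by (rule filtration_sub'[OF j])
    obtain v where v: "\<Phi> x w j = coset T v" using graded_coset[OF j, of x w] unfolding T_def by metis
    have T0: "T = coset T 0" by (simp add: coset_0)
    have di: "\<Phi> x (d i) j = coset T (if j = i then v else 0)"
      using d insert.prems j v T0 T_def by auto
    have dI: "\<Phi> x (\<Sum>i\<in>I. d i) j = coset T (if j \<in> I then v else 0)"
      using insert.IH insert.prems v T0 T_def by auto
    have "\<Phi> x (\<Sum>i\<in>insert i I. d i) j = quot_add (\<Phi> x (d i) j) (\<Phi> x (\<Sum>i\<in>I. d i) j)"
      using insert.hyps graded_add[OF j] by simp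
    also have "\<dots> = coset T ((if j = i then v else 0) + (if j \<in> I then v else 0))"
      unfolding di dI by (rule quot_add_coset[OF T])
    also have "\<dots> = (if j \<in> insert i I then \<Phi> x w j else F (j - 1) x)"
      using insert.hyps(2) v T0 T_def by auto
    finally show ?case .
  qed
  show thesis
  proof (rule that)
    show "d i \<in> summand k F \<Phi> i x" if "i \<in> {1..k}" for i
      using d that by (simp add: summand_def)
    show "\<Phi> x (d i) i = \<Phi> x w i" if "i \<in> {1..k}" for i
      using d that by simp
    show "w = (\<Sum>i\<in>{1..k}. d i)"
      by (rule graded_inj[of x]) (simp add: sum)
  qed
qed

text \<open>
  As \<open>F 0\<close> is zero, the first component of \<open>\<Phi>\<close> is an endomorphism of \<open>W\<close> with image \<open>F 1\<close>.
\<close>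

definition first_part :: "'x \<Rightarrow> complex ^ 'n \<Rightarrow> complex ^ 'n" where
  "first_part x w = (THE u. \<Phi> x w 1 = {u})"

lemma one_in: "1 \<in> {1..k}"
  using filtration_k_pos[OF F] by simp

lemma F0: "F (1 - 1) x = {0}"
  using filtration_0[OF F] by simp

lemma coset_zero: "coset {0} u = {u}"
  by (simp add: coset_def)

lemma first_part: "\<Phi> x w 1 = {first_part x w}" "first_part x w \<in> F 1 x"
proof -
  obtain v where v: "v \<in> F 1 x" "\<Phi> x w 1 = coset (F (1 - 1) x) v"
    using graded_coset[OF one_in, of x w] by metis
  then have *: "\<Phi> x w 1 = {v}" by (simp only: F0 coset_zero)
  then have "first_part x w = v" unfolding first_part_def by auto
  with v * show "\<Phi> x w 1 = {first_part x w}" "first_part x w \<in> F 1 x" by simp_all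
qed

lemma first_part_add: "first_part x (u + v) = first_part x u + first_part x v"
  using graded_add[OF one_in, of x u v] unfolding first_part(1) by (simp add: quot_add_def)

lemma first_part_scale: "first_part x (a *s u) = a *s first_part x u"
  using graded_scale[OF one_in, of x a u] unfolding first_part(1) F0 by (simp add: quot_scale_def)

lemma first_part_matrix: "matrix (first_part x) *v w = first_part x w"
  by (rule matrix_works) (simp add: Vector_Spaces.linear_iff vec.vector_space_axioms first_part_add first_part_scale)

lemma hol_end_first_part: "hol_end (\<lambda>x. matrix (first_part x))"
  unfolding hol_end_def first_part_matrix
proof safe
  fix U s assume U: "open U" "hol_section A W U s"
  show "hol_section A W U (\<lambda>x. first_part x (s x))"
  proof (rule hol_section_local[OF U(1)])
    fix x assume "x \<in> U"
    from graded_hol[OF U one_in, unfolded hol_quot_section_def, THEN bspec, OF this]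
    obtain V s' where V: "open V \<and> x \<in> V \<and> V \<subseteq> U \<and> hol_section A W V s' \<and>
        (\<forall>y\<in>V. s' y \<in> F 1 y \<and> \<Phi> y (s y) 1 = coset (F (1 - 1) y) (s' y))"
      by (elim exE) (rule that)
    note s' = V[THEN conjunct2, THEN conjunct2, THEN conjunct2, THEN conjunct2]
    have V: "open V" "x \<in> V" "V \<subseteq> U" "hol_section A W V s'" using V by simp_all
    \<comment> \<open>Cosets of the zero subspace are singletons, so the local holomorphic lift is
      the first part itself.\<close>
    have fp: "first_part y (s y) = s' y" if "y \<in> V" for y
    proof -
      have "\<Phi> y (s y) 1 = {s' y}" using s'[THEN bspec, OF that] by (simp only: F0 coset_zero)
      then show ?thesis using first_part(1)[of y "s y"] by simp
    qed
    have "hol_section A W V (\<lambda>x. first_part x (s x))"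
      by (rule hol_section_cong[OF _ V(4)]) (simp add: fp)
    then have "hol_section A W (U \<inter> V) (\<lambda>x. first_part x (s x))"
      by (rule hol_section_subset) simp
    with V(1,2) show "\<exists>T. open T \<and> x \<in> T \<and> hol_section A W (U \<inter> T) (\<lambda>x. first_part x (s x))"
      by (intro exI[of _ V] conjI)
  qed
qed

lemma mem_F1_iff: "w \<in> F 1 x \<longleftrightarrow> (\<forall>i\<in>{1<..k}. \<Phi> x w i = F (i - 1) x)"
proof -
  have 1: "(1::nat) \<le> k" using one_in by simp
  have "inj (\<Phi> x)" using graded_bij[of x] by (simp add: bij_betw_def)
  then have "w \<in> F 1 x \<longleftrightarrow> \<Phi> x w \<in> \<Phi> x ` F 1 x" by (simp add: inj_image_mem_iff)
  then show ?thesis unfolding graded_image[OF 1] using graded_in by simp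
qed

lemma first_part_range: "range (first_part x) = F 1 x"
proof (intro equalityI subsetI)
  fix u assume u: "u \<in> F 1 x"
  define c where "c = (\<lambda>i\<in>{1..k}. if i = 1 then {u} else F (i - 1) x)"
  have "c \<in> graded_fibre k F x"
    unfolding graded_fibre_def c_def
  proof (rule restrict_PiE_iff[THEN iffD2], rule ballI)
    fix j assume j: "j \<in> {1..k}"
    have "F (j - 1) x = coset (F (j - 1) x) 0" by (simp add: coset_0)
    moreover have "0 \<in> F j x" using j by (intro vec.subspace_0 filtration_subspace[OF F]) simp
    ultimately have "F (j - 1) x \<in> coset (F (j - 1) x) ` F j x" by (rule image_eqI)
    moreover have "{u} \<in> coset (F (1 - 1) x) ` F 1 x"
      by (rule image_eqI[OF _ u]) (simp only: F0 coset_zero)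
    ultimately show "(if j = 1 then {u} else F (j - 1) x) \<in> coset (F (j - 1) x) ` F j x" by simp
  qed
  then have "c \<in> range (\<Phi> x)" using bij_betw_imp_surj_on[OF graded_bij] by simp
  then obtain w where "\<Phi> x w = c" by auto
  then have "\<Phi> x w 1 = {u}" using one_in by (simp add: c_def)
  then have "u = first_part x w" using first_part(1)[of x w] by simp
  then show "u \<in> range (first_part x)" by simp
qed (use first_part(2) in auto)

text \<open>This is the sum of the summands of index at least 2. Its description as the kernel of a
  holomorphic endomorphism is what makes it a holomorphic subbundle.\<close>

definition complement :: "'x \<Rightarrow> (complex ^ 'n) set" where
  "complement x = {w. first_part x w = 0}"

lemma complement_iff: "w \<in> complement x \<longleftrightarrow> \<Phi> x w 1 = {0}"
  unfolding complement_def using first_part(1)[of x w] by auto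

lemma complement_subbundle: "hol_subbundle A W complement"
proof -
  have 1: "(1::nat) \<le> k" using one_in by simp
  have "hol_subbundle A W (\<lambda>x. {w. matrix (first_part x) *v w = 0})"
  proof (rule subbundle_kernel[OF hol_end_first_part filtration_sub[OF F 1]])
    have "(*v) (matrix (first_part x)) = first_part x" for x by (simp add: fun_eq_iff first_part_matrix)
    then show "range ((*v) (matrix (first_part x))) = F 1 x" for x by (simp add: first_part_range)
  qed
  then show ?thesis by (simp add: first_part_matrix complement_def[abs_def])
qed

lemma complement_sub: "vec.subspace (complement x)"
  by (rule subbundle_subspace[OF complement_subbundle])

lemma summand_complement: "i \<in> {2..k} \<Longrightarrow> u \<in> summand k F \<Phi> i x \<Longrightarrow> u \<in> complement x"
  unfolding complement_iff summand_def using F0[of x] one_in by auto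

lemma complement_decomposition:
  assumes "w \<in> complement x"
  obtains d where "\<And>i. i \<in> {2..k} \<Longrightarrow> d i \<in> summand k F \<Phi> i x" "w = (\<Sum>i\<in>{2..k}. d i)"
proof -
  obtain d where d: "\<And>i. i \<in> {1..k} \<Longrightarrow> d i \<in> summand k F \<Phi> i x" "w = (\<Sum>i\<in>{1..k}. d i)"
    "\<And>i. i \<in> {1..k} \<Longrightarrow> \<Phi> x (d i) i = \<Phi> x w i"
    by (rule graded_decomposition[of x w]) (rule that)
  have "d 1 = 0"
  proof (rule graded_inj)
    fix i assume i: "i \<in> {1..k}"
    have "\<Phi> x (d 1) i = F (i - 1) x"
    proof (cases "i = 1")
      case True
      then show ?thesis using d(3)[OF one_in] assms F0[of x] by (simp add: complement_iff)
    next
      case False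
      then show ?thesis using d(1)[OF one_in] i by (simp add: summand_def)
    qed
    then show "\<Phi> x (d 1) i = \<Phi> x 0 i" using graded_0[OF i] by simp
  qed
  moreover have "{1..k} = insert 1 {2..k}" using one_in by auto
  ultimately have "w = (\<Sum>i\<in>{2..k}. d i)" using d(2) by simp
  moreover have "d i \<in> summand k F \<Phi> i x" if "i \<in> {2..k}" for i using d(1)[of i] that by simp
  ultimately show thesis by (rule that[rotated])
qed

lemma complement_splits: "splits (F 1) complement"
  unfolding splits_def
proof (intro allI conjI)
  fix x
  have 1: "(1::nat) \<le> k" using one_in by simp
  show "F 1 x \<inter> complement x = {0}"
  proof (intro equalityI subsetI)
    fix w assume w: "w \<in> F 1 x \<inter> complement x"
    have "w = 0"
    proof (rule graded_inj)
      fix i assume i: "i \<in> {1..k}"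
      show "\<Phi> x w i = \<Phi> x 0 i"
      proof (cases "i = 1")
        case True
        have "\<Phi> x w 1 = {0}" using w unfolding Int_iff complement_iff by (rule conjunct2)
        then show ?thesis unfolding graded_0[OF i] unfolding True by (simp only: F0)
      next
        case False
        have "\<forall>i\<in>{1<..k}. \<Phi> x w i = F (i - 1) x"
          using w unfolding Int_iff mem_F1_iff by (rule conjunct1)
        moreover have "i \<in> {1<..k}" using False i by simp
        ultimately show ?thesis unfolding graded_0[OF i] by (rule bspec)
      qed
    qed
    then show "w \<in> {0}" by simp
  next
    fix w :: "complex ^ 'n" assume "w \<in> {0}"
    then show "w \<in> F 1 x \<inter> complement x"
      using vec.subspace_0[OF complement_sub] vec.subspace_0[OF filtration_subspace[OF F 1]] by simp
  qed
  show "{u + v |u v. u \<in> F 1 x \<and> v \<in> complement x} = UNIV"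
  proof (intro equalityI subsetI UNIV_I)
    fix w
    obtain d where d: "\<And>i. i \<in> {1..k} \<Longrightarrow> d i \<in> summand k F \<Phi> i x" "w = (\<Sum>i\<in>{1..k}. d i)"
      by (rule graded_decomposition[of x w]) (rule that)
    have "\<Phi> x (d 1) i = F (i - 1) x" if "i \<in> {1<..k}" for i
      using d(1)[OF one_in] that by (simp add: summand_def)
    then have "d 1 \<in> F 1 x" unfolding mem_F1_iff by (intro ballI)
    moreover have "(\<Sum>i\<in>{2..k}. d i) \<in> complement x"
    proof (rule vec.subspace_sum[OF complement_sub])
      fix i assume "i \<in> {2..k}"
      then show "d i \<in> complement x" using d(1)[of i] by (intro summand_complement[of i]) auto
    qed
    moreover have "{1..k} = insert 1 {2..k}" using one_in by auto
    then have "w = d 1 + (\<Sum>i\<in>{2..k}. d i)" using d(2) by simp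
    ultimately show "w \<in> {u + v |u v. u \<in> F 1 x \<and> v \<in> complement x}"
      by (intro CollectI exI[of _ "d 1"] exI[of _ "\<Sum>i\<in>{2..k}. d i"] conjI)
  qed
qed

context
  assumes k2: "2 \<le> k"
    and orth: "\<forall>x. \<forall>i\<in>{1..k}. \<forall>j\<in>{1..k}. i + j \<noteq> k + 1 \<longrightarrow>
      (\<forall>u\<in>summand k F \<Phi> i x. \<forall>v\<in>summand k F \<Phi> j x. pairing (Q x) u v = 0)"
begin

text \<open>The summand of index k pairs non-trivially only with that of index 1, which is absent
  from the complement.\<close>

lemma last_orth_complement:
  assumes "u \<in> summand k F \<Phi> k x" "w \<in> complement x"
  shows "pairing (Q x) u w = 0"
proof -
  obtain d where d: "\<And>i. i \<in> {2..k} \<Longrightarrow> d i \<in> summand k F \<Phi> i x" "w = (\<Sum>i\<in>{2..k}. d i)"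
    by (rule complement_decomposition[OF assms(2)]) (rule that)
  have "pairing (Q x) u (d i) = 0" if "i \<in> {2..k}" for i
    using orth[rule_format, of k i u x "d i"] assms(1) d(1)[OF that] that k2 by simp
  then show ?thesis unfolding d(2) pairing_sum by simp
qed

text \<open>The first component of a vector v orthogonal to the complement can pair only with the
  last summand. As k is at least 2, that summand lies in the complement, and there the pairing
  agrees with that of v, which is zero. So the first component vanishes by non-degeneracy.\<close>

lemma complement_coisotropic: "coisotropic Q complement"
  unfolding coisotropic_def perp_eq
proof (intro allI subsetI)
  fix x v assume v: "v \<in> perp1 (Q x) (complement x)"
  obtain d where d: "\<And>i. i \<in> {1..k} \<Longrightarrow> d i \<in> summand k F \<Phi> i x" "v = (\<Sum>i\<in>{1..k}. d i)"
    "\<And>i. i \<in> {1..k} \<Longrightarrow> \<Phi> x (d i) i = \<Phi> x v i"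
    by (rule graded_decomposition[of x v]) (rule that)
  have "pairing (Q x) (d 1) w = 0" for w
  proof -
    obtain e where e: "\<And>i. i \<in> {1..k} \<Longrightarrow> e i \<in> summand k F \<Phi> i x" "w = (\<Sum>i\<in>{1..k}. e i)"
      by (rule graded_decomposition[of x w]) (rule that)
    have "pairing (Q x) (d 1) (e i) = 0" if i: "i \<in> {1..k}" for i
    proof (cases "i = k")
      case False
      then show ?thesis using orth[rule_format, of 1 i "d 1" x "e i"] d(1)[OF one_in] e(1)[OF i] one_in i by simp
    next
      case True
      have "e k \<in> complement x" using e(1)[of k] k2 by (intro summand_complement[of k]) auto
      then have "0 = pairing (Q x) (e k) v" using v by (simp add: perp1_def)
      also have "\<dots> = (\<Sum>i\<in>{1..k}. pairing (Q x) (e k) (d i))" unfolding d(2) pairing_sum ..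
      also have "\<dots> = pairing (Q x) (e k) (d 1)"
      proof -
        have "pairing (Q x) (e k) (d i) = 0" if "i \<in> {1..k} - {1}" for i
          using orth[rule_format, of k i "e k" x "d i"] that d(1)[of i] e(1)[of k] k2 by simp
        then show ?thesis using one_in by (subst sum.remove[of _ 1]) auto
      qed
      also have "\<dots> = pairing (Q x) (d 1) (e k)" by (rule pairing_sym[OF nondeg])
      finally show ?thesis using True by simp
    qed
    then show ?thesis unfolding e(2) pairing_sum by simp
  qed
  then have "d 1 = 0" by (rule nondegD(1)[OF nondeg])
  then have "\<Phi> x v 1 = {0}" using d(3)[OF one_in] graded_0[OF one_in, of x] F0[of x] by simp
  then show "v \<in> complement x" by (simp add: complement_iff)
qed

text \<open>Strict weights allow only tensors between the summands i and k - i + 1. Such a tensor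
  maps w to multiples of its two factors; a factor of index 1 comes with the pairing of w with a
  vector of index k, which is zero on the complement.\<close>

lemma complement_invariant:
  assumes lam: "lam \<in> Weights k" "\<forall>i. 1 \<le> i \<and> i < k \<longrightarrow> lam i < lam (i + 1)"
    and N: "\<psi> \<in> H0 A L W (graded_N k F \<Phi> lam)"
  shows "psi_invariant Q \<psi> complement"
  unfolding psi_invariant_def
proof (intro allI ballI)
  fix x w assume w: "w \<in> complement x"
  have strict: "lam i < lam j" if "i < j" "1 \<le> i" "j \<le> k" for i j
  proof -
    have "lam i < lam (i + 1)" using lam(2) that by simp
    also have "\<dots> \<le> lam j" using that by (intro weights_mono[OF F lam(1)]) auto
    finally show ?thesis .
  qed
  have "\<psi> x \<in> graded_N k F \<Phi> lam x" using N in_H0 by blast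
  then show "\<theta> x *v w \<in> complement x"
    unfolding graded_N_def
  proof (rule span_sym_tensor_maps_into[OF _ complement_sub _ w])
    fix Y w
    assume Y: "Y \<in> \<Union> {sym_tensors (summand k F \<Phi> i x) (summand k F \<Phi> j x) |i j.
        i \<in> {1..k} \<and> j \<in> {1..k} \<and> lam i + lam j = 0}" and w: "w \<in> complement x"
    obtain i j where ij: "i \<in> {1..k}" "j \<in> {1..k}" "lam i + lam j = 0"
      "Y \<in> sym_tensors (summand k F \<Phi> i x) (summand k F \<Phi> j x)"
      using Y by blast
    obtain l u v where uv: "Y = sym_tensor l u v" "u \<in> summand k F \<Phi> i x" "v \<in> summand k F \<Phi> j x"
      using ij(4) unfolding sym_tensors_def by blast
    have j: "j = k - i + 1"
    proof (rule ccontr)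
      assume "j \<noteq> k - i + 1"
      moreover have "lam (k - i + 1) = lam j" using weights_sym[OF F lam(1), of i] ij by simp
      moreover have "k - i + 1 \<le> k" using ij(1) by auto
      ultimately show False
        using strict[of j "k - i + 1"] strict[of "k - i + 1" j] ij by (cases "j < k - i + 1") auto
    qed
    have key: "pairing (Q x) b w *s a \<in> complement x"
      if "i \<in> {1..k}" "j = k - i + 1" "a \<in> summand k F \<Phi> i x" "b \<in> summand k F \<Phi> j x" for i j a b
    proof (cases "i = 1")
      case True
      then have "b \<in> summand k F \<Phi> k x" using that k2 by simp
      then show ?thesis
        using last_orth_complement[OF _ w] vec.subspace_0[OF complement_sub] by simp
    next
      case False
      then have "a \<in> complement x" using that(1,3) by (intro summand_complement[of i]) auto
      then show ?thesis by (rule vec.subspace_scale[OF complement_sub])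
    qed
    have 1: "pairing (Q x) v w *s u \<in> complement x" by (rule key[OF ij(1) j uv(2,3)])
    have 2: "pairing (Q x) u w *s v \<in> complement x"
      by (rule key[OF ij(2) _ uv(3,2)]) (use j ij(1) in simp)
    show "(Y ** Q x) *v w \<in> complement x"
      unfolding uv(1) sym_tensor_vec
      by (rule vec.subspace_scale[OF complement_sub vec.subspace_add[OF complement_sub 1 2]])
  qed
qed

end

end

lemma splits_neq_zero: "splits S T \<Longrightarrow> S \<noteq> whole_sub \<Longrightarrow> T \<noteq> zero_sub"
proof
  assume "splits S T" "S \<noteq> whole_sub" and T: "T = zero_sub"
  have "S x = UNIV" for x
  proof -
    have "{u + v |u v. u \<in> S x \<and> v \<in> T x} = S x" unfolding T by simp
    then show ?thesis using \<open>splits S T\<close> unfolding splits_def by simp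
  qed
  with \<open>S \<noteq> whole_sub\<close> show False by (simp add: fun_eq_iff)
qed

lemma polystable_complement:
  assumes ps: "polystable A L W Q \<psi>"
    and S: "hol_subbundle A W S" "isotropic Q S" "psi_invariant Q \<psi> S" "S \<noteq> zero_sub" "deg A W S = 0"
  shows "\<exists>T. hol_subbundle A W T \<and> coisotropic Q T \<and> psi_invariant Q \<psi> T \<and> T \<noteq> zero_sub \<and> splits S T"
proof -
  obtain k F lam where F: "q_filtration A W Q k F" "lam \<in> Weights k" "2 \<le> k" "F 1 = S"
    "\<forall>i. 1 \<le> i \<and> i < k \<longrightarrow> lam i < lam (i + 1)" "\<psi> \<in> H0 A L W (N_bundle k F lam)"
    "weighted_deg A W k F lam = - 2 * deg A W S"
    using isotropic_filtration[OF S(1-4)] by (elim exE conjE) (rule that)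
  have "weighted_deg A W k F lam = 0" using F(7) S(5) by simp
  then have "\<exists>\<Phi>. graded_iso A W k F \<Phi> \<and>
      (\<forall>x. \<forall>i\<in>{1..k}. \<forall>j\<in>{1..k}. i + j \<noteq> k + 1 \<longrightarrow>
         (\<forall>u\<in>summand k F \<Phi> i x. \<forall>v\<in>summand k F \<Phi> j x. pairing (Q x) u v = 0)) \<and>
      \<psi> \<in> H0 A L W (graded_N k F \<Phi> lam)"
    by (intro ps[unfolded polystable_def, THEN conjunct2, THEN spec, THEN spec, THEN spec, THEN mp] conjI F(1,2,5,6))
  then obtain \<Phi> where \<Phi>: "graded_iso A W k F \<Phi>"
      "\<forall>x. \<forall>i\<in>{1..k}. \<forall>j\<in>{1..k}. i + j \<noteq> k + 1 \<longrightarrow>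
         (\<forall>u\<in>summand k F \<Phi> i x. \<forall>v\<in>summand k F \<Phi> j x. pairing (Q x) u v = 0)"
      "\<psi> \<in> H0 A L W (graded_N k F \<Phi> lam)"
    by (elim exE conjE) (rule that)
  have "splits S (complement \<Phi>)" using complement_splits[OF F(1) \<Phi>(1)] F(4) by simp
  moreover have "complement \<Phi> \<noteq> zero_sub"
    by (rule splits_neq_zero[OF calculation isotropic_neq_whole[OF S(2)]])
  ultimately show ?thesis
    using complement_subbundle[OF F(1) \<Phi>(1)] complement_coisotropic[OF F(1) \<Phi>(1) F(3) \<Phi>(2)]
      complement_invariant[OF F(1) \<Phi>(1) F(3) \<Phi>(2) F(2,5) \<Phi>(3)]
    by (intro exI[of _ "complement \<Phi>"] conjI)
qed

text \<open>The adjoint of the projection onto S along T is the projection onto the orthogonal of T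
  along the orthogonal of S.\<close>

lemma perp_splits:
  assumes "hol_subbundle A W S" "hol_subbundle A W T" "splits S T"
  shows "splits (perp Q S) (perp Q T)"
  unfolding splits_def perp_eq
proof (intro allI conjI)
  fix x
  obtain P where P: "\<And>x. projection (P x) (S x)" "\<And>x v. v \<in> T x \<Longrightarrow> P x *v v = 0"
    by (rule subbundle_projection[OF assms]) (rule that)
  have ST: "\<exists>a b. w = a + b \<and> a \<in> S x \<and> b \<in> T x" for w
    using assms(3) unfolding splits_def by blast
  show "perp1 (Q x) (S x) \<inter> perp1 (Q x) (T x) = {0}"
  proof (intro equalityI subsetI)
    fix v assume v: "v \<in> perp1 (Q x) (S x) \<inter> perp1 (Q x) (T x)"
    have "pairing (Q x) w v = 0" for w
    proof -
      obtain a b where "w = a + b" "a \<in> S x" "b \<in> T x" using ST by blast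
      then show ?thesis using v by (simp add: perp1_def pairing_add)
    qed
    then have "v = 0" by (rule nondegD(2)[OF nondeg])
    then show "v \<in> {0}" by simp
  qed (simp add: perp1_def pairing_0)
  show "{u + v |u v. u \<in> perp1 (Q x) (S x) \<and> v \<in> perp1 (Q x) (T x)} = UNIV"
  proof (intro equalityI subsetI UNIV_I)
    fix w
    have "w - adj (Q x) (P x) *v w \<in> perp1 (Q x) (S x)"
      using P(1)[of x] by (simp add: perp1_def pairing_diff pairing_adj(1)[OF nondeg, symmetric] projection_def)
    moreover have "adj (Q x) (P x) *v w \<in> perp1 (Q x) (T x)"
      using P(2) by (simp add: perp1_def pairing_adj(1)[OF nondeg, symmetric] pairing_0)
    moreover have "w = (w - adj (Q x) (P x) *v w) + adj (Q x) (P x) *v w" by simp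
    ultimately show "w \<in> {u + v |u v. u \<in> perp1 (Q x) (S x) \<and> v \<in> perp1 (Q x) (T x)}" by blast
  qed
qed

end

section \<open>Splittings from complements\<close>

lemma adj_mult:
  assumes "nondeg q"
  shows "adj q (M ** N) = adj q N ** adj q M"
proof -
  have "adj q N ** adj q M = matrix_inv q ** transpose N ** (q ** matrix_inv q) ** transpose M ** q"
    by (simp add: adj_def matrix_mul_assoc)
  then show ?thesis
    using matrix_inv(1)[OF nondeg_invertible[OF assms]]
    by (simp add: adj_def matrix_transpose_mul matrix_mul_assoc)
qed

lemma adj_adj:
  assumes "nondeg q"
  shows "adj q (adj q M) = M"
proof (rule matrix_eqI)
  fix v
  have "pairing q u (adj q (adj q M) *v v) = pairing q u (M *v v)" for u
    unfolding pairing_adj(1)[OF assms, of "adj q M", symmetric] pairing_adj(2)[OF assms, of _ M] ..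
  then have "pairing q u (adj q (adj q M) *v v - M *v v) = 0" for u
    by (simp add: pairing_diff)
  then have "adj q (adj q M) *v v - M *v v = 0" by (rule nondegD(2)[OF assms])
  then show "adj q (adj q M) *v v = M *v v" by simp
qed

lemma adj_diff: "adj q (M - N) = adj q M - adj q N"
  by (simp add: adj_def transpose_diff matrix_sub_ldistrib matrix_sub_rdistrib)

lemma adj_one: "nondeg q \<Longrightarrow> adj q (mat 1) = mat 1"
  using matrix_inv(2)[OF nondeg_invertible[of q]] by (simp add: adj_def transpose_mat)

lemma projection_mult_right:
  fixes P M :: "complex ^ 'n ^ 'n"
  assumes "projection P S" "\<And>v. M *v v \<in> S"
  shows "P ** M = M"
  using assms by (intro matrix_eqI) (simp add: projection_def flip: matrix_vector_mul_assoc)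

lemma projection_perp:
  assumes "nondeg q" "projection P S"
  shows "projection (mat 1 - adj q P) (perp1 q S)"
  unfolding projection_def
proof (intro conjI allI ballI)
  fix v
  show "(mat 1 - adj q P) *v v \<in> perp1 q S"
    using assms(2) by (simp add: perp1_def matrix_vector_mult_diff_rdistrib pairing_diff
        pairing_adj(1)[OF assms(1), symmetric] projection_def)
next
  fix v assume v: "v \<in> perp1 q S"
  have "pairing q u (adj q P *v v) = 0" for u
    using assms(2) v by (simp add: pairing_adj(1)[OF assms(1), symmetric] projection_def perp1_def)
  then have "adj q P *v v = 0" by (rule nondegD(2)[OF assms(1)])
  then show "(mat 1 - adj q P) *v v = v" by (simp add: matrix_vector_mult_diff_rdistrib)
qed

text \<open>The adjoint has its image in the orthogonal of T, hence in T, where P vanishes. In this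
  form coisotropy of a complement survives composition of projections.\<close>

lemma adj_projection_complement:
  assumes q: "nondeg q" and P: "projection P S" "\<And>v. v \<in> T \<Longrightarrow> P *v v = 0" and T: "perp1 q T \<subseteq> T"
  shows "P ** adj q P = 0"
proof (rule matrix_eqI)
  fix v
  have "adj q P *v v \<in> perp1 q T"
    using P(2) by (simp add: perp1_def pairing_adj(1)[OF q, symmetric] pairing_0)
  then have "P *v (adj q P *v v) = 0" using T P(2) by blast
  then show "(P ** adj q P) *v v = 0 *v v" by (simp flip: matrix_vector_mul_assoc)
qed

text \<open>A Lagrangian \<open>S\<close> with a coisotropic complement \<open>T\<close>: then \<open>T\<close> is Lagrangian as well.\<close>

lemma lagrangian_projection:
  assumes q: "nondeg q" and P: "projection P S" and S: "perp1 q S = S" and PA: "P ** adj q P = 0"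
  shows "P = mat 1 - adj q P"
proof -
  have "(mat 1 - adj q P) ** P = P"
    using projection_perp[OF q P] P unfolding S
    by (intro projection_mult_right) (auto simp: projection_def)
  \<comment> \<open>Both matrices project onto the same S; since \<open>P ** adj q P\<close>
    vanishes, the left-hand side is also P.\<close>
  moreover have "P ** (mat 1 - adj q P) = mat 1 - adj q P"
    using projection_perp[OF q P] P unfolding S
    by (intro projection_mult_right) (auto simp: projection_def)
  ultimately show ?thesis using PA by (simp add: matrix_sub_ldistrib)
qed

context higgs_bundle
begin

lemma projection_commutes:
  assumes P: "projection (P x) (S x)" "\<And>v. v \<in> T x \<Longrightarrow> P x *v v = 0" and "splits S T"
    and inv: "psi_invariant Q \<psi> S" "psi_invariant Q \<psi> T"
  shows "P x ** \<theta> x = \<theta> x ** P x"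
proof (rule matrix_eqI)
  fix v
  obtain a b where v: "v = a + b" and a: "a \<in> S x" and b: "b \<in> T x"
    using assms(3) unfolding splits_def by blast
  have "P x *v a = a" "P x *v (\<theta> x *v a) = \<theta> x *v a" "P x *v b = 0" "P x *v (\<theta> x *v b) = 0"
    using P a b psi_invariantD[OF inv(1) a] psi_invariantD[OF inv(2) b] by (simp_all add: projection_def)
  then show "(P x ** \<theta> x) *v v = (\<theta> x ** P x) *v v"
    unfolding v matrix_vector_mul_assoc[symmetric, of "P x"] matrix_vector_mul_assoc[symmetric, of "\<theta> x"]
      matrix_vector_right_distrib by simp
qed

lemma adj_commutes: "P ** \<theta> x = \<theta> x ** P \<Longrightarrow> adj (Q x) P ** \<theta> x = \<theta> x ** adj (Q x) P"
  by (metis adj_mult[OF nondeg] adj_theta)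

definition equivariant :: "('x \<Rightarrow> complex ^ 'n ^ 'n) \<Rightarrow> ('x \<Rightarrow> (complex ^ 'n) set) \<Rightarrow> bool" where
  "equivariant P S \<longleftrightarrow> hol_end P \<and> (\<forall>x. projection (P x) (S x) \<and> P x ** \<theta> x = \<theta> x ** P x)"

lemma equivariant_perp:
  assumes "equivariant P S"
  shows "equivariant (\<lambda>x. mat 1 - adj (Q x) (P x)) (perp Q S)"
proof -
  have "(mat 1 - adj (Q x) (P x)) ** \<theta> x = \<theta> x ** (mat 1 - adj (Q x) (P x))" for x
    using adj_commutes[of "P x" x] assms unfolding equivariant_def
    by (simp add: matrix_sub_ldistrib matrix_sub_rdistrib)
  then show ?thesis
    using assms unfolding equivariant_def perp_eq
    by (auto intro!: hol_end_diff hol_end_1 hol_end_adj projection_perp[OF nondeg])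
qed

text \<open>The projection onto the larger subbundle fixes the smaller one, so the product is again
  a projection onto the smaller one; only its kernel changes.\<close>

lemma equivariant_mult:
  assumes "equivariant P S" "equivariant P' S'" "S \<le> S'"
  shows "equivariant (\<lambda>x. P x ** P' x) S"
  unfolding equivariant_def
proof (intro conjI allI)
  show "hol_end (\<lambda>x. P x ** P' x)" using assms(1,2) by (simp add: equivariant_def hol_end_mult)
  fix x
  have e: "projection (P x) (S x)" "projection (P' x) (S' x)" "P x ** \<theta> x = \<theta> x ** P x" "P' x ** \<theta> x = \<theta> x ** P' x"
    using assms(1,2) by (simp_all add: equivariant_def)
  have "S x \<subseteq> S' x" using assms(3) by (simp add: le_fun_def)
  then have "P' x *v v = v" if "v \<in> S x" for v using e(2) that unfolding projection_def by blast
  then show "projection (P x ** P' x) (S x)"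
    using e(1) unfolding projection_def matrix_vector_mul_assoc[symmetric] by simp
  show "(P x ** P' x) ** \<theta> x = \<theta> x ** (P x ** P' x)"
    using e(3,4) by (metis matrix_mul_assoc)
qed

text \<open>
  The given complements need not be nested, so the projections onto the isotropic steps are
  composed: \<open>p j = \<pi> j ** \<dots> ** \<pi> l\<close> with \<open>l = k div 2\<close>. Its kernel contains that of \<open>\<pi> l\<close>, hence is
  coisotropic again, and the upper half of the filtration is handled by adjoints.
\<close>

lemma adapted_projections:
  assumes F: "q_filtration A W Q k F"
    and inv: "\<And>j. 1 \<le> j \<Longrightarrow> j < k \<Longrightarrow> psi_invariant Q \<psi> (F j)"
    and compl: "\<And>j. 1 \<le> j \<Longrightarrow> 2 * j \<le> k \<Longrightarrow>
      \<exists>T. hol_subbundle A W T \<and> coisotropic Q T \<and> psi_invariant Q \<psi> T \<and> splits (F j) T"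
  obtains P where "\<And>j. j \<le> k \<Longrightarrow> equivariant (P j) (F j)"
    "\<And>j x. j \<le> k \<Longrightarrow> P (k - j) x = mat 1 - adj (Q x) (P j x)"
    "\<And>i j x. i \<le> j \<Longrightarrow> j \<le> k \<Longrightarrow> P i x ** P j x = P i x"
proof -
  \<comment> \<open>\<open>F l\<close> is the largest step covered by \<open>compl\<close>, and k is
    either 2 l or 2 l + 1.\<close>
  define l where "l = k div 2"
  have lk: "2 * l \<le> k" "k \<le> 2 * l + 1" unfolding l_def by auto
  have kpos: "0 < k" by (rule filtration_k_pos[OF F])
  have "\<exists>\<pi>. equivariant \<pi> (F j) \<and> (\<forall>x. \<pi> x ** adj (Q x) (\<pi> x) = 0)" if j: "j \<in> {1..l}" for j
  proof -
    have j': "1 \<le> j" "2 * j \<le> k" "j < k" "j \<le> k" using j lk by auto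
    obtain T where T: "hol_subbundle A W T" "coisotropic Q T" "psi_invariant Q \<psi> T" "splits (F j) T"
      using compl[OF j'(1,2)] by (elim exE conjE) (rule that)
    obtain \<pi> where \<pi>: "hol_end \<pi>" "\<And>x. projection (\<pi> x) (F j x)" "\<And>x v. v \<in> T x \<Longrightarrow> \<pi> x *v v = 0"
      by (rule subbundle_projection[OF filtration_sub[OF F j'(4)] T(1,4)]) (rule that)
    have "\<pi> x ** \<theta> x = \<theta> x ** \<pi> x" for x
      by (rule projection_commutes[OF \<pi>(2,3) T(4) inv[OF j'(1,3)] T(3)])
    moreover have "\<pi> x ** adj (Q x) (\<pi> x) = 0" for x
    proof (rule adj_projection_complement[OF nondeg \<pi>(2)])
      show "\<pi> x *v v = 0" if "v \<in> T x" for v by (rule \<pi>(3)[OF that])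
      show "perp1 (Q x) (T x) \<subseteq> T x" by (rule T(2)[unfolded coisotropic_def perp_eq, THEN spec])
    qed
    ultimately show ?thesis using \<pi>(1,2) by (intro exI[of _ \<pi>]) (simp add: equivariant_def)
  qed
  then have "\<forall>j\<in>{1..l}. \<exists>\<pi>. equivariant \<pi> (F j) \<and> (\<forall>x. \<pi> x ** adj (Q x) (\<pi> x) = 0)" by blast
  from bchoice[OF this] obtain \<pi> where
    \<pi>: "\<forall>j\<in>{1..l}. equivariant (\<pi> j) (F j) \<and> (\<forall>x. \<pi> j x ** adj (Q x) (\<pi> j x) = 0)" by blast
  \<comment> \<open>\<open>e d\<close> is the product from \<open>\<pi> (l - d)\<close> to
    \<open>\<pi> l\<close>; descending from the middle keeps \<open>\<pi> l\<close> as the rightmost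
    factor of all of them.\<close>
  define e where "e = rec_nat (\<pi> l) (\<lambda>d M x. \<pi> (l - Suc d) x ** M x)"
  have e0: "e 0 = \<pi> l" and eS: "e (Suc d) x = \<pi> (l - Suc d) x ** e d x" for d x
    by (simp_all add: e_def)
  have e_eq: "equivariant (e d) (F (l - d))" if "d < l" for d
    using that
  proof (induction d)
    case 0
    then show ?case using \<pi> by (simp add: e0)
  next
    case (Suc d)
    then have "equivariant (\<pi> (l - Suc d)) (F (l - Suc d))" "equivariant (e d) (F (l - d))"
      using \<pi> by auto
    moreover have "F (l - Suc d) \<le> F (l - d)" using lk by (intro filtration_mono[OF F]) auto
    ultimately have "equivariant (\<lambda>x. \<pi> (l - Suc d) x ** e d x) (F (l - Suc d))" by (rule equivariant_mult)
    then show ?case unfolding eS[symmetric] by simp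
  qed
  have e_factor: "\<exists>M. e d' x = M ** e d x" if "d \<le> d'" for d d' x
    using that
  proof (induction d' rule: dec_induct)
    case base
    show ?case by (rule exI[of _ "mat 1"]) simp
  next
    case (step n)
    then obtain M where "e n x = M ** e d x" by blast
    then have "e (Suc n) x = (\<pi> (l - Suc n) x ** M) ** e d x" by (simp add: eS matrix_mul_assoc)
    then show ?case by (rule exI)
  qed
  \<comment> \<open>\<open>F 0\<close> is zero and no \<open>\<pi> 0\<close> was chosen, whence the
    separate value.\<close>
  define p where "p j x = (if j = 0 then 0 else e (l - j) x)" for j x
  have p_eq: "equivariant (p j) (F j)" if "j \<le> l" for j
  proof (cases "j = 0")
    case True
    have "p 0 = (\<lambda>x. 0)" by (simp add: p_def fun_eq_iff)
    then show ?thesis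
      unfolding True equivariant_def filtration_0[OF F] by (simp add: hol_end_0 projection_def)
  next
    case False
    then have "p j = e (l - j)" by (simp add: p_def fun_eq_iff)
    then show ?thesis using e_eq[of "l - j"] that False by simp
  qed
  have p_proj: "projection (p j x) (F j x)" if "j \<le> l" for j x
    using p_eq[OF that] by (simp add: equivariant_def)
  have p_nest: "p i x ** p j x = p i x" if ij: "i \<le> j" "j \<le> l" for i j x
  proof (cases "i = 0")
    case False
    then have "p i x = e (l - i) x" "p j x = e (l - j) x" using ij by (simp_all add: p_def)
    moreover have "l - j \<le> l - i" using ij by simp
    from e_factor[OF this, of x] obtain M where "e (l - i) x = M ** e (l - j) x"
      by (elim exE) (rule that)
    moreover have "p j x ** p j x = p j x"
      using p_proj[OF ij(2), of x] by (intro projection_mult_right) (auto simp: projection_def)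
    ultimately show ?thesis by (metis matrix_mul_assoc)
  qed (simp add: p_def)
  have p_down: "p j x ** p i x = p i x" if ij: "i \<le> j" "j \<le> l" for i j x
  proof (rule projection_mult_right[OF p_proj[OF ij(2)]])
    fix v
    have "p i x *v v \<in> F i x" using p_proj[of i x] ij by (simp add: projection_def)
    then show "p i x *v v \<in> F j x" using filtration_mono_mem[OF F ij(1)] ij lk by simp
  qed
  have p_factor: "\<exists>M. p j x = M ** \<pi> l x" if "j \<le> l" for j x
  proof (cases "j = 0")
    case True
    then show ?thesis by (intro exI[of _ 0]) (simp add: p_def)
  next
    case False
    then show ?thesis using e_factor[of 0 "l - j" x] by (simp add: p_def e0)
  qed
  \<comment> \<open>The common rightmost factor puts \<open>\<pi> l\<close> times its adjoint, which
    is zero, into the middle of the product.\<close>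
  have p_adj: "p i x ** adj (Q x) (p j x) = 0" if ij: "i \<le> l" "j \<le> l" for i j x
  proof (cases "l = 0")
    case True
    then show ?thesis using ij by (simp add: p_def)
  next
    case False
    then have z: "\<pi> l x ** adj (Q x) (\<pi> l x) = 0" using \<pi> by auto
    obtain M N where M: "p i x = M ** \<pi> l x" and N: "p j x = N ** \<pi> l x" using p_factor ij by metis
    have "p i x ** adj (Q x) (p j x) = M ** (\<pi> l x ** adj (Q x) (\<pi> l x)) ** adj (Q x) N"
      unfolding M N adj_mult[OF nondeg] by (simp add: matrix_mul_assoc)
    then show ?thesis unfolding z by simp
  qed
  \<comment> \<open>The upper half is forced by the duality relation to be proved.\<close>
  define P where "P j x = (if j \<le> l then p j x else mat 1 - adj (Q x) (p (k - j) x))" for j x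
  have up: "k - j \<le> l" if "\<not> j \<le> l" for j using that lk by linarith
  show thesis
  proof (rule that)
    show "equivariant (P j) (F j)" if "j \<le> k" for j
    proof (cases "j \<le> l")
      case True
      then have "P j = p j" by (simp add: P_def fun_eq_iff)
      then show ?thesis using p_eq[OF True] by simp
    next
      case False
      then have "P j = (\<lambda>x. mat 1 - adj (Q x) (p (k - j) x))" by (simp add: P_def fun_eq_iff)
      then show ?thesis
        using equivariant_perp[OF p_eq[OF up[OF False]]] filtration_perp[OF F that] by simp
    qed
  next
    fix j x assume jk: "j \<le> k"
    consider "j \<le> l" "\<not> k - j \<le> l" | "\<not> j \<le> l" | "j = l" "k = 2 * l" using lk by linarith
    then show "P (k - j) x = mat 1 - adj (Q x) (P j x)"
    proof cases
      case 1
      then show ?thesis using jk by (simp add: P_def)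
    next
      case 2
      then show ?thesis using up[OF 2]
        by (simp add: P_def adj_diff adj_one[OF nondeg] adj_adj[OF nondeg])
    next
      case 3
      \<comment> \<open>For even k the index l is dual to itself, so duality is not built into the
        definition there. It holds because \<open>F l\<close> is Lagrangian and \<open>p l\<close>
        annihilates the image of its own adjoint.\<close>
      then have l: "l \<noteq> 0" "k - l = l" "l \<le> k" using kpos by auto
      have "perp1 (Q x) (F l x) = F l x" using filtration_perp[OF F l(3)] unfolding l(2) perp_eq[symmetric] by simp
      then have "p l x = mat 1 - adj (Q x) (p l x)"
        by (rule lagrangian_projection[OF nondeg p_proj[OF order_refl] _ p_adj]) simp_all
      then show ?thesis using 3(1) l(2) by (simp add: P_def)
    qed
  next
    fix i j x assume ij: "i \<le> j" "j \<le> k"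
    consider "j \<le> l" | "i \<le> l" "\<not> j \<le> l" | "\<not> i \<le> l" "\<not> j \<le> l" using ij by linarith
    then show "P i x ** P j x = P i x"
    proof cases
      case 1
      then show ?thesis using p_nest[OF ij(1) 1] ij by (simp add: P_def)
    next
      case 2
      \<comment> \<open>\<open>P j\<close> differs from the identity by the adjoint of
        \<open>p (k - j)\<close>, and \<open>p i\<close> kills that adjoint.\<close>
      then show ?thesis using p_adj[OF 2(1) up[OF 2(2)], of x] by (simp add: P_def matrix_sub_ldistrib)
    next
      case 3
      have "p (k - j) x ** p (k - i) x = p (k - j) x"
        using ij up[OF 3(1)] by (intro p_nest) auto
      then have "adj (Q x) (p (k - i) x) ** adj (Q x) (p (k - j) x) = adj (Q x) (p (k - j) x)"
        unfolding adj_mult[OF nondeg, symmetric] by simp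
      then show ?thesis using 3 by (simp add: P_def matrix_sub_ldistrib matrix_sub_rdistrib)
    qed
  qed
qed

section \<open>The splitting determined by nested, self-dual projections\<close>

context
  fixes k F P
  assumes F: "q_filtration A W Q k F"
    and eqv: "\<And>j. j \<le> k \<Longrightarrow> equivariant (P j) (F j)"
    and dual: "\<And>j x. j \<le> k \<Longrightarrow> P (k - j) x = mat 1 - adj (Q x) (P j x)"
    and nest: "\<And>i j x. i \<le> j \<Longrightarrow> j \<le> k \<Longrightarrow> P i x ** P j x = P i x"
begin

text \<open>Modulo \<open>F (i - 1)\<close>, the vector \<open>P i x *v w\<close> agrees with the
  increment from \<open>P (i - 1)\<close> to \<open>P i\<close>; these increments are the
  projections onto the summands.\<close>

definition split_iso :: "'x \<Rightarrow> complex ^ 'n \<Rightarrow> nat \<Rightarrow> (complex ^ 'n) set" where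
  "split_iso x w = (\<lambda>i\<in>{1..k}. coset (F (i - 1) x) (P i x *v w))"

lemma P_in: "j \<le> k \<Longrightarrow> P j x *v v \<in> F j x"
  and P_fix: "j \<le> k \<Longrightarrow> v \<in> F j x \<Longrightarrow> P j x *v v = v"
  using eqv[of j] by (simp_all add: equivariant_def projection_def)

lemma P_nest: "i \<le> j \<Longrightarrow> j \<le> k \<Longrightarrow> P i x *v (P j x *v v) = P i x *v v"
  using nest[of i j x] by (simp add: matrix_vector_mul_assoc)

lemma P_0: "P 0 x *v v = 0"
  using P_in[of 0 x v] filtration_0[OF F] by simp

lemma P_k: "P k x *v v = v"
  using filtration_k[OF F] by (intro P_fix) simp_all

lemma pred_subspace: "i \<in> {1..k} \<Longrightarrow> vec.subspace (F (i - 1) x)"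
  by (rule filtration_subspace[OF F]) auto

lemma split_eq: "i \<in> {1..k} \<Longrightarrow> split_iso x w i = coset (F (i - 1) x) (P i x *v w)"
  by (simp add: split_iso_def)

lemma split_in_iff: "i \<in> {1..k} \<Longrightarrow> split_iso x w i = F (i - 1) x \<longleftrightarrow> P i x *v w \<in> F (i - 1) x"
  by (simp only: split_eq coset_eq_self[OF pred_subspace])

lemma split_stable:
  assumes "i \<in> {1..k}" "P i x *v w \<in> F (i - 1) x"
  shows "P i x *v w = P (i - 1) x *v w"
  using P_fix[OF _ assms(2)] P_nest[of "i - 1" i x w] assms(1) by (simp add: subset_eq)

text \<open>Descending induction: in the step \<open>F i\<close> the vector is fixed by
  \<open>P i\<close>, and its vanishing i-th component moves it into
  \<open>F (i - 1)\<close>.\<close>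

lemma mem_if_parts:
  assumes j: "j \<le> k" and parts: "\<And>i. i \<in> {j<..k} \<Longrightarrow> P i x *v v \<in> F (i - 1) x"
  shows "v \<in> F j x"
proof -
  have "m \<le> k - j \<Longrightarrow> v \<in> F (k - m) x" for m
  proof (induction m)
    case 0
    then show ?case using filtration_k[OF F] by simp
  next
    case (Suc m)
    then have "v \<in> F (k - m) x" by simp
    then have "P (k - m) x *v v = v" by (intro P_fix) simp_all
    moreover have "P (k - m) x *v v \<in> F (k - m - 1) x" using Suc.prems by (intro parts) auto
    ultimately show ?case by simp
  qed
  from this[of "k - j"] show ?thesis using j by simp
qed

lemma split_coset_iff:
  assumes "i \<in> {1..k}"
  shows "split_iso x u i = coset (F (i - 1) x) v \<longleftrightarrow> P i x *v u - v \<in> F (i - 1) x"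
  unfolding split_eq[OF assms] by (rule coset_eq_iff[OF pred_subspace[OF assms]])

lemma split_in: "split_iso x w \<in> graded_fibre k F x"
  unfolding graded_fibre_def split_iso_def
  by (rule restrict_PiE_iff[THEN iffD2]) (intro ballI imageI P_in, simp)

lemma telescope: "(\<Sum>j\<in>{1..k}. P j x *v w - P (j - 1) x *v w) = w"
proof -
  have "(\<Sum>j\<in>{1..m}. f j - f (j - 1)) = f m - f 0" for f :: "nat \<Rightarrow> complex ^ 'n" and m
    by (induction m) simp_all
  from this[of "\<lambda>j. P j x *v w" k] show ?thesis by (simp only: P_0 P_k diff_zero)
qed

lemma split_inj: "inj (split_iso x)"
proof (rule injI)
  fix u v assume uv: "split_iso x u = split_iso x v"
  have parts: "P i x *v (u - v) \<in> F (i - 1) x" if "i \<in> {0<..k}" for i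
  proof -
    have i: "i \<in> {1..k}" using that by auto
    have "split_iso x u i = coset (F (i - 1) x) (P i x *v v)" unfolding uv by (rule split_eq[OF i])
    then show ?thesis unfolding split_coset_iff[OF i] matrix_vector_mult_diff_distrib .
  qed
  have "u - v \<in> F 0 x" by (rule mem_if_parts[OF _ parts]) simp
  then show "u = v" using filtration_0[OF F] by simp
qed

lemma split_surj:
  assumes c: "c \<in> graded_fibre k F x"
  shows "\<exists>w. split_iso x w = c"
proof -
  have "\<forall>i\<in>{1..k}. \<exists>y. y \<in> F i x \<and> c i = coset (F (i - 1) x) y"
    using c unfolding graded_fibre_def by (auto dest!: PiE_mem)
  from bchoice[OF this] obtain y where
    y: "\<forall>i\<in>{1..k}. y i \<in> F i x \<and> c i = coset (F (i - 1) x) (y i)" by blast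
  \<comment> \<open>The representative of the i-th class that is annihilated by
    \<open>P (i - 1)\<close>, hence by all earlier projections.\<close>
  define g where "g i = y i - P (i - 1) x *v y i" for i
  have sub: "vec.subspace (F j x)" if "j \<le> k" for j by (rule filtration_subspace[OF F that])
  have gF: "g i \<in> F i x" if i: "i \<in> {1..k}" for i
  proof -
    have "P (i - 1) x *v y i \<in> F (i - 1) x" using i by (intro P_in) auto
    then have "P (i - 1) x *v y i \<in> F i x" using i by (intro filtration_mono_mem[OF F, of "i - 1" i]) auto
    then show ?thesis unfolding g_def using y i by (intro vec.subspace_diff sub) auto
  qed
  define w where "w = (\<Sum>i\<in>{1..k}. g i)"
  have "split_iso x w j = c j" if j: "j \<in> {1..k}" for j
  proof -
    \<comment> \<open>For i < j the vector already lies in \<open>F (j - 1)\<close>; for i > j it is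
      annihilated, because \<open>P j\<close> absorbs \<open>P (i - 1)\<close>.\<close>
    have other: "P j x *v g i \<in> F (j - 1) x" if i: "i \<in> {1..k} - {j}" for i
    proof (cases "i < j")
      case True
      have "g i \<in> F j x" using gF[of i] i j True by (intro filtration_mono_mem[OF F, of i j]) auto
      then have "P j x *v g i = g i" using j by (intro P_fix) auto
      moreover have "g i \<in> F (j - 1) x" using gF[of i] i j True by (intro filtration_mono_mem[OF F, of i "j - 1"]) auto
      ultimately show ?thesis by simp
    next
      case False
      have "P j x *v (P (i - 1) x *v y i) = P j x *v y i" using i False by (intro P_nest) auto
      then have "P j x *v g i = 0" by (simp add: g_def matrix_vector_mult_diff_distrib)
      then show ?thesis using j vec.subspace_0[OF sub, of "j - 1"] by auto
    qed
    have own: "P j x *v g j - y j \<in> F (j - 1) x"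
    proof -
      have "P j x *v g j = g j" using gF[OF j] j by (intro P_fix) auto
      then have "P j x *v g j - y j = - (P (j - 1) x *v y j)" by (simp add: g_def)
      moreover have "P (j - 1) x *v y j \<in> F (j - 1) x" using j by (intro P_in) auto
      ultimately show ?thesis using vec.subspace_neg[OF sub, of "j - 1"] j by auto
    qed
    have "P j x *v w - y j = (P j x *v g j - y j) + (\<Sum>i\<in>{1..k} - {j}. P j x *v g i)"
      unfolding w_def matrix_vector_mult_sum using j by (subst sum.remove[of _ j]) auto
    also have "\<dots> \<in> F (j - 1) x"
      using own other j by (intro vec.subspace_add vec.subspace_sum sub) auto
    finally have "split_iso x w j = coset (F (j - 1) x) (y j)" unfolding split_coset_iff[OF j] .
    then show ?thesis using y j by simp
  qed
  moreover have "split_iso x w \<in> graded_fibre k F x" by (rule split_in)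
  ultimately have "split_iso x w = c" using c unfolding graded_fibre_def by (intro PiE_ext[of _ "{1..k}"]) auto
  then show ?thesis by blast
qed

lemma P_hol: "j \<le> k \<Longrightarrow> open U \<Longrightarrow> hol_section A W U s \<Longrightarrow> hol_section A W U (\<lambda>x. P j x *v s x)"
  using eqv[of j] by (simp add: equivariant_def hol_end_def)

text \<open>For the converse, a holomorphic lift of the i-th component is corrected to the i-th
  increment of s; the increments add up to s.\<close>

lemma split_hol:
  assumes U: "open U"
  shows "hol_section A W U s \<longleftrightarrow>
    (\<forall>i\<in>{1..k}. hol_quot_section A W (F i) (F (i - 1)) U (\<lambda>x. split_iso x (s x) i))"
proof
  assume s: "hol_section A W U s"
  show "\<forall>i\<in>{1..k}. hol_quot_section A W (F i) (F (i - 1)) U (\<lambda>x. split_iso x (s x) i)"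
    unfolding hol_quot_section_def
  proof (intro ballI)
    fix i x assume i: "i \<in> {1..k}" and x: "x \<in> U"
    have "hol_section A W U (\<lambda>x. P i x *v s x)" using i by (intro P_hol U s) auto
    moreover have "P i y *v s y \<in> F i y \<and> split_iso y (s y) i = coset (F (i - 1) y) (P i y *v s y)" for y
      using i by (simp add: split_iso_def P_in)
    ultimately show "\<exists>V t. open V \<and> x \<in> V \<and> V \<subseteq> U \<and> hol_section A W V t \<and>
        (\<forall>y\<in>V. t y \<in> F i y \<and> split_iso y (s y) i = coset (F (i - 1) y) (t y))"
      using U x by (intro exI[of _ U] exI[of _ "\<lambda>x. P i x *v s x"]) simp
  qed
next
  assume q: "\<forall>i\<in>{1..k}. hol_quot_section A W (F i) (F (i - 1)) U (\<lambda>x. split_iso x (s x) i)"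
  have part: "hol_section A W U (\<lambda>x. P i x *v s x - P (i - 1) x *v s x)" if i: "i \<in> {1..k}" for i
  proof (rule hol_section_local[OF U])
    fix x assume "x \<in> U"
    from q[THEN bspec, OF i, unfolded hol_quot_section_def, THEN bspec, OF this]
    obtain V t where Vt: "open V \<and> x \<in> V \<and> V \<subseteq> U \<and> hol_section A W V t \<and>
        (\<forall>y\<in>V. t y \<in> F i y \<and> split_iso y (s y) i = coset (F (i - 1) y) (t y))"
      by (elim exE) (rule that)
    note t = Vt[THEN conjunct2, THEN conjunct2, THEN conjunct2, THEN conjunct2]
    have V: "open V" "x \<in> V" "V \<subseteq> U" "hol_section A W V t" using Vt by simp_all
    \<comment> \<open>The lift differs from \<open>P i x *v s x\<close> by an element of
      \<open>F (i - 1)\<close>, and subtracting \<open>P (i - 1)\<close> removes this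
      ambiguity.\<close>
    have "hol_section A W V (\<lambda>x. t x - P (i - 1) x *v t x)"
      using i by (intro hol_section_diff P_hol V) auto
    then have "hol_section A W V (\<lambda>x. P i x *v s x - P (i - 1) x *v s x)"
    proof (rule hol_section_cong[rotated])
      fix y assume "y \<in> V"
      have "P i y *v s y - t y \<in> F (i - 1) y"
        by (rule split_coset_iff[OF i, THEN iffD1]) (rule t[THEN bspec, OF \<open>y \<in> V\<close>, THEN conjunct2])
      then have "P (i - 1) y *v (P i y *v s y - t y) = P i y *v s y - t y"
        using i by (intro P_fix) auto
      moreover have "P (i - 1) y *v (P i y *v s y) = P (i - 1) y *v s y" using i by (intro P_nest) auto
      ultimately show "t y - P (i - 1) y *v t y = P i y *v s y - P (i - 1) y *v s y"
        by (simp add: matrix_vector_mult_diff_distrib algebra_simps)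
    qed
    then have "hol_section A W (U \<inter> V) (\<lambda>x. P i x *v s x - P (i - 1) x *v s x)"
      by (rule hol_section_subset) simp
    with V(1,2) show "\<exists>T. open T \<and> x \<in> T \<and> hol_section A W (U \<inter> T) (\<lambda>x. P i x *v s x - P (i - 1) x *v s x)"
      by (intro exI[of _ V] conjI)
  qed
  have "hol_section A W U (\<lambda>x. \<Sum>i\<in>{1..k}. P i x *v s x - P (i - 1) x *v s x)"
    by (rule hol_section_sum[OF part])
  then show "hol_section A W U s" unfolding telescope .
qed

lemma split_image:
  assumes j: "j \<le> k"
  shows "split_iso x ` F j x = {c \<in> graded_fibre k F x. \<forall>i\<in>{j<..k}. c i = F (i - 1) x}"
proof (intro equalityI subsetI)
  fix c assume "c \<in> split_iso x ` F j x"
  then obtain w where w: "w \<in> F j x" "c = split_iso x w" by blast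
  have "c i = F (i - 1) x" if i: "i \<in> {j<..k}" for i
  proof -
    have i': "i \<in> {1..k}" using i by auto
    have "w \<in> F (i - 1) x" "w \<in> F i x" using i w(1) by (auto intro!: filtration_mono_mem[OF F, of j])
    then have "P i x *v w \<in> F (i - 1) x" using P_fix[of i w x] i by simp
    then show ?thesis unfolding w(2) split_in_iff[OF i'] .
  qed
  then show "c \<in> {c \<in> graded_fibre k F x. \<forall>i\<in>{j<..k}. c i = F (i - 1) x}"
    using split_in w(2) by simp
next
  fix c assume c: "c \<in> {c \<in> graded_fibre k F x. \<forall>i\<in>{j<..k}. c i = F (i - 1) x}"
  then obtain w where w: "split_iso x w = c" using split_surj by blast
  have "w \<in> F j x"
  proof (rule mem_if_parts[OF j])
    fix i assume i: "i \<in> {j<..k}"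
    then have "i \<in> {1..k}" by auto
    from split_in_iff[OF this, of x w] show "P i x *v w \<in> F (i - 1) x" using c w i by auto
  qed
  with w show "c \<in> split_iso x ` F j x" by blast
qed

lemma split_graded_iso: "graded_iso A W k F split_iso"
  unfolding graded_iso_def
proof (intro conjI allI ballI impI)
  have "range (split_iso x) = graded_fibre k F x" for x
    using split_in split_surj by (fast)
  then show "bij_betw (split_iso x) UNIV (graded_fibre k F x)" for x
    unfolding bij_betw_def using split_inj by simp
  fix i x u v a assume i: "i \<in> {1..k}"
  show "split_iso x (u + v) i = quot_add (split_iso x u i) (split_iso x v i)"
    unfolding split_eq[OF i] quot_add_coset[OF pred_subspace[OF i]] by (simp add: matrix_vector_right_distrib)
  show "split_iso x (a *s u) i = quot_scale (F (i - 1) x) a (split_iso x u i)"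
    unfolding split_eq[OF i] quot_scale_coset[OF pred_subspace[OF i]] by (simp add: matrix_vector_mult_smult)
qed (erule split_hol split_image)+

text \<open>All increments except the i-th vanish on the i-th summand, and they telescope to the
  identity.\<close>

lemma summandD:
  assumes "i \<in> {1..k}" "w \<in> summand k F split_iso i x" and j: "j \<in> {1..k}"
  shows "P j x *v w - P (j - 1) x *v w = (if j = i then w else 0)"
proof -
  have z: "P j x *v w - P (j - 1) x *v w = 0" if "j \<in> {1..k} - {i}" for j
  proof -
    have j: "j \<in> {1..k}" using that by simp
    have "split_iso x w j = F (j - 1) x" using assms(2) that by (simp add: summand_def)
    then show ?thesis using split_stable[OF j] split_in_iff[OF j] by simp
  qed
  have "w = P i x *v w - P (i - 1) x *v w"
    using telescope[of x w] sum.remove[of "{1..k}" i "\<lambda>j. P j x *v w - P (j - 1) x *v w"] assms(1) z by simp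
  then show ?thesis using z j by auto
qed

lemma summandI:
  assumes i: "i \<in> {1..k}"
  shows "(P i x - P (i - 1) x) *v v \<in> summand k F split_iso i x"
  unfolding summand_def
proof (intro CollectI ballI)
  fix j assume j: "j \<in> {1..k} - {i}"
  then have j': "j \<in> {1..k}" by simp
  let ?d = "P i x *v v - P (i - 1) x *v v"
  have "P j x *v ?d \<in> F (j - 1) x"
  proof (cases "j < i")
    case True
    then have "P j x *v (P i x *v v) = P j x *v v" "P j x *v (P (i - 1) x *v v) = P j x *v v"
      using i by (auto intro!: P_nest)
    then have "P j x *v ?d = 0" by (simp add: matrix_vector_mult_diff_distrib)
    then show ?thesis using j by (auto intro!: vec.subspace_0 filtration_subspace[OF F])
  next
    case False
    have "P (i - 1) x *v v \<in> F (i - 1) x" using i by (intro P_in) auto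
    then have "P (i - 1) x *v v \<in> F i x" using i by (intro filtration_mono_mem[OF F, of "i - 1" i]) auto
    then have "?d \<in> F i x" using i by (intro vec.subspace_diff filtration_subspace[OF F] P_in) auto
    then have "?d \<in> F (j - 1) x" "?d \<in> F j x"
      using False j by (auto intro!: filtration_mono_mem[OF F, of i])
    then show ?thesis using P_fix[of j ?d x] j by simp
  qed
  then show "split_iso x ((P i x - P (i - 1) x) *v v) j = F (j - 1) x"
    unfolding split_in_iff[OF j'] by (simp add: matrix_vector_mult_diff_rdistrib)
qed

text \<open>Subtracting the duality relations for two consecutive indices cancels the identity
  matrices. The resulting exchange of i and k + 1 - i yields both the orthogonality of summands and
  the form of \<psi>.\<close>

lemma dual_step:
  assumes "i \<in> {1..k}"
  shows "adj (Q x) (P i x - P (i - 1) x) = P (k - i + 1) x - P (k - i) x"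
proof -
  have 1: "P (k - i) x = mat 1 - adj (Q x) (P i x)" using assms by (intro dual) auto
  have "P (k - (i - 1)) x = mat 1 - adj (Q x) (P (i - 1) x)" using assms by (intro dual) auto
  moreover have "k - (i - 1) = k - i + 1" using assms by auto
  ultimately have 2: "P (k - i + 1) x = mat 1 - adj (Q x) (P (i - 1) x)" by (simp only:)
  show ?thesis unfolding 1 2 adj_diff by simp
qed

lemma summands_orthogonal:
  assumes i: "i \<in> {1..k}" and j: "j \<in> {1..k}" and ij: "i + j \<noteq> k + 1"
    and u: "u \<in> summand k F split_iso i x" and v: "v \<in> summand k F split_iso j x"
  shows "pairing (Q x) u v = 0"
proof -
  have i': "k - i + 1 \<in> {1..k}" "k - i + 1 \<noteq> j" using i ij by auto
  have "u = (P i x - P (i - 1) x) *v u" using summandD[OF i u i] by (simp add: matrix_vector_mult_diff_rdistrib)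
  then have "pairing (Q x) u v = pairing (Q x) u (adj (Q x) (P i x - P (i - 1) x) *v v)"
    by (metis pairing_adj(1)[OF nondeg])
  also have "adj (Q x) (P i x - P (i - 1) x) *v v = 0"
    using summandD[OF j v i'(1)] i'(2) unfolding dual_step[OF i] by (simp add: matrix_vector_mult_diff_rdistrib)
  finally show ?thesis by (simp add: pairing_0)
qed

text \<open>The projection \<open>e i\<close> onto a summand commutes with \<open>\<theta> x\<close>
  and its adjoint is the projection onto the opposite summand. Cancelling Q, one finds that
  \<open>e i ** \<psi> x\<close> pairs summand i with its opposite only, and opposite weights add up
  to zero.\<close>

lemma psi_in_graded_N:
  assumes lam: "lam \<in> Weights k"
  shows "\<psi> x \<in> graded_N k F split_iso lam x"
proof -
  define e where "e i = P i x - P (i - 1) x" for i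
  define i' where "i' i = k - i + 1" for i
  have i': "i' i \<in> {1..k}" if "i \<in> {1..k}" for i using that by (auto simp: i'_def)
  have range: "e i *v v \<in> summand k F split_iso i x" if "i \<in> {1..k}" for i v
    unfolding e_def by (rule summandI[OF that])
  have idem: "e i ** e i = e i" if "i \<in> {1..k}" for i
  proof (rule matrix_eqI)
    fix v
    show "(e i ** e i) *v v = e i *v v"
      using summandD[OF that range[OF that, of v] that]
      by (simp add: e_def matrix_vector_mult_diff_rdistrib flip: matrix_vector_mul_assoc)
  qed
  have comm: "e i ** \<theta> x = \<theta> x ** e i" if "i \<in> {1..k}" for i
  proof -
    have "equivariant (P i) (F i)" "equivariant (P (i - 1)) (F (i - 1))" using that by (auto intro!: eqv)
    then show ?thesis by (simp add: e_def equivariant_def matrix_sub_ldistrib matrix_sub_rdistrib)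
  qed
  have tr: "Q x ** e i = transpose (e (i' i)) ** Q x" if i: "i \<in> {1..k}" for i
  proof -
    have "k - i' i + 1 = i" "k - i' i = i - 1" using i by (auto simp: i'_def)
    then have "adj (Q x) (e (i' i)) = e i" using dual_step[OF i'[OF i], of x] by (simp add: e_def)
    then show ?thesis using q_adj[OF nondeg, of x "e (i' i)"] by simp
  qed
  have main: "e i ** \<psi> x = e i ** \<psi> x ** transpose (e (i' i))" if i: "i \<in> {1..k}" for i
  proof -
    have "e i ** \<psi> x ** Q x = e i ** (e i ** \<theta> x)"
      by (simp add: matrix_mul_assoc idem[OF i])
    also have "\<dots> = e i ** \<psi> x ** (Q x ** e i)" unfolding comm[OF i] by (simp add: matrix_mul_assoc)
    also have "\<dots> = e i ** \<psi> x ** transpose (e (i' i)) ** Q x" unfolding tr[OF i] by (simp add: matrix_mul_assoc)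
    finally have *: "e i ** \<psi> x ** Q x ** matrix_inv (Q x) = e i ** \<psi> x ** transpose (e (i' i)) ** Q x ** matrix_inv (Q x)"
      by simp
    have c: "M ** Q x ** matrix_inv (Q x) = M" for M :: "complex ^ 'n ^ 'n"
      using matrix_inv(1)[OF nondeg_invertible[OF nondeg[of x]]] by (simp flip: matrix_mul_assoc)
    show ?thesis using * unfolding c .
  qed
  let ?S = "\<Union> {sym_tensors (summand k F split_iso i x) (summand k F split_iso j x) |i j.
      i \<in> {1..k} \<and> j \<in> {1..k} \<and> lam i + lam j = 0}"
  have sum1: "(\<Sum>i\<in>{1..k}. e i ** \<psi> x) = \<psi> x"
  proof (rule matrix_eqI)
    fix v
    have "(\<Sum>i\<in>I. e i ** \<psi> x) *v v = (\<Sum>i\<in>I. e i *v (\<psi> x *v v))" for I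
      by (induction I rule: infinite_finite_induct)
        (simp_all add: matrix_vector_mult_add_rdistrib matrix_vector_mul_assoc)
    then show "(\<Sum>i\<in>{1..k}. e i ** \<psi> x) *v v = \<psi> x *v v"
      using telescope[of x "\<psi> x *v v"] by (simp add: e_def matrix_vector_mult_diff_rdistrib)
  qed
  \<comment> \<open>Adding the transpose produces the symmetrized products handled by
    \<open>sym_sum_in_span\<close>; the doubling is undone at the end.\<close>
  have "\<psi> x + \<psi> x = (\<Sum>i\<in>{1..k}. e i ** \<psi> x) + transpose (\<Sum>i\<in>{1..k}. e i ** \<psi> x)"
    unfolding sum1 psi_sym ..
  also have "transpose (\<Sum>i\<in>{1..k}. e i ** \<psi> x) = (\<Sum>i\<in>{1..k}. transpose (e i ** \<psi> x))"
    by (simp add: vec_eq_iff transpose_def)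
  also have "(\<Sum>i\<in>{1..k}. e i ** \<psi> x) + \<dots> = (\<Sum>i\<in>{1..k}. e i ** \<psi> x ** transpose (e (i' i)) + e (i' i) ** \<psi> x ** transpose (e i))"
    unfolding sum.distrib[symmetric]
  proof (rule sum.cong[OF refl])
    fix i assume "i \<in> {1..k}"
    note m = main[OF this]
    have "transpose (e i ** \<psi> x) = transpose (e i ** \<psi> x ** transpose (e (i' i)))" by (rule arg_cong[OF m])
    also have "\<dots> = e (i' i) ** \<psi> x ** transpose (e i)"
      by (simp add: matrix_transpose_mul psi_sym matrix_mul_assoc)
    finally have t: "transpose (e i ** \<psi> x) = e (i' i) ** \<psi> x ** transpose (e i)" .
    show "e i ** \<psi> x + transpose (e i ** \<psi> x) =
        e i ** \<psi> x ** transpose (e (i' i)) + e (i' i) ** \<psi> x ** transpose (e i)"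
      by (rule arg_cong2[OF m t])
  qed
  also have "\<dots> \<in> span ?S"
  proof (rule span_sum)
    fix i assume i: "i \<in> {1..k}"
    have "lam i + lam (i' i) = 0" using weights_sym[OF F lam, of i] i by (simp add: i'_def)
    then have "sym_tensors (summand k F split_iso i x) (summand k F split_iso (i' i) x) \<subseteq> ?S"
      using i i'[OF i] by blast
    moreover have "e i ** \<psi> x ** transpose (e (i' i)) + e (i' i) ** \<psi> x ** transpose (e i) \<in>
        span (sym_tensors (summand k F split_iso i x) (summand k F split_iso (i' i) x))"
      by (rule sym_sum_in_span[OF psi_sym range[OF i] range[OF i'[OF i]]])
    ultimately show "e i ** \<psi> x ** transpose (e (i' i)) + e (i' i) ** \<psi> x ** transpose (e i) \<in> span ?S"
      using span_mono by blast
  qed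
  finally have "(1 / 2) *\<^sub>R (\<psi> x + \<psi> x) \<in> span ?S" by (rule span_scale)
  moreover have "(1 / 2) *\<^sub>R (\<psi> x + \<psi> x) = \<psi> x" by (simp add: scaleR_2[symmetric])
  ultimately show ?thesis unfolding graded_N_def by simp
qed

end

section \<open>The criterion for polystability\<close>

lemma polystable_if_complements:
  assumes ss: "semistable A L W Q \<psi>"
    and compl: "\<And>S. hol_subbundle A W S \<Longrightarrow> isotropic Q S \<Longrightarrow> psi_invariant Q \<psi> S \<Longrightarrow> S \<noteq> zero_sub \<Longrightarrow>
      S \<noteq> whole_sub \<Longrightarrow> deg A W S = 0 \<Longrightarrow>
      \<exists>T. hol_subbundle A W T \<and> coisotropic Q T \<and> psi_invariant Q \<psi> T \<and> T \<noteq> zero_sub \<and> splits S T"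
  shows "polystable A L W Q \<psi>"
  unfolding polystable_def
proof (intro conjI allI impI, goal_cases)
  case 1
  show ?case by (rule ss)
next
  case (2 k F lam)
  then have F: "q_filtration A W Q k F" and lam: "lam \<in> Weights k"
    and strict: "\<And>i. 1 \<le> i \<Longrightarrow> i < k \<Longrightarrow> lam i < lam (i + 1)"
    and N: "\<psi> \<in> H0 A L W (N_bundle k F lam)" and d: "weighted_deg A W k F lam = 0" by simp_all
  have inv: "psi_invariant Q \<psi> (F j)" if "1 \<le> j" "j < k" for j
    by (rule jump_invariant[OF F lam that strict[OF that] N])
  have nonneg: "0 \<le> (lam j - lam (j + 1)) * deg A W (F j)" if "1 \<le> j" "j < k" for j
    using ss by (intro weighted_deg_term[OF _ F lam N that]) (simp add: semistable_iff)
  \<comment> \<open>The weighted degree is a vanishing sum of non-negative terms, and strictness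
    makes each weight factor non-zero.\<close>
  have deg0: "deg A W (F j) = 0" if j: "1 \<le> j" "j < k" for j
  proof -
    have nonneg': "0 \<le> (lam j - lam (j + 1)) * deg A W (F j)" if "j \<in> {1..k - 1}" for j
      by (rule nonneg) (use that in auto)
    have "(\<Sum>j\<in>{1..k - 1}. (lam j - lam (j + 1)) * deg A W (F j)) = 0"
      using d by (simp only: weighted_deg_def)
    then have "\<forall>j\<in>{1..k - 1}. (lam j - lam (j + 1)) * deg A W (F j) = 0"
      by (rule sum_nonneg_eq_0_iff[THEN iffD1, rotated 2]) (rule finite_atLeastAtMost, erule nonneg')
    then have "(lam j - lam (j + 1)) * deg A W (F j) = 0" using j by auto
    then show ?thesis using strict[OF j] by simp
  qed
  have compl': "\<exists>T. hol_subbundle A W T \<and> coisotropic Q T \<and> psi_invariant Q \<psi> T \<and> splits (F j) T"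
    if j: "1 \<le> j" "2 * j \<le> k" for j
  proof -
    have "j < k" "j \<le> k" using j by auto
    then have "\<exists>T. hol_subbundle A W T \<and> coisotropic Q T \<and> psi_invariant Q \<psi> T \<and> T \<noteq> zero_sub \<and> splits (F j) T"
      using filtration_proper[OF F, of j] j
      by (intro compl filtration_sub[OF F] filtration_isotropic[OF F] inv deg0) auto
    then show ?thesis by blast
  qed
  obtain P where P: "\<And>j. j \<le> k \<Longrightarrow> equivariant (P j) (F j)"
    "\<And>j x. j \<le> k \<Longrightarrow> P (k - j) x = mat 1 - adj (Q x) (P j x)"
    "\<And>i j x. i \<le> j \<Longrightarrow> j \<le> k \<Longrightarrow> P i x ** P j x = P i x"
    by (rule adapted_projections[OF F inv compl']) (assumption | rule that)+
  let ?\<Phi> = "split_iso k F P"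
  have "\<forall>x. \<forall>i\<in>{1..k}. \<forall>j\<in>{1..k}. i + j \<noteq> k + 1 \<longrightarrow>
      (\<forall>u\<in>summand k F ?\<Phi> i x. \<forall>v\<in>summand k F ?\<Phi> j x. pairing (Q x) u v = 0)"
    using summands_orthogonal[OF F P] by simp
  moreover have "\<psi> \<in> H0 A L W (graded_N k F ?\<Phi> lam)"
    unfolding in_H0 using psi_in_graded_N[OF F P lam] by simp
  ultimately show ?case
    using split_graded_iso[OF F P] by (intro exI[of _ ?\<Phi>] conjI)
qed

lemma polystable_iff:
  "polystable A L W Q \<psi> \<longleftrightarrow> semistable A L W Q \<psi> \<and>
     (\<forall>S. hol_subbundle A W S \<and> isotropic Q S \<and> psi_invariant Q \<psi> S \<and> S \<noteq> zero_sub \<and> S \<noteq> whole_sub \<and>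
        deg A W S = 0 \<longrightarrow>
        (\<exists>T. hol_subbundle A W T \<and> coisotropic Q T \<and> psi_invariant Q \<psi> T \<and> T \<noteq> zero_sub \<and> splits S T)) \<and>
     (\<forall>S. hol_subbundle A W S \<and> coisotropic Q S \<and> psi_invariant Q \<psi> S \<and> S \<noteq> zero_sub \<and> S \<noteq> whole_sub \<and>
        deg A W S = 0 \<longrightarrow>
        (\<exists>T. hol_subbundle A W T \<and> isotropic Q T \<and> psi_invariant Q \<psi> T \<and> T \<noteq> zero_sub \<and> splits S T))"
    (is "_ \<longleftrightarrow> _ \<and> ?iso \<and> ?coiso")
proof (intro iffI conjI)
  assume ps: "polystable A L W Q \<psi>"
  show "semistable A L W Q \<psi>" using ps by (simp add: polystable_def)
  show ?iso
  proof (intro allI impI, elim conjE)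
    fix S assume "hol_subbundle A W S" "isotropic Q S" "psi_invariant Q \<psi> S" "S \<noteq> zero_sub" "deg A W S = 0"
    then show "\<exists>T. hol_subbundle A W T \<and> coisotropic Q T \<and> psi_invariant Q \<psi> T \<and> T \<noteq> zero_sub \<and> splits S T"
      by (rule polystable_complement[OF ps])
  qed
  \<comment> \<open>Reduced to the isotropic case: if T is a complement of the orthogonal of S, then
    the orthogonal of T is a complement of S.\<close>
  show ?coiso
  proof (intro allI impI, elim conjE)
    fix S assume S: "hol_subbundle A W S" "coisotropic Q S" "psi_invariant Q \<psi> S" "S \<noteq> zero_sub"
      "S \<noteq> whole_sub" "deg A W S = 0"
    have 1: "isotropic Q (perp Q S)" using S(2) by (simp add: isotropic_iff coisotropic_iff perp_perp[OF S(1)])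
    have 2: "perp Q S \<noteq> zero_sub" using perp_eq_zero[OF S(1)] S(5) by simp
    have 3: "deg A W (perp Q S) = 0" using deg_perp'[OF S(1,4,5)] S(6) by simp
    obtain T where T: "hol_subbundle A W T" "coisotropic Q T" "psi_invariant Q \<psi> T"
      "T \<noteq> zero_sub" "splits (perp Q S) T"
      using polystable_complement[OF ps subbundle_perp[OF S(1)] 1 psi_invariant_perp[OF S(3)] 2 3]
      by (elim exE conjE) (rule that)
    have sp: "splits S (perp Q T)"
      using perp_splits[OF subbundle_perp[OF S(1)] T(1,5)] by (simp add: perp_perp[OF S(1)])
    show "\<exists>T. hol_subbundle A W T \<and> isotropic Q T \<and> psi_invariant Q \<psi> T \<and> T \<noteq> zero_sub \<and> splits S T"
    proof (intro exI conjI)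
      show "hol_subbundle A W (perp Q T)" by (rule subbundle_perp[OF T(1)])
      show "isotropic Q (perp Q T)" using T(2) by (simp add: isotropic_iff coisotropic_iff perp_perp[OF T(1)])
      show "psi_invariant Q \<psi> (perp Q T)" by (rule psi_invariant_perp[OF T(3)])
      show "perp Q T \<noteq> zero_sub" by (rule splits_neq_zero[OF sp S(5)])
      show "splits S (perp Q T)" by (rule sp)
    qed
  qed
next
  assume a: "semistable A L W Q \<psi> \<and> ?iso \<and> ?coiso"
  show "polystable A L W Q \<psi>"
  proof (rule polystable_if_complements)
    show "semistable A L W Q \<psi>" by (rule a[THEN conjunct1])
    fix S assume "hol_subbundle A W S" "isotropic Q S" "psi_invariant Q \<psi> S" "S \<noteq> zero_sub" "S \<noteq> whole_sub"
      "deg A W S = 0"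
    then show "\<exists>T. hol_subbundle A W T \<and> coisotropic Q T \<and> psi_invariant Q \<psi> T \<and> T \<noteq> zero_sub \<and> splits S T"
      by (intro a[THEN conjunct2, THEN conjunct1, THEN spec, THEN mp] conjI)
  qed
qed

end

theorem theorem4p17:
  fixes A :: "('x::t2_space) atlas"
    and L :: "('x, 1) vbundle"
    and W :: "('x, 'n::finite) vbundle"
    and Q \<psi> :: "'x \<Rightarrow> complex ^ 'n ^ 'n"
  assumes "compact_riemann_surface A"
    and "hol_vbundle A L"
    and "higgs_pair A L W Q \<psi>"
  shows
    "(semistable A L W Q \<psi> \<longleftrightarrow>
        (\<forall>W'. hol_subbundle A W W' \<and> isotropic Q W' \<and> psi_invariant Q \<psi> W' \<longrightarrow> deg A W W' \<le> 0)) \<and>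
     (stable A L W Q \<psi> \<longleftrightarrow>
        semistable A L W Q \<psi> \<and>
        (\<forall>W'. hol_subbundle A W W' \<and> isotropic Q W' \<and> psi_invariant Q \<psi> W' \<and>
              W' \<noteq> zero_sub \<and> W' \<noteq> whole_sub \<longrightarrow> deg A W W' < 0)) \<and>
     (polystable A L W Q \<psi> \<longleftrightarrow>
        semistable A L W Q \<psi> \<and>
        (\<forall>W'. hol_subbundle A W W' \<and> isotropic Q W' \<and> psi_invariant Q \<psi> W' \<and>
              W' \<noteq> zero_sub \<and> W' \<noteq> whole_sub \<and> deg A W W' = 0 \<longrightarrow>
              (\<exists>W''. hol_subbundle A W W'' \<and> coisotropic Q W'' \<and> psi_invariant Q \<psi> W'' \<and>
                     W'' \<noteq> zero_sub \<and> splits W' W'')) \<and>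
        (\<forall>W'. hol_subbundle A W W' \<and> coisotropic Q W' \<and> psi_invariant Q \<psi> W' \<and>
              W' \<noteq> zero_sub \<and> W' \<noteq> whole_sub \<and> deg A W W' = 0 \<longrightarrow>
              (\<exists>W''. hol_subbundle A W W'' \<and> isotropic Q W'' \<and> psi_invariant Q \<psi> W'' \<and>
                     W'' \<noteq> zero_sub \<and> splits W' W'')))"
proof -
  have *: "hol_vbundle A W" "hol_nondeg_quadratic_form A W Q" "hol_section_LS2 A L W \<psi>"
    using assms(3) by (simp_all add: higgs_pair_def)
  have hb: "higgs_bundle A W Q L \<psi>"
    by (rule higgs_bundle.intro[OF quadratic_bundle.intro[OF riemann_surface.intro
          quadratic_bundle_axioms.intro] higgs_bundle_axioms.intro]) (rule assms(1) *)+
  show ?thesis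
    by (rule conjI[OF higgs_bundle.semistable_iff[OF hb, unfolded higgs_bundle.slope_condition_def[OF hb]]
          conjI[OF higgs_bundle.stable_iff[OF hb] higgs_bundle.polystable_iff[OF hb]]])
qed

end
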